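(* Let $B$ be an $(n,n-1)$-blocker of a convex $n$-gon with vertices $0,\dots,n-1$ (indices mod $n$) which contains at least one vertex $u$ with $\deg_B(u)=2$ and $(u-1,u+1)\notin B$. Then, up to a cyclic rotation of the labels, $B$ is of one of the following three types. Type 1: $B=B_{\mathrm{Sea}}\cup B_1\cup B_2$, where for some $4\le m\le n-3$ and $2<\ell<m$: $B_{\mathrm{Sea}}=\{(\ell-2,\ell),(\ell-2,\ell+1),(\ell-1,\ell+2),(\ell,\ell+2)\}$; $B_1=\{(0,2),\dots,(\ell-3,\ell-1),(\ell+1,\ell+3),\dots,(m,m+2)\}$; $B_2=\{(m+3,i_1),\dots,(n-1,i_{n-3-m})\}$ with all $i_j\in\{1,\dots,\ell-1,\ell+1,\dots,m+1\}$, such that whenever $|i_{j_1}-i_{j_2}|\ge2$, $(m+2+j_1,i_{j_1})$ and $(m+2+j_2,i_{j_2})$ do not cross. Type 2: $B=B_{\mathrm{Buf}}\cup B_1\cup B_2$, where for some $5\le m\le n-3$ and $2<\ell<m-1$: $B_{\mathrm{Buf}}=\{(\ell-2,\ell),(\ell-2,\ell+1),(\ell-1,\ell+2),(\ell,\ell+3),(\ell+1,\ell+3)\}$; $B_1=\{(0,2),\dots,(\ell-3,\ell-1),(\ell+2,\ell+4),\dots,(m,m+2)\}$; $B_2=\{(m+3,i_1),\dots,(n-1,i_{n-3-m})\}$ with all $i_j\in\{1,\dots,\ell-1,\ell+2,\dots,m+1\}$, such that whenever $|i_{j_1}-i_{j_2}|\ge2$, $(m+2+j_1,i_{j_1})$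 and $(m+2+j_2,i_{j_2})$ do not cross. Type 3: $B=B_{\mathrm{Bouq}}\cup B_{1,L}\cup B_{1,R}\cup B_{2,L}\cup B_{2,R}$, where for integers with $0<\ell<m+2<k<k+1<k+t\le n-1$: $B_{\mathrm{Bouq}}=\{(\ell-1,\ell+1),(k,\ell-1),(k+t,\ell+1),(k,k+t),(k+1,\ell),\dots,(k+t-1,\ell)\}$; $B_{1,L}=\{(\ell,\ell+2),\dots,(m,m+2)\}$ if $\ell<m+1$, $\emptyset$ if $\ell=m+1$; $B_{1,R}=\{(0,2),\dots,(\ell-2,\ell)\}$ if $\ell>1$, $\emptyset$ if $\ell=1$; $B_{2,L}=\{(m+3,i_1),\dots,(k-1,i_{k-m-3})\}$ if $k>m+3$, $\emptyset$ if $k=m+3$; $B_{2,R}=\{(k+t+1,i_{k+t-m-1}),\dots,(n-1,i_{n-3-m})\}$ if $k+t<n-1$, $\emptyset$ if $k+t=n-1$; with $i_1,\dots,i_{k-m-3}\in\{\ell,\dots,m+1\}$, $i_{k+t-m-1},\dots,i_{n-3-m}\in\{1,\dots,\ell\}$, and whenever $|i_{j_1}-i_{j_2}|\ge2$, $(m+2+j_1,i_{j_1})$ and $(m+2+j_2,i_{j_2})$ do not cross.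
   Context: An edge $(i,j)$ is the segment between vertices $i,j$ of the convex polygon; sides are $(i,i+1)$ and diagonals are the other edges. Two edges cross if they share an interior point. A triangulation is a maximal set of pairwise non-crossing diagonals. A blocker is a set $B$ of diagonals having a diagonal in common with every triangulation; it is saturated if for every $e\in B$, $B\setminus\{e\}$ is not a blocker. An $(n,k)$-blocker is a saturated blocker of size $k$ for a convex $n$-gon. $\deg_B(u)$ is the number of edges of $B$ incident to $u$. *)

theory Defs
  imports Main
begin

text \<open>Convex n-gon with vertices 0,...,n-1 in cyclic order. An edge is a 2-element set of vertices.\<close>

type_synonym edge = "nat set"

definition is_side :: "nat \<Rightarrow> edge \<Rightarrow> bool" where
  "is_side n e \<longleftrightarrow> (\<exists>i<n. e = {i, (i + 1) mod n})"

definition is_edge :: "nat \<Rightarrow> edge \<Rightarrow> bool" where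
  "is_edge n e \<longleftrightarrow> (\<exists>i j. i < j \<and> j < n \<and> e = {i, j})"

definition diagonals :: "nat \<Rightarrow> edge set" where
  "diagonals n = {e. is_edge n e \<and> \<not> is_side n e}"

text \<open>Two edges of a convex polygon share an interior point iff their four endpoints are
  distinct and interleave in the cyclic order (for distinct edges).\<close>
definition crosses :: "edge \<Rightarrow> edge \<Rightarrow> bool" where
  "crosses e f \<longleftrightarrow>
     (\<exists>a b c d. e = {a, b} \<and> f = {c, d} \<and> a < c \<and> c < b \<and> b < d) \<or>
     (\<exists>a b c d. f = {a, b} \<and> e = {c, d} \<and> a < c \<and> c < b \<and> b < d)"

definition triangulation :: "nat \<Rightarrow> edge set \<Rightarrow> bool" where
  "triangulation n T \<longleftrightarrow>
     T \<subseteq> diagonals n \<and>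
     (\<forall>e\<in>T. \<forall>f\<in>T. \<not> crosses e f) \<and>
     (\<forall>d\<in>diagonals n. d \<notin> T \<longrightarrow> (\<exists>e\<in>T. crosses d e))"

definition blocker :: "nat \<Rightarrow> edge set \<Rightarrow> bool" where
  "blocker n B \<longleftrightarrow> B \<subseteq> diagonals n \<and> (\<forall>T. triangulation n T \<longrightarrow> B \<inter> T \<noteq> {})"

definition saturated_blocker :: "nat \<Rightarrow> edge set \<Rightarrow> bool" where
  "saturated_blocker n B \<longleftrightarrow> blocker n B \<and> (\<forall>e\<in>B. \<not> blocker n (B - {e}))"

definition nk_blocker :: "nat \<Rightarrow> nat \<Rightarrow> edge set \<Rightarrow> bool" where
  "nk_blocker n k B \<longleftrightarrow> saturated_blocker n B \<and> card B = k"

definition deg :: "edge set \<Rightarrow> nat \<Rightarrow> nat" where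
  "deg B u = card {e\<in>B. u \<in> e}"

definition rotate_edges :: "nat \<Rightarrow> nat \<Rightarrow> edge set \<Rightarrow> edge set" where
  "rotate_edges n r B = (\<lambda>e. (\<lambda>x. (x + r) mod n) ` e) ` B"

definition short_diags :: "nat \<Rightarrow> nat \<Rightarrow> edge set" where
  "short_diags lo hi = {{a, a + 2} | a. lo \<le> a \<and> a \<le> hi}"

definition fan_edges :: "nat \<Rightarrow> (nat \<Rightarrow> nat) \<Rightarrow> nat set \<Rightarrow> edge set" where
  "fan_edges m i J = {{m + 2 + j, i j} | j. j \<in> J}"

definition fan_ok :: "nat \<Rightarrow> (nat \<Rightarrow> nat) \<Rightarrow> nat set \<Rightarrow> bool" where
  "fan_ok m i J \<longleftrightarrow> (\<forall>j1\<in>J. \<forall>j2\<in>J.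
      (i j2 + 2 \<le> i j1 \<or> i j1 + 2 \<le> i j2) \<longrightarrow> \<not> crosses {m + 2 + j1, i j1} {m + 2 + j2, i j2})"

definition type1 :: "nat \<Rightarrow> edge set \<Rightarrow> bool" where
  "type1 n B \<longleftrightarrow> (\<exists>m l i. 4 \<le> m \<and> m \<le> n - 3 \<and> 2 < l \<and> l < m \<and>
      (\<forall>j\<in>{1..n-3-m}. i j \<in> {1..l-1} \<union> {l+1..m+1}) \<and>
      fan_ok m i {1..n-3-m} \<and>
      B = {{l-2, l}, {l-2, l+1}, {l-1, l+2}, {l, l+2}}
          \<union> (short_diags 0 (l-3) \<union> short_diags (l+1) m)
          \<union> fan_edges m i {1..n-3-m})"

definition type2 :: "nat \<Rightarrow> edge set \<Rightarrow> bool" where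
  "type2 n B \<longleftrightarrow> (\<exists>m l i. 5 \<le> m \<and> m \<le> n - 3 \<and> 2 < l \<and> l + 1 < m \<and>
      (\<forall>j\<in>{1..n-3-m}. i j \<in> {1..l-1} \<union> {l+2..m+1}) \<and>
      fan_ok m i {1..n-3-m} \<and>
      B = {{l-2, l}, {l-2, l+1}, {l-1, l+2}, {l, l+3}, {l+1, l+3}}
          \<union> (short_diags 0 (l-3) \<union> short_diags (l+2) m)
          \<union> fan_edges m i {1..n-3-m})"

definition type3 :: "nat \<Rightarrow> edge set \<Rightarrow> bool" where
  "type3 n B \<longleftrightarrow> (\<exists>m l k t i. 0 < l \<and> l < m + 2 \<and> m + 2 < k \<and> k + 1 < k + t \<and> k + t \<le> n - 1 \<and>
      (\<forall>j\<in>{1..k-m-3}. i j \<in> {l..m+1}) \<and>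
      (\<forall>j\<in>{k+t-m-1..n-3-m}. i j \<in> {1..l}) \<and>
      fan_ok m i ({1..k-m-3} \<union> {k+t-m-1..n-3-m}) \<and>
      B = ({{l-1, l+1}, {k, l-1}, {k+t, l+1}, {k, k+t}} \<union> {{k+s, l} | s. 1 \<le> s \<and> s \<le> t - 1})
          \<union> {{a, a + 2} | a. l \<le> a \<and> a \<le> m}
          \<union> {{a, a + 2} | a. a + 2 \<le> l}
          \<union> fan_edges m i {1..k-m-3}
          \<union> fan_edges m i {k+t-m-1..n-3-m})"

end

(*
  Removing an ear u, a vertex whose short diagonal (u-1,u+1) is not in B, leaves a blocker of the
  remaining polygon, and a blocker of an N-gon has at least N-2 edges. So if u has degree two, the
  remaining n-3 edges of B form a blocker of minimum size of an (n-1)-gon.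

  A blocker of minimum size consists of the short diagonals of an arc A together with one edge from
  each vertex x outside A to an interior vertex A ! h x of A. This is proved by removing an ear:
  in a blocker of minimum size every ear has degree one, and no edge joins two ears. Conversely such
  a set blocks as soon as the edges from outside A cross only if their ends in A are neighbours,
  because removing an ear of a triangulation preserves this shape.

  It remains to insert u. Saturation forbids that one of the two edges at u alone completes such a
  shape; every other configuration that is not of the three types is refuted either by a
  triangulation avoiding B, mostly a zigzag of two fans, or by counting the edges at one or two
  successive ears. If u is inserted outside the arc, or next to one of its ends, B is of type 3;
  in the interior of the arc all three types occur.
*)
theory Submission
  imports Defs
begin

section \<open>Polygons as cyclic lists and their triangulations\<close>

text \<open>The counting is driven by slack. A blocked polygon with N vertices needs N - 2 edges.
  The polygon \<open>ys\<close> without u meets this bound exactly, and the whole polygon exceeds it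
  by one. So in the minimum case deleting an ear costs one edge; in the final case one ear costs at
  most two edges and two successive ears at most three. A configuration is therefore excluded by
  finding an ear that has too many edges or whose removal isolates another vertex, since an isolated
  vertex gives a fan triangulation. Blocking and saturation pull in opposite directions. Against
  blocking a triangulation must be built; against saturation one shows that B without an edge still
  blocks, which is the purpose of \<open>fan_block\<close>. The condition on crossings is not part
  of \<open>arc_fan\<close>; it is recovered afterwards in \<open>h_almost_decreasing\<close>.
  Polygons are lists up to rotation. The place of an inserted vertex is then a split of a list,
  indices wrap only in the final conversion, and reversing the list halves the case
  analyses.\<close>

definition cyc :: "'a list \<Rightarrow> 'a list \<Rightarrow> bool" where
  "cyc xs ys \<longleftrightarrow> (\<exists>us vs. xs = us @ vs \<and> ys = vs @ us)"

lemma cyc_append [simp]: "cyc (us @ vs) (vs @ us)"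
  unfolding cyc_def by blast

lemma cyc_iff_rotate: "cyc xs ys \<longleftrightarrow> (\<exists>k. ys = rotate k xs)"
proof
  assume "cyc xs ys"
  then obtain us vs where "xs = us @ vs" "ys = vs @ us" unfolding cyc_def by blast
  then have "ys = rotate (length us) xs" by (simp add: rotate_append)
  then show "\<exists>k. ys = rotate k xs" ..
next
  assume "\<exists>k. ys = rotate k xs"
  then obtain k where "ys = rotate k xs" ..
  then have "ys = drop (k mod length xs) xs @ take (k mod length xs) xs"
    by (simp add: rotate_drop_take)
  then show "cyc xs ys" unfolding cyc_def by (metis append_take_drop_id)
qed

lemma cyc_refl [simp]: "cyc xs xs"
  unfolding cyc_def by (metis append_Nil append_Nil2)

lemma cyc_sym: "cyc xs ys \<Longrightarrow> cyc ys xs"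
  unfolding cyc_def by blast

lemma cyc_trans [trans]: "cyc xs ys \<Longrightarrow> cyc ys zs \<Longrightarrow> cyc xs zs"
  unfolding cyc_iff_rotate by (metis rotate_rotate)

lemma cyc_set: "cyc xs ys \<Longrightarrow> set ys = set xs"
  unfolding cyc_def by auto

lemma cyc_length: "cyc xs ys \<Longrightarrow> length ys = length xs"
  unfolding cyc_def by auto

lemma cyc_distinct: "cyc xs ys \<Longrightarrow> distinct ys = distinct xs"
  unfolding cyc_def by auto

lemma cyc_rev: "cyc xs ys \<Longrightarrow> cyc (rev xs) (rev ys)"
  unfolding cyc_def by (metis rev_append)

lemma cyc_Cons_snoc [simp]: "cyc (x # xs) (xs @ [x])"
  using cyc_append[of "[x]" xs] by simp

lemma cyc_Cons_split:
  assumes "cyc (w # ys) zs"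
  obtains pre post where "zs = pre @ w # post" "ys = post @ pre"
proof -
  obtain us vs where 1: "w # ys = us @ vs" "zs = vs @ us"
    using assms unfolding cyc_def by blast
  show thesis
  proof (cases us)
    case Nil
    then show thesis using 1 that[of "[]" ys] by simp
  next
    case (Cons a us')
    then show thesis using 1 that[of vs us'] by simp
  qed
qed

lemma cyc_move: "x \<in> set xs \<Longrightarrow> \<exists>ys. cyc xs (x # ys)"
  by (metis append_Cons cyc_append split_list)

text \<open>A list stands for the convex polygon with these vertices in cyclic order. Both predicates say
  that it has a triangulation avoiding B. The chord rule of the first is suited for constructing
  triangulations, the ear rule of the second for refuting them. No equivalence is needed: each is
  related to \<open>triangulation\<close> in one direction.\<close>

inductive tri :: "'a set set \<Rightarrow> 'a list \<Rightarrow> bool" for B where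
  tri_base: "length xs \<le> 3 \<Longrightarrow> tri B xs"
| tri_chord: "\<lbrakk>tri B (a # xs @ [b]); tri B (b # ys @ [a]); {a, b} \<notin> B; xs \<noteq> []; ys \<noteq> []\<rbrakk>
    \<Longrightarrow> tri B (a # xs @ b # ys)"
| tri_rot: "tri B (xs @ ys) \<Longrightarrow> tri B (ys @ xs)"

inductive etri :: "'a set set \<Rightarrow> 'a list \<Rightarrow> bool" for B where
  etri_base: "length xs \<le> 3 \<Longrightarrow> etri B xs"
| etri_ear: "\<lbrakk>etri B ys; {hd ys, last ys} \<notin> B\<rbrakk> \<Longrightarrow> etri B (w # ys)"
| etri_rot: "etri B (xs @ ys) \<Longrightarrow> etri B (ys @ xs)"

lemma tri_cyc: "tri B xs \<Longrightarrow> cyc xs ys \<Longrightarrow> tri B ys"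
  unfolding cyc_def by (auto intro: tri_rot)

text \<open>The rule \<open>tri_chord\<close> is kept for genuine diagonals, as gluing requires. If
  one side of the chord is empty, the chord is a side of the polygon and the other part is already
  the whole polygon up to rotation.\<close>

lemma tri_split:
  assumes "tri B (a # xs @ [b])" "tri B (b # ys @ [a])" "{a, b} \<notin> B"
  shows "tri B (a # xs @ b # ys)"
proof (cases "xs = [] \<or> ys = []")
  case True
  then show ?thesis
  proof
    assume "xs = []"
    then show ?thesis using tri_rot[of B "b # ys" "[a]"] assms(2) by simp
  next
    assume "ys = []"
    then show ?thesis using assms(1) by simp
  qed
next
  case False
  then show ?thesis using assms by (auto intro!: tri_chord[of B a xs b ys])
qed

lemma tri_rev: "tri B xs \<Longrightarrow> tri B (rev xs)"
proof (induction rule: tri.induct)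
  case (tri_base xs)
  then show ?case by (simp add: tri.tri_base)
next
  case (tri_chord a xs b ys)
  have "tri B (a # rev ys @ b # rev xs)"
    using tri_chord by (auto intro!: tri.tri_chord[of B a "rev ys" b "rev xs"])
  then show ?case using tri_rot[of B "[a]" "rev ys @ b # rev xs"] by simp
next
  case (tri_rot xs ys)
  then show ?case using tri.tri_rot[of B "rev ys" "rev xs"] by simp
qed

lemma etri_rev: "etri B xs \<Longrightarrow> etri B (rev xs)"
proof (induction rule: etri.induct)
  case (etri_base xs)
  then show ?case by (simp add: etri.etri_base)
next
  case (etri_ear ys w)
  have "etri B (w # rev ys)"
    using etri_ear
    by (metis etri.etri_ear hd_rev insert_commute last_rev)
  then show ?case using etri_rot[of B "[w]" "rev ys"] by simp
next
  case (etri_rot xs ys)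
  then show ?case using etri.etri_rot[of B "rev ys" "rev xs"] by simp
qed

text \<open>A fan: all diagonals at \<open>x\<close>. The triangle \<open>x\<close>,
  \<open>a\<close>, \<open>b\<close> is cut off by the chord from \<open>x\<close> to
  \<open>b\<close>, and induction handles the rest.\<close>

lemma tri_isolated:
  "\<forall>y\<in>set ys. {x, y} \<notin> B \<Longrightarrow> tri B (x # ys)"
proof (induction "length ys" arbitrary: ys rule: less_induct)
  case less
  show ?case
  proof (cases "length ys \<le> 2")
    case True
    then show ?thesis by (intro tri_base) auto
  next
    case False
    then obtain a b zs where ys: "ys = a # b # zs"
      by (cases ys; cases "tl ys"; auto)
    have "tri B (x # b # zs)" using less ys by auto
    then have 2: "tri B (b # zs @ [x])" using tri_rot[of B "[x]" "b # zs"] by simp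
    have "tri B (x # [a] @ b # zs)"
      by (rule tri_split) (use less.prems ys 2 in \<open>auto intro: tri_base\<close>)
    then show ?thesis using ys by simp
  qed
qed

text \<open>The chord between the two neighbours of \<open>w\<close> cuts off the triangle at
  \<open>w\<close>.\<close>

lemma tri_ear:
  assumes "tri B ys" "{hd ys, last ys} \<notin> B"
  shows "tri B (w # ys)"
proof (cases "length ys \<le> 2")
  case True
  then show ?thesis by (intro tri_base) auto
next
  case False
  then obtain b zs a where ys: "ys = b # zs @ [a]"
    by (cases ys; cases "tl ys" rule: rev_cases; auto)
  have "tri B (a # [w] @ b # zs)"
    by (rule tri_split) (use assms ys in \<open>auto intro: tri_base simp: insert_commute\<close>)
  then show ?thesis using ys tri_rot[of B "[a]" "w # b # zs"] by simp
qed

lemma tri_isolated_cyc: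
  assumes "cyc xs (x # ys)" "\<forall>y\<in>set ys. {x, y} \<notin> B"
  shows "tri B xs"
  using tri_cyc[OF tri_isolated[OF assms(2)] cyc_sym[OF assms(1)]] .

text \<open>The triangle z, p, q together with fans at p and q.\<close>

lemma tri_zigzag:
  assumes p: "\<forall>x\<in>set (z # X @ Y @ [q]). {p, x} \<notin> B"
    and q: "\<forall>x\<in>set (W @ [z]). {q, x} \<notin> B"
  shows "tri B (z # X @ p # Y @ q # W)"
proof -
  have zX: "tri B (z # X @ [p])"
    by (rule tri_isolated_cyc[of _ p "z # X"]) (use p cyc_append[of "z # X" "[p]"] in auto)
  have "tri B (p # Y @ [q, z])" by (rule tri_isolated) (use p in auto)
  then have zpq: "tri B (z # (p # Y) @ [q])"
    using tri_rot[of B "p # Y @ [q]" "[z]"] by simp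
  have qz: "tri B (q # W @ [z])" by (rule tri_isolated) (use q in auto)
  have "{z, q} \<notin> B" using q by (auto simp: insert_commute)
  from tri_split[OF zpq qz this] have "tri B (p # (Y @ q # W) @ [z])"
    using tri_rot[of B "[z]" "p # Y @ q # W"] by simp
  moreover have "{z, p} \<notin> B" using p by (auto simp: insert_commute)
  ultimately show ?thesis
    using tri_split[OF zX, of "Y @ q # W"] by simp
qed

section \<open>Geometric triangulations of polygons on a set of natural numbers\<close>

definition diag_in :: "nat set \<Rightarrow> nat \<Rightarrow> nat \<Rightarrow> bool" where
  "diag_in V p q \<longleftrightarrow> p \<in> V \<and> q \<in> V \<and> p < q \<and>
     (\<exists>x\<in>V. p < x \<and> x < q) \<and> (\<exists>x\<in>V. x < p \<or> q < x)"

text \<open>Relative to a vertex set because splitting along a chord and cutting off an ear lead to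
  polygons whose labels have gaps; maximality must then refer to the diagonals of the smaller
  polygon.\<close>

definition triangulation_on :: "nat set \<Rightarrow> edge set \<Rightarrow> bool" where
  "triangulation_on V T \<longleftrightarrow>
     (\<forall>e\<in>T. \<exists>p q. diag_in V p q \<and> e = {p, q}) \<and>
     (\<forall>e\<in>T. \<forall>f\<in>T. \<not> crosses e f) \<and>
     (\<forall>p q. diag_in V p q \<longrightarrow> {p, q} \<notin> T \<longrightarrow> (\<exists>e\<in>T. crosses {p, q} e))"

lemma crosses_doubleton:
  assumes "a < b" "c < d"
  shows "crosses {a, b} {c, d} \<longleftrightarrow> a < c \<and> c < b \<and> b < d \<or> c < a \<and> a < d \<and> d < b"
proof
  show "crosses {a, b} {c, d} \<Longrightarrow> a < c \<and> c < b \<and> b < d \<or> c < a \<and> a < d \<and> d < b"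
    unfolding crosses_def using assms by (auto simp: doubleton_eq_iff)
qed (unfold crosses_def, blast)

lemma diagonals_eq:
  assumes "n \<ge> 3"
  shows "diagonals n = {{p, q} | p q. diag_in {0..<n} p q}"
proof -
  have side: "is_side n {p, q} \<longleftrightarrow> q = Suc p \<or> p = 0 \<and> q = n - 1" if "p < q" "q < n" for p q
  proof
    assume "is_side n {p, q}"
    then obtain i where i: "i < n" "{p, q} = {i, (i + 1) mod n}" unfolding is_side_def by blast
    then show "q = Suc p \<or> p = 0 \<and> q = n - 1"
      using that by (cases "i + 1 = n") (auto simp: doubleton_eq_iff)
  next
    assume "q = Suc p \<or> p = 0 \<and> q = n - 1"
    then show "is_side n {p, q}"
    proof
      assume "q = Suc p"
      then show ?thesis unfolding is_side_def using that by (intro exI[of _ p]) auto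
    next
      assume "p = 0 \<and> q = n - 1"
      then show ?thesis unfolding is_side_def using that assms
        by (intro exI[of _ "n - 1"]) (auto simp: insert_commute)
    qed
  qed
  have diag: "diag_in {0..<n} p q \<longleftrightarrow> p < q \<and> q < n \<and> \<not> (q = Suc p \<or> p = 0 \<and> q = n - 1)" for p q
  proof
    assume *: "p < q \<and> q < n \<and> \<not> (q = Suc p \<or> p = 0 \<and> q = n - 1)"
    have "\<exists>x\<in>{0..<n}. p < x \<and> x < q" using * by (intro bexI[of _ "Suc p"]) auto
    moreover have "\<exists>x\<in>{0..<n}. x < p \<or> q < x"
    proof (cases "p = 0")
      case True
      then show ?thesis using * by (intro bexI[of _ "n - 1"]) auto
    next
      case False
      then show ?thesis using * by (intro bexI[of _ 0]) auto
    qed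
    ultimately show "diag_in {0..<n} p q" unfolding diag_in_def using * by auto
  qed (auto simp: diag_in_def)
  show ?thesis
    unfolding diagonals_def is_edge_def diag using side by blast
qed

lemma triangulation_iff:
  assumes "n \<ge> 3"
  shows "triangulation n T \<longleftrightarrow> triangulation_on {0..<n} T"
  unfolding triangulation_def triangulation_on_def diagonals_eq[OF assms] by blast

text \<open>A diagonal of \<open>V\<close> other than the chord either has both ends on one side of
  it and is a diagonal of that part, or it crosses the chord. This gives maximality of the
  union.\<close>

lemma triangulation_on_glue:
  assumes ab: "diag_in V a b"
    and T1: "triangulation_on {x\<in>V. a \<le> x \<and> x \<le> b} T1"
    and T2: "triangulation_on {x\<in>V. x \<le> a \<or> b \<le> x} T2"
  shows "triangulation_on V (insert {a, b} (T1 \<union> T2))"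
proof -
  let ?V1 = "{x\<in>V. a \<le> x \<and> x \<le> b}" and ?V2 = "{x\<in>V. x \<le> a \<or> b \<le> x}"
  have d: "a < b" "a \<in> V" "b \<in> V" using ab unfolding diag_in_def by auto
  have T1d: "\<exists>p q. diag_in ?V1 p q \<and> e = {p, q}" if "e \<in> T1" for e
    using T1 that unfolding triangulation_on_def by blast
  have T2d: "\<exists>p q. diag_in ?V2 p q \<and> e = {p, q}" if "e \<in> T2" for e
    using T2 that unfolding triangulation_on_def by blast
  have in1: "diag_in V p q" if "diag_in ?V1 p q" for p q
    using that unfolding diag_in_def by auto
  have in2: "diag_in V p q" if "diag_in ?V2 p q" for p q
    using that unfolding diag_in_def by auto
  have sym: "crosses e f = crosses f e" for e f unfolding crosses_def by blast
  have c12: "\<not> crosses e f" if ef: "e \<in> insert {a, b} T1" "f \<in> insert {a, b} T2" for e f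
  proof -
    obtain p q where pq: "e = {p, q}" "p < q" "a \<le> p" "q \<le> b"
    proof (cases "e = {a, b}")
      case False
      then obtain p q where "diag_in ?V1 p q" "e = {p, q}" using T1d ef by blast
      then show ?thesis using that unfolding diag_in_def by auto
    qed (use that d in auto)
    obtain r s where rs: "f = {r, s}" "r < s" "r \<le> a \<or> b \<le> r" "s \<le> a \<or> b \<le> s"
    proof (cases "f = {a, b}")
      case False
      then obtain r s where "diag_in ?V2 r s" "f = {r, s}" using T2d ef by blast
      then show ?thesis using that unfolding diag_in_def by auto
    qed (use that d in auto)
    show ?thesis using pq rs by (auto simp: crosses_doubleton)
  qed
  have c11: "\<not> crosses e f" if "e \<in> T1" "f \<in> T1" for e f
    using T1 that unfolding triangulation_on_def by blast
  have c22: "\<not> crosses e f" if "e \<in> T2" "f \<in> T2" for e f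
    using T2 that unfolding triangulation_on_def by blast
  have max: "\<exists>e\<in>insert {a, b} (T1 \<union> T2). crosses {p, q} e"
    if pq: "diag_in V p q" "{p, q} \<notin> insert {a, b} (T1 \<union> T2)" for p q
  proof -
    have pq': "p < q" "p \<in> V" "q \<in> V" "\<not> (p = a \<and> q = b)"
      using pq unfolding diag_in_def by auto
    obtain x y where x: "x \<in> V" "p < x" "x < q" and y: "y \<in> V" "y < p \<or> q < y"
      using pq unfolding diag_in_def by auto
    \<comment> \<open>All positions relative to \<open>a < b\<close>. In the last two the ends lie
      strictly on different sides, so the chord itself is crossed.\<close>
    consider "a \<le> p" "q \<le> b" | "q \<le> a" | "b \<le> p" | "p \<le> a" "b \<le> q" |
       "p < a" "a < q" "q < b" | "a < p" "p < b" "b < q"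
      by linarith
    then show ?thesis
    proof cases
      case 1
      have "\<exists>x\<in>?V1. p < x \<and> x < q" by (rule bexI[of _ x]) (use x d 1 in auto)
      \<comment> \<open>The outer witness may lie beyond the chord; an end of the chord replaces
        it.\<close>
      moreover have "\<exists>x\<in>?V1. x < p \<or> q < x"
        by (rule bexI[of _ "if p = a then b else a"]) (use pq' d 1 in auto)
      ultimately have "diag_in ?V1 p q" unfolding diag_in_def using pq' d 1 by auto
      then show ?thesis using T1 pq unfolding triangulation_on_def by blast
    next
      case 2
      have "\<exists>x\<in>?V2. p < x \<and> x < q" by (rule bexI[of _ x]) (use x d 2 in auto)
      moreover have "\<exists>x\<in>?V2. x < p \<or> q < x"
        by (rule bexI[of _ "b"]) (use pq' d 2 in auto)
      ultimately have "diag_in ?V2 p q" unfolding diag_in_def using pq' d 2 by auto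
      then show ?thesis using T2 pq unfolding triangulation_on_def by blast
    next
      case 3
      have "\<exists>x\<in>?V2. p < x \<and> x < q" by (rule bexI[of _ x]) (use x d 3 in auto)
      moreover have "\<exists>x\<in>?V2. x < p \<or> q < x"
        by (rule bexI[of _ "a"]) (use pq' d 3 in auto)
      ultimately have "diag_in ?V2 p q" unfolding diag_in_def using pq' d 3 by auto
      then show ?thesis using T2 pq unfolding triangulation_on_def by blast
    next
      case 4
      have "\<exists>x\<in>?V2. p < x \<and> x < q"
        by (rule bexI[of _ "if p = a then b else a"]) (use pq' d 4 in auto)
      moreover have "\<exists>x\<in>?V2. x < p \<or> q < x"
        by (rule bexI[of _ y]) (use y 4 in auto)
      ultimately have "diag_in ?V2 p q" unfolding diag_in_def using pq' 4 by auto
      then show ?thesis using T2 pq unfolding triangulation_on_def by blast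
    qed (use d in \<open>auto simp: crosses_doubleton\<close>)
  qed
  show ?thesis
    unfolding triangulation_on_def
  proof (intro conjI)
    show "\<forall>e\<in>insert {a, b} (T1 \<union> T2). \<exists>p q. diag_in V p q \<and> e = {p, q}"
      using T1d T2d in1 in2 ab by blast
    show "\<forall>e\<in>insert {a, b} (T1 \<union> T2). \<forall>f\<in>insert {a, b} (T1 \<union> T2). \<not> crosses e f"
      using c11 c22 c12 sym by blast
  qed (use max in blast)
qed

text \<open>The increasing rotation of the polygon is cut either within \<open>ys\<close> or within
  \<open>xs\<close>; accordingly \<open>a\<close> or \<open>b\<close> is the smaller end of the
  chord, which gluing needs to know.\<close>

lemma cyc_sorted_split:
  assumes "cyc (a # xs @ b # ys) zs" "sorted_wrt (<) zs"
  obtains y1 y2 where "ys = y1 @ y2" "sorted_wrt (<) (y2 @ a # xs @ b # y1)"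
  | x1 x2 where "xs = x1 @ x2" "sorted_wrt (<) (x2 @ b # ys @ a # x1)"
proof -
  obtain pre post where 1: "zs = pre @ a # post" "xs @ b # ys = post @ pre"
    using assms(1) by (rule cyc_Cons_split)
  from 1(2) consider us where "post = xs @ us" "b # ys = us @ pre" |
     us where "xs = post @ us" "pre = us @ b # ys"
    unfolding append_eq_append_conv2 by auto
  then show thesis
  proof cases
    case (1 us)
    show thesis
    proof (cases us)
      case Nil
      then show thesis using 1 \<open>zs = _\<close> assms(2) that(2)[of xs "[]"] by auto
    next
      case (Cons c us')
      then show thesis using 1 \<open>zs = _\<close> assms(2) that(1)[of us' pre] by auto
    qed
  next
    case (2 us)
    then show thesis using \<open>zs = _\<close> assms(2) that(2)[of post us] by auto
  qed
qed

text \<open>Each rule of \<open>tri\<close> is realised geometrically. The increasing rotation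
  \<open>zs\<close> is carried along so that the two parts at a chord can be described by
  inequalities.\<close>

lemma tri_imp_triangulation:
  assumes "tri B xs" "cyc xs zs" "sorted_wrt (<) zs"
  shows "\<exists>T. triangulation_on (set xs) T \<and> T \<inter> B = {}"
  using assms
proof (induction arbitrary: zs rule: tri.induct)
  case (tri_base xs)
  have "\<not> diag_in (set xs) p q" for p q
  proof
    assume "diag_in (set xs) p q"
    \<comment> \<open>A diagonal involves four different vertices, too many for a triangle.\<close>
    then obtain x y where "{p, q, x, y} \<subseteq> set xs" "p < x" "x < q" "y < p \<or> q < y"
      unfolding diag_in_def by auto
    then have "card {p, q, x, y} \<le> length xs" "card {p, q, x, y} = 4"
      using card_mono[of "set xs" "{p, q, x, y}"] card_length[of xs] by auto
    then show False using tri_base by auto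
  qed
  then show ?case by (intro exI[of _ "{}"]) (auto simp: triangulation_on_def)
next
  case (tri_chord a xs b ys)
  \<comment> \<open>Stated for arbitrary \<open>a\<close> and \<open>b\<close> to serve both
    alternatives of \<open>cyc_sorted_split\<close>, which differ by exchanging the ends and the
    sides of the chord.\<close>
  have glue: "\<exists>T. triangulation_on (set (a # xs @ b # ys)) T \<and> T \<inter> B = {}"
    if ys: "ys = y1 @ y2" and s: "sorted_wrt (<) (y2 @ a # xs @ b # y1)"
     and "triangulation_on (set (a # xs @ [b])) T1" "triangulation_on (set (b # ys @ [a])) T2"
     and T: "T1 \<inter> B = {}" "T2 \<inter> B = {}" and ab: "{a, b} \<notin> B" and ne: "xs \<noteq> []" "ys \<noteq> []"
    for a b :: nat and xs ys y1 y2 T1 T2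
  proof -
    let ?V = "set (a # xs @ b # ys)"
    have lt: "a < b" "\<forall>x\<in>set xs. a < x \<and> x < b" "\<forall>x\<in>set y1. b < x" "\<forall>x\<in>set y2. x < a"
      using s by (auto simp: sorted_wrt_append)
    have o: "\<forall>x\<in>set xs. a \<le> x \<and> x \<le> b \<and> \<not> x \<le> a \<and> \<not> b \<le> x"
      "\<forall>x\<in>set y1. b \<le> x \<and> \<not> x \<le> b" "\<forall>x\<in>set y2. x \<le> a \<and> \<not> a \<le> x"
      using lt by auto
    have 1: "set (a # xs @ [b]) = {x\<in>?V. a \<le> x \<and> x \<le> b}"
      using o lt by (auto simp: ys)
    have 2: "set (b # ys @ [a]) = {x\<in>?V. x \<le> a \<or> b \<le> x}"
      using o lt by (auto simp: ys)
    obtain x y where "x \<in> set xs" "y \<in> set ys" using ne by (meson hd_in_set)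
    then have "diag_in ?V a b"
      unfolding diag_in_def using s ys by (auto simp: sorted_wrt_append)
    from triangulation_on_glue[OF this, of T1 T2] that(3,4) T ab show ?thesis
      unfolding 1 2 by (intro exI[of _ "insert {a, b} (T1 \<union> T2)"]) auto
  qed
  from tri_chord.prems show ?case
  proof (cases rule: cyc_sorted_split)
    case (1 y1 y2)
    have "cyc (a # xs @ [b]) (a # xs @ [b])" "sorted_wrt (<) (a # xs @ [b])"
      using 1(2) by (auto simp: sorted_wrt_append)
    then obtain T1 where "triangulation_on (set (a # xs @ [b])) T1" "T1 \<inter> B = {}"
      using tri_chord.IH(1) by blast
    moreover have "cyc (b # ys @ [a]) (y2 @ a # b # y1)" "sorted_wrt (<) (y2 @ a # b # y1)"
      using 1 cyc_append[of "b # y1" "y2 @ [a]"] by (auto simp: sorted_wrt_append)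
    then obtain T2 where "triangulation_on (set (b # ys @ [a])) T2" "T2 \<inter> B = {}"
      using tri_chord.IH(2) by blast
    ultimately show ?thesis using glue[OF 1] tri_chord.hyps by blast
  next
    case (2 x1 x2)
    have "cyc (b # ys @ [a]) (b # ys @ [a])" "sorted_wrt (<) (b # ys @ [a])"
      using 2(2) by (auto simp: sorted_wrt_append)
    then obtain T1 where "triangulation_on (set (b # ys @ [a])) T1" "T1 \<inter> B = {}"
      using tri_chord.IH(2) by blast
    moreover have "cyc (a # xs @ [b]) (x2 @ b # a # x1)" "sorted_wrt (<) (x2 @ b # a # x1)"
      using 2 cyc_append[of "a # x1" "x2 @ [b]"] by (auto simp: sorted_wrt_append)
    then obtain T2 where "triangulation_on (set (a # xs @ [b])) T2" "T2 \<inter> B = {}"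
      using tri_chord.IH(1) by blast
    moreover have "{b, a} \<notin> B" using tri_chord.hyps by (simp add: insert_commute)
    ultimately have "\<exists>T. triangulation_on (set (b # ys @ a # xs)) T \<and> T \<inter> B = {}"
      using glue[OF 2] tri_chord.hyps by blast
    moreover have "set (b # ys @ a # xs) = set (a # xs @ b # ys)" by auto
    ultimately show ?thesis by simp
  qed
next
  case (tri_rot xs ys)
  have "cyc (xs @ ys) zs" using tri_rot.prems(1) cyc_trans cyc_append by blast
  then show ?case using tri_rot by (auto simp: Un_commute)
qed

text \<open>A chord of the triangulation cutting off the fewest vertices cuts off exactly one.\<close>

lemma triangulation_on_ear:
  assumes T: "triangulation_on V T" and V: "finite V" "card V \<ge> 4"
  obtains p w q where "p \<in> V" "w \<in> V" "q \<in> V" "p < w" "w < q"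
    "\<forall>x\<in>V. p < x \<and> x < q \<longrightarrow> x = w" "{p, q} \<in> T"
    "triangulation_on (V - {w}) (T - {{p, q}})"
proof -
  \<comment> \<open>Only vertices between the ends are counted, so the ear found lies between its
    neighbours in the order of the labels.\<close>
  define len where "len = (\<lambda>(p, q). card {x\<in>V. p < x \<and> x < q})"
  define C where "C = {(p, q). diag_in V p q \<and> {p, q} \<in> T}"
  have "\<exists>p q. diag_in V p q"
  proof -
    define xs where "xs = sorted_list_of_set V"
    have xs: "set xs = V" "sorted_wrt (<) xs" "length xs = card V"
      unfolding xs_def using V by auto
    have lt: "xs ! i < xs ! j" if "i < j" "j < length xs" for i j
      using sorted_wrt_nth_less[OF xs(2)] that by blast
    have mem: "xs ! i \<in> V" if "i < length xs" for i using nth_mem[OF that] xs by simp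
    have "diag_in V (xs ! 0) (xs ! 2)"
      unfolding diag_in_def
    proof (intro conjI)
      show "\<exists>x\<in>V. xs ! 0 < x \<and> x < xs ! 2"
        using V xs lt mem by (intro bexI[of _ "xs ! 1"]) auto
      show "\<exists>x\<in>V. x < xs ! 0 \<or> xs ! 2 < x"
        using V xs lt mem by (intro bexI[of _ "xs ! 3"]) auto
    qed (use V xs lt mem in auto)
    then show ?thesis by blast
  qed
  then have "T \<noteq> {}" using T unfolding triangulation_on_def by blast
  then obtain e where "e \<in> T" by blast
  moreover then obtain p q where "diag_in V p q" "e = {p, q}"
    using T unfolding triangulation_on_def by blast
  ultimately have "(p, q) \<in> C" unfolding C_def by blast
  then have "C \<noteq> {}" by blast
  then obtain c where c: "c \<in> C" "\<And>c'. c' \<in> C \<Longrightarrow> len c \<le> len c'"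
    using ex_has_least_nat[of "\<lambda>c. c \<in> C" _ len] by blast
  obtain p q where pq: "c = (p, q)" by (cases c)
  have d: "diag_in V p q" "{p, q} \<in> T" using c pq unfolding C_def by auto
  have shorter: False if "diag_in V r s" "{r, s} \<in> T" "p \<le> r" "s \<le> q" "r \<noteq> p \<or> s \<noteq> q" for r s
  proof -
    have rs: "r < s" "r \<in> V" "s \<in> V" using that(1) unfolding diag_in_def by auto
    let ?z = "if r = p then s else r"
    have "?z \<in> {x\<in>V. p < x \<and> x < q}" "?z \<notin> {x\<in>V. r < x \<and> x < s}" using that(3-5) rs by auto
    moreover have "{x\<in>V. r < x \<and> x < s} \<subseteq> {x\<in>V. p < x \<and> x < q}"
      using that(3,4) by auto
    ultimately have "{x\<in>V. r < x \<and> x < s} \<subset> {x\<in>V. p < x \<and> x < q}" by blast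
    then have "card {x\<in>V. r < x \<and> x < s} < card {x\<in>V. p < x \<and> x < q}"
      using V(1) by (intro psubset_card_mono) auto
    then have "len (r, s) < len c" unfolding len_def pq by simp
    moreover have "(r, s) \<in> C" using that(1,2) unfolding C_def by simp
    ultimately show False using c(2) by (simp add: leD)
  qed
  let ?I = "{x\<in>V. p < x \<and> x < q}"
  have Ine: "?I \<noteq> {}" "finite ?I" using d V unfolding diag_in_def by auto
  define w where "w = Min ?I"
  have w: "w \<in> V" "p < w" "w < q" and wmin: "\<And>x. x \<in> V \<Longrightarrow> p < x \<Longrightarrow> x < q \<Longrightarrow> w \<le> x"
    using Min_in[OF Ine(2,1)] Min_le[OF Ine(2)] unfolding w_def by auto
  \<comment> \<open>If another vertex lay between \<open>p\<close> and \<open>q\<close>, the chord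
    from \<open>w\<close> to \<open>q\<close> would be a diagonal, outside \<open>T\<close> by
    minimality. An edge of \<open>T\<close> crossing it would cross the chord from \<open>p\<close>
    to \<open>q\<close> or be a shorter member of \<open>C\<close>.\<close>
  have uniq: "x = w" if x: "x \<in> V" "p < x" "x < q" for x
  proof (rule ccontr)
    assume "x \<noteq> w"
    then have "w < x" using wmin x by fastforce
    then have dw: "diag_in V w q"
      using w x d(1) unfolding diag_in_def by auto
    then have "{w, q} \<notin> T" using shorter[of w q] w by auto
    then obtain e where e: "e \<in> T" "crosses {w, q} e"
      using T dw unfolding triangulation_on_def by blast
    obtain r s where rs: "diag_in V r s" "e = {r, s}"
      using T e unfolding triangulation_on_def by blast
    have rs': "r < s" "r \<in> V" "s \<in> V" using rs unfolding diag_in_def by auto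
    have nc: "\<not> crosses {p, q} {r, s}" using T e d rs unfolding triangulation_on_def by blast
    have "p < q" using w by simp
    have "r < w \<and> w < s \<and> s < q \<or> w < r \<and> r < q \<and> q < s"
      using e rs rs' w crosses_doubleton by auto
    then show False
    proof
      assume *: "w < r \<and> r < q \<and> q < s"
      then have "crosses {p, q} {r, s}" using w rs' crosses_doubleton[of p q r s] by auto
      then show False using nc by simp
    next
      assume *: "r < w \<and> w < s \<and> s < q"
      have "\<not> r < p" using * w nc rs' crosses_doubleton[of p q r s] by auto
      then show False using shorter[of r s] rs e * by auto
    qed
  qed
  have T': "triangulation_on (V - {w}) (T - {{p, q}})"
    unfolding triangulation_on_def
  proof (intro conjI ballI allI impI)
    fix e assume e: "e \<in> T - {{p, q}}"
    then obtain r s where rs: "diag_in V r s" "e = {r, s}"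
      using T unfolding triangulation_on_def by blast
    have nc: "\<not> crosses {p, q} {r, s}" using T e d rs unfolding triangulation_on_def by blast
    have rs': "r < s" "r \<in> V" "s \<in> V" "p < q" using rs w unfolding diag_in_def by auto
    have ne: "\<not> (r = p \<and> s = q)" using e rs by auto
    have nc': "\<not> (p < r \<and> r < q \<and> q < s)" "\<not> (r < p \<and> p < s \<and> s < q)"
      using nc rs' crosses_doubleton[of p q r s] by auto
    obtain x y where x: "x \<in> V" "r < x" "x < s" and y: "y \<in> V" "y < r \<or> s < y"
      using rs unfolding diag_in_def by auto
    have rw: "r \<noteq> w"
    proof
      assume "r = w"
      then show False using w nc' rs' uniq[of s] by (cases "s < q"; cases "s = q") (use uniq[of x] x in auto)
    qed
    have sw: "s \<noteq> w"
    proof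
      assume "s = w"
      then show False using w nc' rs' uniq[of x] x by (cases "r < p"; cases "r = p") (use uniq[of r] in auto)
    qed
    have pqV: "p \<in> V" "q \<in> V" using d unfolding diag_in_def by auto
    \<comment> \<open>If \<open>w\<close> itself was the witness, then \<open>r\<close> and
      \<open>s\<close> enclose \<open>p\<close> and \<open>q\<close> without coinciding with both,
      so \<open>p\<close> or \<open>q\<close> is a new witness.\<close>
    have "\<exists>x\<in>V - {w}. r < x \<and> x < s"
    proof (cases "x = w")
      case True
      then have "r \<le> p" "q \<le> s" using uniq[of r] uniq[of s] rw sw rs' x w by fastforce+
      then show ?thesis using ne pqV w
        by (intro bexI[of _ "if r = p then q else p"]) auto
    qed (use x in auto)
    moreover have "\<exists>y\<in>V - {w}. y < r \<or> s < y"
    proof (cases "y = w")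
      case True
      from y(2) show ?thesis
      proof
        assume "y < r"
        then have "p < r" using True w by simp
        then show ?thesis using pqV w by (intro bexI[of _ p]) auto
      next
        assume "s < y"
        then have "s < q" using True w by simp
        then show ?thesis using pqV w by (intro bexI[of _ q]) auto
      qed
    qed (use y in auto)
    ultimately show "\<exists>r s. diag_in (V - {w}) r s \<and> e = {r, s}"
      using rs rw sw rs' unfolding diag_in_def by (intro exI[of _ r] exI[of _ s]) auto
  next
    fix e f assume "e \<in> T - {{p, q}}" "f \<in> T - {{p, q}}"
    then show "\<not> crosses e f" using T unfolding triangulation_on_def by blast
  next
    fix r s assume rs: "diag_in (V - {w}) r s" "{r, s} \<notin> T - {{p, q}}"
    have rsV: "diag_in V r s" using rs(1) unfolding diag_in_def by auto
    have rs': "r < s" "r \<noteq> w" "s \<noteq> w" "r \<in> V" "s \<in> V" using rs unfolding diag_in_def by auto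
    have "\<not> (r = p \<and> s = q)" using rs uniq unfolding diag_in_def by auto
    then have "{r, s} \<noteq> {p, q}" using rs' w by (auto simp: doubleton_eq_iff)
    then obtain e where e: "e \<in> T" "crosses {r, s} e"
      using rs rsV T unfolding triangulation_on_def by blast
    have "\<not> crosses {r, s} {p, q}"
      using rs' w crosses_doubleton[of r s p q] uniq[of r] uniq[of s] by auto
    then show "\<exists>e\<in>T - {{p, q}}. crosses {r, s} e" using e by auto
  qed
  have "p \<in> V" "q \<in> V" using d unfolding diag_in_def by auto
  from that[OF this(1) w(1) this(2) w(2,3) _ d(2) T'] uniq show thesis by blast
qed

lemma sorted_consecutive:
  fixes xs :: "nat list"
  assumes xs: "sorted_wrt (<) xs" and V: "p \<in> set xs" "w \<in> set xs" "q \<in> set xs" "p < w" "w < q"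
    and uniq: "\<forall>x\<in>set xs. p < x \<and> x < q \<longrightarrow> x = w"
  obtains us vs where "xs = us @ p # w # q # vs"
proof -
  obtain us r where 1: "xs = us @ p # r" using V split_list by metis
  have "w \<in> set r" using xs V unfolding 1 by (auto simp: sorted_wrt_append)
  then obtain a r' where r: "r = a # r'" by (cases r) auto
  have "a = w" using uniq xs V \<open>w \<in> set r\<close> unfolding 1 r by (auto simp: sorted_wrt_append)
  have "q \<in> set r'" using xs V \<open>a = w\<close> unfolding 1 r by (auto simp: sorted_wrt_append)
  then obtain b r'' where r': "r' = b # r''" by (cases r') auto
  have "b = q" using uniq xs V \<open>q \<in> set r'\<close> \<open>a = w\<close> unfolding 1 r r' by (auto simp: sorted_wrt_append)
  then show thesis using that 1 r r' \<open>a = w\<close> by simp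
qed

text \<open>Cutting off the ear found by \<open>triangulation_on_ear\<close> uses up one chord of
  \<open>T\<close>; the remaining chords triangulate the smaller polygon, and induction
  applies.\<close>

lemma triangulation_imp_etri:
  assumes "triangulation_on (set xs) T" "sorted_wrt (<) xs" "T \<inter> B = {}"
  shows "etri B xs"
  using assms
proof (induction "length xs" arbitrary: xs T rule: less_induct)
  case less
  show ?case
  proof (cases "length xs \<le> 3")
    case True
    then show ?thesis by (rule etri_base)
  next
    case False
    have "card (set xs) = length xs"
      using less.prems(2) strict_sorted_iff distinct_card by blast
    then have 4: "card (set xs) \<ge> 4" using False by simp
    obtain p w q where pwq: "p \<in> set xs" "w \<in> set xs" "q \<in> set xs" "p < w" "w < q"
      "\<forall>x\<in>set xs. p < x \<and> x < q \<longrightarrow> x = w" "{p, q} \<in> T"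
      "triangulation_on (set xs - {w}) (T - {{p, q}})"
      using triangulation_on_ear[OF less.prems(1) _ 4] by blast
    obtain us vs where xs: "xs = us @ p # w # q # vs"
      using sorted_consecutive[OF less.prems(2) pwq(1-6)] .
    have "set (us @ p # q # vs) = set xs - {w}" "sorted_wrt (<) (us @ p # q # vs)"
      using less.prems(2) unfolding xs by (auto simp: sorted_wrt_append)
    then have "etri B (us @ p # q # vs)"
      using less.hyps[of "us @ p # q # vs" "T - {{p, q}}"] pwq(8) less.prems(3) xs by auto
    then have "etri B (q # vs @ us @ [p])" using etri_rot[of B "us @ [p]" "q # vs"] by simp
    moreover have "{q, p} \<notin> B" using pwq(7) less.prems(3) by (auto simp: insert_commute)
    ultimately have "etri B (w # q # vs @ us @ [p])" by (auto intro!: etri_ear[of B "q # vs @ us @ [p]"])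
    then show ?thesis unfolding xs using etri_rot[of B "w # q # vs" "us @ [p]"] by simp
  qed
qed

lemma blocker_imp_not_tri:
  assumes "blocker n B" "n \<ge> 3"
  shows "\<not> tri B [0..<n]"
proof
  assume "tri B [0..<n]"
  then obtain T where "triangulation_on (set [0..<n]) T" "T \<inter> B = {}"
    using tri_imp_triangulation[of B "[0..<n]" "[0..<n]"] by auto
  then show False using assms triangulation_iff unfolding blocker_def by auto
qed

lemma not_blocker_imp_etri:
  assumes "\<not> blocker n B" "B \<subseteq> diagonals n" "n \<ge> 3"
  shows "etri B [0..<n]"
proof -
  obtain T where "triangulation n T" "B \<inter> T = {}" using assms unfolding blocker_def by auto
  then show ?thesis using triangulation_imp_etri[of "[0..<n]" T B] triangulation_iff[OF assms(3)] by auto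
qed

section \<open>A sufficient condition for blocking\<close>

text \<open>\<open>h\<close> gives positions in \<open>A\<close>. In the cyclic order
  \<open>A @ D\<close> the edges of \<open>x\<close> and of a later \<open>y\<close> in
  \<open>D\<close> cross exactly if \<open>h x < h y\<close>, so the last conjunct lets edges cross
  only if their positions are neighbours. All conditions ask for edges and forbid none. At least
  four vertices are demanded because a triangle is never blocked.\<close>

definition fan_block :: "'a set set \<Rightarrow> 'a list \<Rightarrow> 'a list \<Rightarrow> ('a \<Rightarrow> nat) \<Rightarrow> bool" where
  "fan_block B A D h \<longleftrightarrow> 3 \<le> length A \<and> 4 \<le> length A + length D \<and>
     (\<forall>i. i + 2 < length A \<longrightarrow> {A ! i, A ! (i + 2)} \<in> B) \<and>
     (\<forall>x\<in>set D. 1 \<le> h x \<and> h x + 1 < length A \<and> {x, A ! h x} \<in> B) \<and>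
     sorted_wrt (\<lambda>x y. h y \<le> h x + 1) D"

text \<open>Reflection reverses both the order of \<open>D\<close> and the positions, so the bound
  on the increase of \<open>h\<close> keeps its direction.\<close>

lemma fan_block_rev:
  assumes "fan_block B A D h"
  shows "fan_block B (rev A) (rev D) (\<lambda>x. length A - 1 - h x)"
proof -
  have "{rev A ! i, rev A ! (i + 2)} \<in> B" if "i + 2 < length A" for i
  proof -
    have "rev A ! i = A ! (length A - 3 - i + 2)" "rev A ! (i + 2) = A ! (length A - 3 - i)"
      using that by (auto simp: rev_nth intro!: arg_cong[of _ _ "(!) A"])
    moreover have "length A - 3 - i + 2 < length A" using that by simp
    ultimately show ?thesis using assms unfolding fan_block_def by (metis insert_commute)
  qed
  moreover have "1 \<le> length A - 1 - h x \<and> length A - 1 - h x + 1 < length A \<and>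
      {x, rev A ! (length A - 1 - h x)} \<in> B" if "x \<in> set D" for x
  proof -
    have *: "1 \<le> h x" "h x + 1 < length A" "{x, A ! h x} \<in> B"
      using assms that unfolding fan_block_def by auto
    then have "rev A ! (length A - 1 - h x) = A ! h x"
      by (auto simp: rev_nth intro!: arg_cong[of _ _ "(!) A"])
    then show ?thesis using * by auto
  qed
  moreover have "sorted_wrt (\<lambda>x y. length A - 1 - h y \<le> length A - 1 - h x + 1) (rev D)"
    unfolding sorted_wrt_rev
    by (rule sorted_wrt_mono_rel[of _ "\<lambda>x y. h y \<le> h x + 1"])
       (use assms in \<open>auto simp: fan_block_def\<close>)
  ultimately show ?thesis using assms unfolding fan_block_def by auto
qed

text \<open>If some vertex of D is joined to the first interior vertex of the arc, then the last vertex of D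
  takes over the role of the removed end of the arc.\<close>

lemma fan_block_remove_first:
  assumes F: "fan_block B (w # A) D h" and ear: "{hd (A @ D), last (A @ D)} \<notin> B"
  shows "\<exists>A' D' h'. cyc (A @ D) (A' @ D') \<and> fan_block B A' D' h'"
proof -
  have len: "length A \<ge> 2" "length A + length D \<ge> 3" using F unfolding fan_block_def by auto
  have short: "{(w # A) ! i, A ! (i + 1)} \<in> B" if "i + 1 < length A" for i
    using F that unfolding fan_block_def by force
  have short': "{A ! i, A ! (i + 2)} \<in> B" if "i + 2 < length A" for i
    using short[of "i + 1"] that by simp
  have fan: "1 \<le> h x" "h x < length A" "{x, A ! (h x - 1)} \<in> B" if "x \<in> set D" for x
    using F that unfolding fan_block_def by (auto simp: nth_Cons split: nat.splits)
  have mono: "sorted_wrt (\<lambda>x y. h y \<le> h x + 1) D" using F unfolding fan_block_def by auto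
  have hdA: "hd (A @ D) = A ! 0" using len by (cases A) auto
  \<comment> \<open>The neighbours of the removed \<open>w\<close> are \<open>hd A\<close> and
    \<open>last D\<close>. Their chord is missing from \<open>B\<close>, so \<open>last D\<close> is
    not joined to the first interior vertex of the old arc.\<close>
  have last1: "h (last D) \<noteq> 1" if "D \<noteq> []"
    using fan[of "last D"] that ear hdA by (auto simp: insert_commute)
  have len3: "length A \<ge> 3"
  proof (rule ccontr)
    assume "\<not> length A \<ge> 3"
    then have "D \<noteq> []" using len by auto
    then show False using last1 fan[of "last D"] \<open>\<not> length A \<ge> 3\<close> by auto
  qed
  have len4: "length A + length D \<ge> 4"
  proof (rule ccontr)
    assume "\<not> length A + length D \<ge> 4"
    then have "length D = 0" "length A = 3" using len3 by linarith+
    then have *: "D = []" "length A = 3" by auto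
    then have "last (A @ D) = A ! 2" by (cases A rule: rev_cases) (auto simp: nth_append)
    then show False using ear hdA short'[of 0] * by (auto simp: numeral_2_eq_2)
  qed
  show ?thesis
  proof (cases "\<exists>x\<in>set D. h x = 1")
    case False
    \<comment> \<open>No vertex of \<open>D\<close> is joined to the new end of the arc, so
      \<open>A\<close> serves as the arc with all positions lowered by one.\<close>
    have "fan_block B A D (\<lambda>x. h x - 1)"
      unfolding fan_block_def
    proof (intro conjI allI impI ballI)
      fix x assume "x \<in> set D"
      then show "1 \<le> h x - 1" "h x - 1 + 1 < length A" "{x, A ! (h x - 1)} \<in> B"
        using fan[of x] False by (auto simp: le_less)
    next
      show "sorted_wrt (\<lambda>x y. h y - 1 \<le> h x - 1 + 1) D"
        by (rule sorted_wrt_mono_rel[OF _ mono]) auto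
    qed (use len3 len4 short' in auto)
    then show ?thesis using cyc_refl by blast
  next
    case True
    then obtain x D' l where x: "x \<in> set D" "h x = 1" and D: "D = D' @ [l]"
      by (metis empty_iff empty_set rev_exhaust)
    have "h l \<noteq> 1" using last1 D by simp
    then have "x \<in> set D'" using x D by auto
    \<comment> \<open>Some earlier vertex has position 1, so the bounded increase leaves only 2 for
      \<open>l\<close>. Its edge thus goes to \<open>A ! 1\<close> and is the short diagonal needed
      to put \<open>l\<close> in front of \<open>A\<close>.\<close>
    then have "h l = 2" using mono D x fan(1)[of l] \<open>h l \<noteq> 1\<close> by (fastforce simp: sorted_wrt_append)
    have "fan_block B (l # A) D' h"
      unfolding fan_block_def
    proof (intro conjI allI impI ballI)
      fix i assume "i + 2 < length (l # A)"
      then show "{(l # A) ! i, (l # A) ! (i + 2)} \<in> B"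
        using short[of i] fan[of l] \<open>h l = 2\<close> D by (cases i) auto
    next
      fix x assume "x \<in> set D'"
      then show "1 \<le> h x" "h x + 1 < length (l # A)" "{x, (l # A) ! h x} \<in> B"
        using fan[of x] D by (auto simp: nth_Cons split: nat.splits)
    next
      show "sorted_wrt (\<lambda>x y. h y \<le> h x + 1) D'" using mono D by (simp add: sorted_wrt_append)
    qed (use len3 len4 in auto)
    moreover have "cyc (A @ D) ((l # A) @ D')" using D cyc_append[of "A @ D'" "[l]"] by simp
    ultimately show ?thesis by blast
  qed
qed

text \<open>Consider the first ear \<open>w\<close> of a triangulation. In \<open>D\<close> it can
  simply be deleted. Strictly inside \<open>A\<close> it is impossible, since its chord is a short
  diagonal in \<open>B\<close>. At an end of \<open>A\<close> the shape survives by
  \<open>fan_block_remove_first\<close> or its mirror image. So the shape would persist down to a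
  triangle, which is too small for it.\<close>

lemma fan_block_not_etri:
  assumes "etri B xs" "distinct xs" "cyc xs (A @ D)"
  shows "\<not> fan_block B A D h"
  using assms
proof (induction arbitrary: A D h rule: etri.induct)
  case (etri_base xs)
  then show ?case using cyc_length[of xs "A @ D"] by (auto simp: fan_block_def)
next
  case (etri_rot xs ys)
  have "distinct (xs @ ys)" using etri_rot.prems by auto
  moreover have "cyc (xs @ ys) (A @ D)" using cyc_trans[OF cyc_append etri_rot.prems(2)] .
  ultimately show ?case by (rule etri_rot.IH)
next
  case (etri_ear ys w)
  have no: False if "cyc ys (A' @ D')" "fan_block B A' D' h'" for A' D' h'
    using etri_ear that by auto
  show ?case
  proof
    assume F: "fan_block B A D h"
    obtain pre post where pp: "A @ D = pre @ w # post" "ys = post @ pre"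
      using etri_ear.prems(2) by (rule cyc_Cons_split)
    from pp(1) consider D1 where "pre = A @ D1" "D = D1 @ w # post"
      | A2 where "A = pre @ w # A2" "post = A2 @ D"
      unfolding append_eq_append_conv2 by (auto simp: append_eq_Cons_conv Cons_eq_append_conv)
    then show False
    proof cases
      case (1 D1)
      have "cyc ys (A @ D1 @ post)" using pp 1 cyc_append[of post "A @ D1"] by simp
      \<comment> \<open>With four vertices in total the arc has three, and cutting off the only
        vertex of \<open>D\<close> would use the short diagonal of the arc.\<close>
      moreover have "length A + length D \<noteq> 4"
      proof
        assume "length A + length D = 4"
        moreover have "length A \<ge> 3" using F unfolding fan_block_def by simp
        moreover have "length D = length D1 + length post + 1" using 1 by simp
        ultimately have "length D1 = 0" "length post = 0" and 3: "length A = 3" by linarith+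
        then have "ys = A" using pp 1 by simp
        moreover have "hd A = A ! 0" "last A = A ! 2"
          using 3 by (cases A rule: rev_cases; auto simp: nth_append hd_append hd_conv_nth)+
        ultimately have "{A ! 0, A ! 2} \<notin> B" using etri_ear.hyps(2) by simp
        then show False using F 3 unfolding fan_block_def by (metis add_0 lessI numeral_2_eq_2 numeral_3_eq_3)
      qed
      then have "fan_block B A (D1 @ post) h"
        using F 1 unfolding fan_block_def by (auto simp: sorted_wrt_append)
      ultimately show False using no by blast
    next
      case (2 A2)
      consider "pre = []" | "A2 = []" | "pre \<noteq> []" "A2 \<noteq> []" by blast
      then show False
      proof cases
        case a: 1
        then have "ys = A2 @ D" using pp 2 by simp
        then show False using fan_block_remove_first[of B w A2 D h] F 2 a etri_ear.hyps(2) no by auto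
      next
        case a: 2
        then have ys: "rev ys = rev pre @ rev D" using pp 2 by simp
        moreover have "fan_block B (w # rev pre) (rev D) (\<lambda>x. length A - 1 - h x)"
          using fan_block_rev[OF F] 2 a by simp
        moreover have "{hd (rev ys), last (rev ys)} \<notin> B"
          using etri_ear.hyps(2) by (simp add: hd_rev last_rev insert_commute)
        ultimately obtain A' D' h' where "cyc (rev ys) (A' @ D')" "fan_block B A' D' h'"
          using fan_block_remove_first by metis
        then have "cyc (rev (rev ys)) (rev D' @ rev A')" "fan_block B (rev A') (rev D') (\<lambda>x. length A' - 1 - h' x)"
          using cyc_rev fan_block_rev by fastforce+
        then show False using no cyc_trans cyc_append by (metis rev_rev_ident)
      next
        case a: 3
        have "A ! (length pre - 1) = last pre" "A ! (length pre - 1 + 2) = hd A2"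
          using 2 a by (auto simp: nth_append last_conv_nth hd_conv_nth)
        moreover have "length pre - 1 + 2 < length A" using 2 a by (cases pre; cases A2) auto
        moreover have "hd ys = hd A2" "last ys = last pre" using pp 2 a by auto
        ultimately show False using F etri_ear.hyps(2) unfolding fan_block_def
          by (metis insert_commute)
      qed
    qed
  qed
qed

section \<open>Blocked polygons with the minimum number of edges\<close>

definition within :: "'a set set \<Rightarrow> 'a list \<Rightarrow> 'a set set" where
  "within B xs = {e\<in>B. e \<subseteq> set xs}"

definition sidefree :: "'a set set \<Rightarrow> 'a list \<Rightarrow> bool" where
  "sidefree B xs \<longleftrightarrow> successively (\<lambda>a b. {a, b} \<notin> B) xs \<and> {last xs, hd xs} \<notin> B"

text \<open>A vertex that can be cut off because the side created by deleting it is not in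
  \<open>B\<close>; no particular triangulation is involved.\<close>

definition ear :: "'a set set \<Rightarrow> 'a list \<Rightarrow> 'a \<Rightarrow> bool" where
  "ear B xs x \<longleftrightarrow> (\<exists>zs. cyc xs (x # zs) \<and> {hd zs, last zs} \<notin> B)"

lemma finite_within [simp]: "finite (within B xs)"
  by (rule finite_subset[of _ "Pow (set xs)"]) (auto simp: within_def)

lemma sidefree_cyc:
  assumes "cyc xs ys" "sidefree B xs"
  shows "sidefree B ys"
proof -
  obtain us vs where "xs = us @ vs" "ys = vs @ us" using assms(1) unfolding cyc_def by blast
  then show ?thesis using assms(2) unfolding sidefree_def
    by (cases "us = []"; cases "vs = []") (auto simp: successively_append_iff)
qed

lemma sidefree_rev: "sidefree B xs \<Longrightarrow> sidefree B (rev xs)"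
  unfolding sidefree_def by (auto simp: hd_rev last_rev insert_commute)

lemma earI: "cyc xs (us @ x # vs) \<Longrightarrow> {hd (vs @ us), last (vs @ us)} \<notin> B \<Longrightarrow> ear B xs x"
  unfolding ear_def using cyc_trans[OF _ cyc_append, of xs us "x # vs"] by auto

lemma nth_neighbours:
  assumes "i + 2 < length xs"
  shows "cyc xs (xs ! (i + 1) # drop (i + 2) xs @ take (i + 1) xs)"
    "hd (drop (i + 2) xs @ take (i + 1) xs) = xs ! (i + 2)"
    "last (drop (i + 2) xs @ take (i + 1) xs) = xs ! i"
proof -
  have "xs = take (i + 1) xs @ xs ! (i + 1) # drop (i + 2) xs"
    using assms id_take_nth_drop[of "i + 1" xs] by simp
  then show "cyc xs (xs ! (i + 1) # drop (i + 2) xs @ take (i + 1) xs)"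
    unfolding cyc_def by (metis append_Cons)
  show "hd (drop (i + 2) xs @ take (i + 1) xs) = xs ! (i + 2)"
    using assms by (simp add: hd_append hd_drop_conv_nth)
  have "take (i + 1) xs = take i xs @ [xs ! i]" using assms by (simp add: take_Suc_conv_app_nth)
  then show "last (drop (i + 2) xs @ take (i + 1) xs) = xs ! i" by simp
qed

text \<open>The two short diagonals that wrap around the end of the list are left out: the others
  are pairwise distinct even in a quadrilateral, where a wrapped one would be a repetition.\<close>

lemma short_diagonals_card:
  assumes "distinct xs" and "\<And>i. i + 2 < length xs \<Longrightarrow> {xs ! i, xs ! (i + 2)} \<in> B"
  shows "inj_on (\<lambda>i. {xs ! i, xs ! (i + 2)}) {..<length xs - 2}"
    "(\<lambda>i. {xs ! i, xs ! (i + 2)}) ` {..<length xs - 2} \<subseteq> within B xs"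
proof -
  show "inj_on (\<lambda>i. {xs ! i, xs ! (i + 2)}) {..<length xs - 2}"
    using assms(1) by (intro inj_onI) (auto simp: doubleton_eq_iff nth_eq_iff_index_eq)
  show "(\<lambda>i. {xs ! i, xs ! (i + 2)}) ` {..<length xs - 2} \<subseteq> within B xs"
    using assms(2) by (auto simp: within_def)
qed

lemma not_tri_neighbour:
  assumes "\<not> tri B xs" "cyc xs (w # ys)"
  shows "\<exists>y\<in>set ys. {w, y} \<in> B"
  using assms(1) tri_isolated_cyc[OF assms(2)] by blast

lemma not_tri_ear:
  assumes "\<not> tri B xs" "cyc xs (w # ys)" "{hd ys, last ys} \<notin> B"
  shows "\<not> tri B ys"
proof
  assume "tri B ys"
  from tri_cyc[OF tri_ear[OF this assms(3), of w] cyc_sym[OF assms(2)]] show False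
    using assms(1) by simp
qed

text \<open>Deleting an ear leaves a blocked polygon and loses at least one edge, since a vertex
  without edges would give a fan. Without ears, all short diagonals are in \<open>B\<close>.\<close>

lemma not_tri_card:
  assumes "\<not> tri B xs" "distinct xs"
  shows "length xs \<le> card (within B xs) + 2"
  using assms
proof (induction "length xs" arbitrary: xs rule: less_induct)
  case less
  show ?case
  proof (cases "\<exists>w. ear B xs w")
    case True
    then obtain w ys where ys: "cyc xs (w # ys)" "{hd ys, last ys} \<notin> B" unfolding ear_def by blast
    have len: "length xs = length ys + 1" using cyc_length[OF ys(1)] by simp
    have d: "distinct (w # ys)" using cyc_distinct[OF ys(1)] less.prems by simp
    have "length ys \<le> card (within B ys) + 2"
      using less.hyps[of ys] len d not_tri_ear[OF less.prems(1) ys] by simp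
    moreover obtain y where "y \<in> set ys" "{w, y} \<in> B"
      using not_tri_neighbour[OF less.prems(1) ys(1)] by blast
    then have "{w, y} \<in> within B xs" "{w, y} \<notin> within B ys" "within B ys \<subseteq> within B xs"
      using cyc_set[OF ys(1)] d by (auto simp: within_def)
    then have "card (within B ys) < card (within B xs)"
      by (intro psubset_card_mono) auto
    ultimately show ?thesis using len by simp
  next
    case False
    then have "{xs ! i, xs ! (i + 2)} \<in> B" if "i + 2 < length xs" for i
      using nth_neighbours[OF that] unfolding ear_def by (metis insert_commute)
    from short_diagonals_card[OF less.prems(2) this]
    have "length xs - 2 \<le> card (within B xs)"
      by (metis (no_types, lifting) card_image card_lessThan card_mono finite_within)
    then show ?thesis by simp
  qed
qed

text \<open>The tool for counting edges at deleted vertices: what remains is still blocked and keeps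
  its minimum number of edges, so the lost edges \<open>S\<close> can only come from the
  excess.\<close>

lemma not_tri_card_avoiding:
  assumes "\<not> tri B zs" "distinct zs" "set zs \<subseteq> set xs"
    and S: "S \<subseteq> within B xs" "\<And>e. e \<in> S \<Longrightarrow> \<not> e \<subseteq> set zs"
  shows "card S + length zs \<le> card (within B xs) + 2"
proof -
  have "S \<inter> within B zs = {}" using S by (auto simp: within_def)
  moreover have "within B zs \<subseteq> within B xs" using assms(3) by (auto simp: within_def)
  moreover have "finite S" using finite_subset[OF S(1)] by simp
  ultimately have "card S + card (within B zs) \<le> card (within B xs)"
    using S(1) card_mono[of "within B xs" "S \<union> within B zs"] by (simp add: card_Un_disjoint)
  then show ?thesis using not_tri_card[OF assms(1,2)] by simp
qed

text \<open>From five vertices on, a wrapped short diagonal differs from the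
  \<open>length xs - 2\<close> others, so a polygon without ears would have too many edges.\<close>

lemma exists_ear:
  assumes "distinct xs" "length xs \<ge> 5" "card (within B xs) + 2 \<le> length xs"
  shows "\<exists>w. ear B xs w"
proof (rule ccontr)
  assume no: "\<nexists>w. ear B xs w"
  then have 1: "{xs ! i, xs ! (i + 2)} \<in> B" if "i + 2 < length xs" for i
    using nth_neighbours[OF that] unfolding ear_def by (metis insert_commute)
  let ?f = "\<lambda>i. {xs ! i, xs ! (i + 2)}" and ?n = "length xs" and ?e = "{xs ! (length xs - 2), xs ! 0}"
  obtain ys z where xs: "xs = ys @ [z]" using assms(2) by (cases xs rule: rev_cases) auto
  then have ys: "length ys = ?n - 1" "ys \<noteq> []" using assms(2) by auto
  have "hd ys = xs ! 0" "last ys = xs ! (?n - 2)"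
    using ys unfolding xs by (auto simp: hd_conv_nth last_conv_nth nth_append)
  moreover have "cyc xs (z # ys)" using xs cyc_append[of ys "[z]"] by simp
  ultimately have "?e \<in> B" using no unfolding ear_def by (metis insert_commute)
  moreover have "?e \<subseteq> set xs" using assms(2) xs nth_mem[of 0 xs] nth_mem[of "?n - 2" xs] by fastforce
  ultimately have e: "?e \<in> within B xs" unfolding within_def by blast
  have "?e \<notin> ?f ` {..<?n - 2}"
  proof
    assume "?e \<in> ?f ` {..<?n - 2}"
    then obtain i where i: "i < ?n - 2" "?e = ?f i" by blast
    have b: "?n - 2 < ?n" "i + 2 < ?n" "i < ?n" "0 < ?n" using i assms(2) by linarith+
    note eq = nth_eq_iff_index_eq[OF assms(1)]
    have "i = ?n - 2 \<and> i + 2 = 0 \<or> i + 2 = ?n - 2 \<and> i = 0"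
      using i(2) eq[OF b(1,3)] eq[OF b(1,2)] eq[OF b(4,3)] eq[OF b(4,2)]
      unfolding doubleton_eq_iff by argo
    then show False using assms(2) by auto
  qed
  moreover note short_diagonals_card[OF assms(1) 1]
  ultimately have "card (insert ?e (?f ` {..<?n - 2})) = Suc (?n - 2)"
    by (simp add: card_image)
  moreover have "insert ?e (?f ` {..<?n - 2}) \<subseteq> within B xs"
    using e short_diagonals_card(2)[OF assms(1) 1] by simp
  ultimately show False
    using card_mono[of "within B xs" "insert ?e (?f ` {..<?n - 2})"] assms(2,3) by simp
qed

text \<open>Singletons are excluded because membership of \<open>{x, y}\<close> in \<open>B\<close>
  is also characterised for coinciding ends.\<close>

definition min_blocked :: "'a set set \<Rightarrow> 'a list \<Rightarrow> bool" where
  "min_blocked B xs \<longleftrightarrow> distinct xs \<and> 4 \<le> length xs \<and> sidefree B xs \<and> (\<forall>x. {x} \<notin> B) \<and>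
     \<not> tri B xs \<and> card (within B xs) + 2 = length xs"

lemma min_blocked_rev: "min_blocked B xs \<Longrightarrow> min_blocked B (rev xs)"
  unfolding min_blocked_def within_def using sidefree_rev[of B xs] tri_rev[of B "rev xs"] by auto

lemma sidefree_Cons_ear:
  assumes "sidefree B (w # ys)" "{hd ys, last ys} \<notin> B"
  shows "sidefree B ys"
  using assms unfolding sidefree_def by (auto simp: successively_Cons insert_commute)

text \<open>One edge exists because an isolated vertex gives a fan; a second one would leave the
  smaller blocked polygon with fewer edges than \<open>not_tri_card\<close> demands.\<close>

lemma min_blocked_ear_unique:
  assumes "min_blocked B xs" "cyc xs (w # ys)" "{hd ys, last ys} \<notin> B"
  obtains v where "v \<in> set ys" "\<And>y. y \<in> set ys \<Longrightarrow> {w, y} \<in> B \<longleftrightarrow> y = v"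
proof -
  have nt: "\<not> tri B xs" and d: "distinct (w # ys)" and c: "card (within B xs) + 2 = length xs"
    using assms cyc_distinct[OF assms(2)] unfolding min_blocked_def by auto
  obtain v where v: "v \<in> set ys" "{w, v} \<in> B" using not_tri_neighbour[OF nt assms(2)] by blast
  have "y = v" if y: "y \<in> set ys" "{w, y} \<in> B" for y
  proof (rule ccontr)
    assume "y \<noteq> v"
    have "card {{w, v}, {w, y}} + length ys \<le> card (within B xs) + 2"
    proof (rule not_tri_card_avoiding[OF not_tri_ear[OF nt assms(2,3)]])
      show "{{w, v}, {w, y}} \<subseteq> within B xs"
        using v y cyc_set[OF assms(2)] by (auto simp: within_def)
    qed (use d cyc_set[OF assms(2)] in auto)
    moreover have "{w, v} \<noteq> {w, y}" using \<open>y \<noteq> v\<close> by (auto simp: doubleton_eq_iff)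
    ultimately show False using c cyc_length[OF assms(2)] by simp
  qed
  then show thesis using that v by blast
qed

lemma min_blocked_remove_ear:
  assumes "min_blocked B xs" "cyc xs (w # ys)" "{hd ys, last ys} \<notin> B" "5 \<le> length xs"
  shows "min_blocked B ys"
proof -
  obtain v where v: "v \<in> set ys" "\<And>y. y \<in> set ys \<Longrightarrow> {w, y} \<in> B \<longleftrightarrow> y = v"
    using min_blocked_ear_unique[OF assms(1-3)] by metis
  have xs: "\<not> tri B xs" "distinct (w # ys)" "card (within B xs) + 2 = length xs" "\<forall>x. {x} \<notin> B"
      "sidefree B xs"
    using assms cyc_distinct[OF assms(2)] unfolding min_blocked_def by auto
  have nt: "\<not> tri B ys" using not_tri_ear[OF xs(1) assms(2,3)] .
  have len: "length xs = length ys + 1" using cyc_length[OF assms(2)] by simp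
  have "card {{w, v}} + length ys \<le> card (within B xs) + 2" using len xs by simp
  have "{w, v} \<in> within B xs" "{w, v} \<notin> within B ys" "within B ys \<subseteq> within B xs"
    using cyc_set[OF assms(2)] xs(2) v by (auto simp: within_def)
  then have "card (within B ys) < card (within B xs)" by (intro psubset_card_mono) auto
  then have "card (within B ys) + 2 = length ys"
    using not_tri_card[OF nt] xs len by simp
  then show ?thesis unfolding min_blocked_def
    using xs nt len assms(4) sidefree_Cons_ear[OF sidefree_cyc[OF assms(2) xs(5)] assms(3)] by auto
qed

text \<open>The edge between the two ears would be the only one at \<open>y\<close>. Cutting off
  \<open>x\<close> then isolates \<open>y\<close>, and what remains has a fan triangulation.\<close>

lemma min_blocked_ears_nonadjacent:
  assumes mb: "min_blocked B xs" and "ear B xs x" "ear B xs y" "{x, y} \<in> B"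
  shows False
proof -
  obtain zs where zs: "cyc xs (x # zs)" "{hd zs, last zs} \<notin> B" using assms unfolding ear_def by blast
  obtain us where us: "cyc xs (y # us)" "{hd us, last us} \<notin> B" using assms unfolding ear_def by blast
  obtain v where v: "v \<in> set us" "\<And>z. z \<in> set us \<Longrightarrow> {y, z} \<in> B \<longleftrightarrow> z = v"
    using min_blocked_ear_unique[OF mb us] by metis
  have d: "distinct (x # zs)" "distinct (y # us)" and nt: "\<not> tri B xs"
    using mb cyc_distinct[OF zs(1)] cyc_distinct[OF us(1)] unfolding min_blocked_def by auto
  have "x \<noteq> y" using mb assms(4) unfolding min_blocked_def by auto
  have sets: "set (x # zs) = set (y # us)" using cyc_set[OF zs(1)] cyc_set[OF us(1)] by simp
  then have "x \<in> set us" using \<open>x \<noteq> y\<close> by auto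
  then have "v = x" using v assms(4) by (auto simp: insert_commute)
  have "y \<in> set zs" using sets \<open>x \<noteq> y\<close> by auto
  then obtain ts where ts: "cyc zs (y # ts)" using cyc_move by metis
  have "distinct (y # ts)" using cyc_distinct[OF ts] d by simp
  have "\<forall>t\<in>set ts. {y, t} \<notin> B"
  proof
    fix t assume "t \<in> set ts"
    then have "t \<in> set zs" "t \<noteq> y" using cyc_set[OF ts] \<open>distinct (y # ts)\<close> by auto
    then have "t \<in> set us" "t \<noteq> x" using sets d by auto
    then show "{y, t} \<notin> B" using v \<open>v = x\<close> by auto
  qed
  then have "tri B zs" using tri_isolated_cyc[OF ts] by blast
  then show False using not_tri_ear[OF nt zs] by simp
qed

section \<open>The shape of blockers of minimum size\<close>

definition arc :: "'a set set \<Rightarrow> 'a list \<Rightarrow> bool" where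
  "arc B A \<longleftrightarrow> (\<forall>i j. i < j \<longrightarrow> j < length A \<longrightarrow> ({A ! i, A ! j} \<in> B \<longleftrightarrow> j = i + 2))"

text \<open>Unlike in \<open>fan_block\<close>, the edges inside A and at the vertices of D are determined completely.\<close>

definition arc_fan :: "'a set set \<Rightarrow> 'a list \<Rightarrow> 'a list \<Rightarrow> bool" where
  "arc_fan B A D \<longleftrightarrow> 4 \<le> length A \<and> arc B A \<and>
     (\<forall>x\<in>set D. \<exists>k. 1 \<le> k \<and> k + 1 < length A \<and> (\<forall>y\<in>set (A @ D). {x, y} \<in> B \<longleftrightarrow> y = A ! k))"

text \<open>Otherwise the first or the last vertex of D could be moved to the arc.\<close>

definition maximal_arc :: "'a set set \<Rightarrow> 'a list \<Rightarrow> 'a list \<Rightarrow> bool" where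
  "maximal_arc B A D \<longleftrightarrow>
     (D \<noteq> [] \<longrightarrow> {A ! 1, last D} \<notin> B \<and> {A ! (length A - 2), hd D} \<notin> B)"

lemma arc_Cons: "arc B (w # A) \<longleftrightarrow> arc B A \<and> (\<forall>j<length A. {w, A ! j} \<in> B \<longleftrightarrow> j = 1)"
proof
  assume *: "arc B (w # A)"
  have "arc B A" unfolding arc_def
  proof (intro allI impI)
    fix i j assume "i < j" "j < length A"
    then show "{A ! i, A ! j} \<in> B \<longleftrightarrow> j = i + 2"
      using *[unfolded arc_def, rule_format, of "Suc i" "Suc j"] by simp
  qed
  moreover have "{w, A ! j} \<in> B \<longleftrightarrow> j = 1" if "j < length A" for j
    using *[unfolded arc_def, rule_format, of 0 "Suc j"] that by simp
  ultimately show "arc B A \<and> (\<forall>j<length A. {w, A ! j} \<in> B \<longleftrightarrow> j = 1)" by blast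
next
  assume *: "arc B A \<and> (\<forall>j<length A. {w, A ! j} \<in> B \<longleftrightarrow> j = 1)"
  show "arc B (w # A)" unfolding arc_def
  proof (intro allI impI)
    fix i j assume ij: "i < j" "j < length (w # A)"
    then obtain j' where j': "j = Suc j'" by (cases j) auto
    show "{(w # A) ! i, (w # A) ! j} \<in> B \<longleftrightarrow> j = i + 2"
      using * ij j' unfolding arc_def by (cases i) auto
  qed
qed

lemma arc_rev: "arc B A \<Longrightarrow> arc B (rev A)"
  unfolding arc_def
proof (intro allI impI)
  fix i j assume a: "\<forall>i j. i < j \<longrightarrow> j < length A \<longrightarrow> ({A ! i, A ! j} \<in> B \<longleftrightarrow> j = i + 2)"
    and ij: "i < j" "j < length (rev A)"
  have "{A ! (length A - 1 - j), A ! (length A - 1 - i)} \<in> B \<longleftrightarrow>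
      length A - 1 - i = length A - 1 - j + 2"
    by (rule a[rule_format]) (use ij in auto)
  then show "{rev A ! i, rev A ! j} \<in> B \<longleftrightarrow> j = i + 2"
    using ij by (auto simp: rev_nth insert_commute)
qed

lemma arc_snoc:
  "arc B (A @ [w]) \<longleftrightarrow> arc B A \<and> (\<forall>j<length A. {A ! j, w} \<in> B \<longleftrightarrow> j + 2 = length A)"
proof
  assume *: "arc B (A @ [w])"
  have "arc B A" unfolding arc_def
  proof (intro allI impI)
    fix i j assume "i < j" "j < length A"
    then show "{A ! i, A ! j} \<in> B \<longleftrightarrow> j = i + 2"
      using *[unfolded arc_def, rule_format, of i j] by (simp add: nth_append)
  qed
  moreover have "{A ! j, w} \<in> B \<longleftrightarrow> j + 2 = length A" if "j < length A" for j
    using *[unfolded arc_def, rule_format, of j "length A"] that by (auto simp: nth_append)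
  ultimately show "arc B A \<and> (\<forall>j<length A. {A ! j, w} \<in> B \<longleftrightarrow> j + 2 = length A)" by blast
next
  assume *: "arc B A \<and> (\<forall>j<length A. {A ! j, w} \<in> B \<longleftrightarrow> j + 2 = length A)"
  show "arc B (A @ [w])" unfolding arc_def
  proof (intro allI impI)
    fix i j assume ij: "i < j" "j < length (A @ [w])"
    then show "{(A @ [w]) ! i, (A @ [w]) ! j} \<in> B \<longleftrightarrow> j = i + 2"
      using * unfolding arc_def by (cases "j = length A") (auto simp: nth_append)
  qed
qed

lemma arc_fan_rev: "arc_fan B A D \<Longrightarrow> arc_fan B (rev A) (rev D)"
  unfolding arc_fan_def
proof (intro conjI ballI)
  fix x assume *: "4 \<le> length A \<and> arc B A \<and>
     (\<forall>x\<in>set D. \<exists>k. 1 \<le> k \<and> k + 1 < length A \<and> (\<forall>y\<in>set (A @ D). {x, y} \<in> B \<longleftrightarrow> y = A ! k))"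
    "x \<in> set (rev D)"
  then obtain k where k: "1 \<le> k" "k + 1 < length A" "\<forall>y\<in>set (A @ D). {x, y} \<in> B \<longleftrightarrow> y = A ! k"
    by auto
  have "rev A ! (length A - 1 - k) = A ! k"
    using k by (auto simp: rev_nth intro!: arg_cong[of _ _ "(!) A"])
  then show "\<exists>k. 1 \<le> k \<and> k + 1 < length (rev A) \<and>
      (\<forall>y\<in>set (rev A @ rev D). {x, y} \<in> B \<longleftrightarrow> y = rev A ! k)"
    using k by (intro exI[of _ "length A - 1 - k"]) auto
qed (auto simp: arc_rev)

lemma maximal_arc_rev:
  assumes "maximal_arc B A D" "4 \<le> length A"
  shows "maximal_arc B (rev A) (rev D)"
proof -
  have "rev A ! 1 = A ! (length A - 2)" "rev A ! (length A - 2) = A ! 1"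
    using assms(2) by (auto simp: rev_nth numeral_2_eq_2 intro!: arg_cong[of _ _ "(!) A"])
  then show ?thesis using assms(1) unfolding maximal_arc_def
    by (auto simp: hd_rev last_rev)
qed

text \<open>If the first vertex of \<open>D\<close> is joined to the last interior vertex of the
  arc, this edge is the next short diagonal and the vertex extends the arc. The same holds at the
  other end, and \<open>D\<close> shrinks each time.\<close>

lemma arc_fan_maximal:
  assumes "arc_fan B A D" "distinct (A @ D)"
  shows "\<exists>A' D'. cyc (A @ D) (A' @ D') \<and> arc_fan B A' D' \<and> maximal_arc B A' D'"
  using assms
proof (induction "length D" arbitrary: A D rule: less_induct)
  case less
  \<comment> \<open>Only growth at the right end is proved; the left end follows by reversing both
    lists.\<close>
  have grow: "\<exists>A' D'. cyc (A @ D) (A' @ D') \<and> arc_fan B A' D' \<and> length D' < length D"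
    if af: "arc_fan B A D" and d: "distinct (A @ D)" and D: "D = d # D2"
      and e: "{A ! (length A - 2), d} \<in> B" for A D d D2
  proof -
    have A: "4 \<le> length A" "arc B A" using af unfolding arc_fan_def by auto
    obtain k where k: "k + 1 < length A" "\<forall>y\<in>set (A @ D). {d, y} \<in> B \<longleftrightarrow> y = A ! k"
      using af D unfolding arc_fan_def by auto
    have "A ! (length A - 2) = A ! k" using k(2) e A by (auto simp: insert_commute)
    then have "k = length A - 2" using d k A by (auto simp: nth_eq_iff_index_eq)
    have "arc B (A @ [d])" unfolding arc_snoc
    proof (intro conjI allI impI)
      fix j assume j: "j < length A"
      then have "{d, A ! j} \<in> B \<longleftrightarrow> A ! j = A ! k" using k(2) by auto
      also have "\<dots> \<longleftrightarrow> j + 2 = length A"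
        using d j k(1) A(1) \<open>k = length A - 2\<close> by (auto simp: nth_eq_iff_index_eq)
      finally show "{A ! j, d} \<in> B \<longleftrightarrow> j + 2 = length A" by (simp add: insert_commute)
    qed fact
    moreover have "\<exists>k. 1 \<le> k \<and> k + 1 < length (A @ [d]) \<and>
        (\<forall>y\<in>set ((A @ [d]) @ D2). {x, y} \<in> B \<longleftrightarrow> y = (A @ [d]) ! k)" if x: "x \<in> set D2" for x
    proof -
      obtain k where "1 \<le> k" "k + 1 < length A" "\<forall>y\<in>set (A @ D). {x, y} \<in> B \<longleftrightarrow> y = A ! k"
        using af x D unfolding arc_fan_def by auto
      then show ?thesis using D by (intro exI[of _ k]) (auto simp: nth_append)
    qed
    ultimately have "arc_fan B (A @ [d]) D2" using A unfolding arc_fan_def by auto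
    then show ?thesis using D
      by (intro exI[of _ "A @ [d]"] exI[of _ D2]) auto
  qed
  have "\<exists>A' D'. cyc (A @ D) (A' @ D') \<and> arc_fan B A' D' \<and> length D' < length D"
    if "\<not> maximal_arc B A D"
  proof -
    have ne: "D \<noteq> []" and "{A ! 1, last D} \<in> B \<or> {A ! (length A - 2), hd D} \<in> B"
      using that unfolding maximal_arc_def by auto
    then consider "{A ! 1, last D} \<in> B" | "{A ! (length A - 2), hd D} \<in> B" by blast
    then show ?thesis
    proof cases
      case 1
      have "4 \<le> length A" using less.prems unfolding arc_fan_def by simp
      then have "rev A ! (length (rev A) - 2) = A ! 1"
        by (auto simp: rev_nth intro!: arg_cong[of _ _ "(!) A"])
      moreover obtain d D2 where "rev D = d # D2" "d = last D" using ne
        by (cases "rev D") (auto simp: hd_rev[symmetric])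
      moreover have "distinct (rev A @ rev D)" using less.prems(2) by auto
      ultimately have "\<exists>A' D'. cyc (rev A @ rev D) (A' @ D') \<and> arc_fan B A' D' \<and> length D' < length (rev D)"
        using 1 by (intro grow[of "rev A" "rev D" d D2]) (simp_all add: arc_fan_rev[OF less.prems(1)] insert_commute)
      then obtain A' D' where A': "cyc (rev A @ rev D) (A' @ D')" "arc_fan B A' D'"
          "length D' < length D" by auto
      have "cyc (D @ A) (rev D' @ rev A')" using cyc_rev[OF A'(1)] by simp
      then have "cyc (A @ D) (rev A' @ rev D')" using cyc_trans cyc_append by blast
      moreover have "arc_fan B (rev A') (rev D')" "length (rev D') < length D"
        using A' arc_fan_rev by auto
      ultimately show ?thesis by blast
    next
      case 2
      then show ?thesis using grow[OF less.prems, of "hd D" "tl D"] ne by auto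
    qed
  qed
  moreover have ?case if "cyc (A @ D) (A' @ D')" "arc_fan B A' D'" "length D' < length D" for A' D'
    using less.hyps[OF that(3,2)] that(1) cyc_distinct[OF that(1)] less.prems(2) cyc_trans by metis
  ultimately show ?case using less.prems cyc_refl by blast
qed

section \<open>Reinserting an ear into a polygon of minimum size\<close>

lemma insertion_cases:
  assumes "cyc xs (w # ys)" "cyc ys (A @ D)"
  obtains D1 D2 where "D = D1 @ D2" "cyc xs (A @ D1 @ w # D2)"
  | A1 A2 where "A = A1 @ A2" "A1 \<noteq> []" "A2 \<noteq> []" "cyc xs (A1 @ w # A2 @ D)"
proof -
  obtain us vs where 1: "ys = us @ vs" "A @ D = vs @ us" using assms(2) unfolding cyc_def by blast
  have c: "cyc xs (vs @ w # us)"
    using cyc_trans[OF assms(1), of "vs @ w # us"] 1 cyc_append[of "w # us" vs] by simp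
  from 1(2) consider A2 where "A = vs @ A2" "us = A2 @ D" | D1 where "vs = A @ D1" "D = D1 @ us"
    unfolding append_eq_append_conv2 by auto
  then show thesis
  proof cases
    case (1 A2)
    consider "vs = []" | "A2 = []" | "vs \<noteq> []" "A2 \<noteq> []" by blast
    then show thesis
    proof cases
      \<comment> \<open>A place before the first vertex of \<open>A\<close> is one after the last
        vertex of \<open>D\<close>, so it counts as lying in \<open>D\<close>.\<close>
      assume "vs = []"
      then have "cyc xs (A @ D @ w # [])" using cyc_trans[OF c, of "A @ D @ [w]"] 1 cyc_append[of "[w]" "A @ D"]
        by simp
      then show thesis using that(1)[of D "[]"] by simp
    next
      assume "A2 = []"
      then show thesis using that(1)[of "[]" D] c 1 by simp
    next
      assume "vs \<noteq> []" "A2 \<noteq> []"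
      then show thesis using that(2)[of vs A2] c 1 by simp
    qed
  next
    case (2 D1)
    then show thesis using that(1)[of D1 us] c by simp
  qed
qed

lemma sidefree_adjacent:
  assumes "sidefree B xs" "cyc xs (us @ a # b # vs)"
  shows "{a, b} \<notin> B"
  using sidefree_cyc[OF assms(2,1)] unfolding sidefree_def
  by (cases us) (auto simp: successively_append_iff successively_Cons)

lemma cyc_shift: "cyc xs (us @ vs) \<Longrightarrow> cyc xs (vs @ us)"
  using cyc_trans cyc_append by blast

text \<open>The induction step of \<open>min_blocked_structure\<close>: \<open>w\<close> is an ear
  of \<open>xs\<close>, \<open>v\<close> its only neighbour, and the shape of the rest
  \<open>ys\<close> is known. A quadrilateral \<open>ys\<close>, whose arc may start anywhere, is
  treated directly in that theorem.\<close>

locale min_insertion =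
  fixes B :: "'a set set" and xs ys A D :: "'a list" and w v :: 'a
  assumes mb: "min_blocked B xs"
    and cyc_w: "cyc xs (w # ys)" and ear_w: "{hd ys, last ys} \<notin> B"
    and cyc_AD: "cyc ys (A @ D)" and af: "arc_fan B A D" and mx: "maximal_arc B A D"
    and len: "5 \<le> length ys"
    and v: "v \<in> set ys" and v_iff: "\<And>y. y \<in> set ys \<Longrightarrow> {w, y} \<in> B \<longleftrightarrow> y = v"
begin

lemma rev_insertion: "min_insertion B (rev xs) (rev ys) (rev A) (rev D) w v"
proof
  show "min_blocked B (rev xs)" using mb by (rule min_blocked_rev)
  show "cyc (rev xs) (w # rev ys)"
    using cyc_trans[OF cyc_rev[OF cyc_w], of "w # rev ys"] cyc_append[of "rev ys" "[w]"] by simp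
  show "{hd (rev ys), last (rev ys)} \<notin> B"
    using ear_w by (simp add: hd_rev last_rev insert_commute)
  show "cyc (rev ys) (rev A @ rev D)"
    using cyc_trans[OF cyc_rev[OF cyc_AD], of "rev A @ rev D"] by simp
  show "arc_fan B (rev A) (rev D)" using af by (rule arc_fan_rev)
  show "maximal_arc B (rev A) (rev D)" using mx af maximal_arc_rev unfolding arc_fan_def by blast
qed (use len v v_iff in auto)

lemma set_ys: "set ys = set A \<union> set D"
  using cyc_set[OF cyc_AD] by auto

lemma dist: "distinct A" "distinct D" "set A \<inter> set D = {}" "w \<notin> set A" "w \<notin> set D"
  using mb cyc_distinct[OF cyc_w] cyc_distinct[OF cyc_AD] set_ys unfolding min_blocked_def by auto

lemma len_A: "4 \<le> length A" and arc_A: "arc B A"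
  using af unfolding arc_fan_def by auto

lemma len_AD: "5 \<le> length A + length D"
  using len cyc_length[OF cyc_AD] by simp

lemma no_loop: "{x} \<notin> B"
  using mb unfolding min_blocked_def by auto

lemma w_iff: "y \<in> set A \<union> set D \<Longrightarrow> {w, y} \<in> B \<longleftrightarrow> y = v" "y \<in> set A \<union> set D \<Longrightarrow> {y, w} \<in> B \<longleftrightarrow> y = v"
  using v_iff[of y] set_ys by (auto simp: insert_commute)

lemma v_in: "v \<in> set A \<union> set D"
  using v set_ys by simp

lemma D_neighbour:
  assumes "x \<in> set D"
  obtains k where "1 \<le> k" "k + 1 < length A" "\<And>y. y \<in> set A \<union> set D \<Longrightarrow> {x, y} \<in> B \<longleftrightarrow> y = A ! k"
  using af assms unfolding arc_fan_def by fastforce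

lemma D_D: "x \<in> set D \<Longrightarrow> y \<in> set D \<Longrightarrow> {x, y} \<notin> B"
proof -
  assume xy: "x \<in> set D" "y \<in> set D"
  obtain k where k: "k + 1 < length A" "\<And>y. y \<in> set A \<union> set D \<Longrightarrow> {x, y} \<in> B \<longleftrightarrow> y = A ! k"
    using D_neighbour[OF xy(1)] by metis
  have "A ! k \<in> set A" using k(1) by simp
  then show ?thesis using k(2) xy dist by auto
qed

lemma D_ends: "x \<in> set D \<Longrightarrow> {x, hd A} \<notin> B \<and> {x, last A} \<notin> B"
proof -
  assume x: "x \<in> set D"
  obtain k where k: "1 \<le> k" "k + 1 < length A" "\<And>y. y \<in> set A \<union> set D \<Longrightarrow> {x, y} \<in> B \<longleftrightarrow> y = A ! k"
    using D_neighbour[OF x] by metis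
  have A: "A \<noteq> []" using len_A by auto
  then have "hd A = A ! 0" "last A = A ! (length A - 1)" by (auto simp: hd_conv_nth last_conv_nth)
  then have "A ! k \<noteq> hd A" "A ! k \<noteq> last A"
    using k(1,2) dist(1) A by (auto simp: nth_eq_iff_index_eq)
  moreover have "hd A \<in> set A" "last A \<in> set A" using A by auto
  ultimately show ?thesis using k(3) by auto
qed

lemma ends_not_short: "{hd A, last A} \<notin> B"
proof -
  have "A \<noteq> []" using len_A by auto
  then have "hd A = A ! 0" "last A = A ! (length A - 1)"
    by (auto simp: hd_conv_nth last_conv_nth)
  then show ?thesis using arc_A[unfolded arc_def, rule_format, of 0 "length A - 1"] len_A by auto
qed

lemma ear_w': "ear B xs w"
  unfolding ear_def using cyc_w ear_w by blast

text \<open>The main source of contradictions: \<open>w\<close> is an ear joined to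
  \<open>v\<close>, so a place for \<open>v\<close> is excluded as soon as the chord between its
  neighbours is missing from \<open>B\<close>.\<close>

lemma v_not_ear: "ear B xs v \<Longrightarrow> False"
  using min_blocked_ears_nonadjacent[OF mb ear_w'] v_iff[OF v] by simp

lemma adjacent_not_v:
  "cyc xs (us @ w # b # vs) \<Longrightarrow> v \<noteq> b" "cyc xs (us @ a # w # vs) \<Longrightarrow> v \<noteq> a"
proof -
  have sf: "sidefree B xs" using mb unfolding min_blocked_def by auto
  have wv: "{w, v} \<in> B" using v_iff[OF v] by simp
  show "cyc xs (us @ w # b # vs) \<Longrightarrow> v \<noteq> b"
    using sidefree_adjacent[OF sf] wv by blast
  show "cyc xs (us @ a # w # vs) \<Longrightarrow> v \<noteq> a"
    using sidefree_adjacent[OF sf] wv by (metis insert_commute)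
qed

lemma arc_fan_extend:
  assumes "D = D1 @ D2" "v = A ! k" "1 \<le> k" "k + 1 < length A"
  shows "arc_fan B A (D1 @ w # D2)"
  unfolding arc_fan_def
proof (intro conjI ballI)
  fix x assume x: "x \<in> set (D1 @ w # D2)"
  show "\<exists>k. 1 \<le> k \<and> k + 1 < length A \<and> (\<forall>y\<in>set (A @ D1 @ w # D2). {x, y} \<in> B \<longleftrightarrow> y = A ! k)"
  proof (cases "x = w")
    case True
    then show ?thesis using assms w_iff(1) no_loop[of w] dist(4) by (intro exI[of _ k]) auto
  next
    case False
    then have xD: "x \<in> set D" using x assms by auto
    then obtain l where l: "1 \<le> l" "l + 1 < length A"
      "\<And>y. y \<in> set A \<union> set D \<Longrightarrow> {x, y} \<in> B \<longleftrightarrow> y = A ! l"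
      using D_neighbour[OF xD] by metis
    have "v \<in> set A" "A ! l \<in> set A" using assms l by auto
    then have "{x, w} \<notin> B" "w \<noteq> A ! l" using w_iff(2)[of x] xD dist by auto
    then show ?thesis using l assms by (intro exI[of _ l]) auto
  qed
qed (use len_A arc_A in auto)

text \<open>It suffices that \<open>v\<close> is interior to \<open>A\<close>; elsewhere it would be
  an ear. Vertices of \<open>D\<close> have no edges among themselves or to the ends of
  \<open>A\<close>, which excludes \<open>D\<close>. Maximality excludes the ends of
  \<open>A\<close>.\<close>

lemma insertion_fan:
  assumes D: "D = D1 @ D2" and c: "cyc xs (A @ D1 @ w # D2)"
  shows "arc_fan B A (D1 @ w # D2)"
proof -
  have A: "A \<noteq> []" using len_A by auto
  have "v \<notin> set D1"
  proof
    assume "v \<in> set D1"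
    then obtain E1 E2 where E: "D1 = E1 @ v # E2" by (meson split_list)
    have "E2 \<noteq> []" using adjacent_not_v(2)[of "A @ E1" v D2] c E by auto
    then have "{hd ((E2 @ w # D2) @ A @ E1), last ((E2 @ w # D2) @ A @ E1)} \<notin> B"
      using D E A D_ends[of "hd E2"] D_D[of "hd E2" "last E1"]
      by (cases "E1 = []") auto
    then have "ear B xs v" using c E by (intro earI[of xs "A @ E1" v "E2 @ w # D2"]) auto
    then show False by (rule v_not_ear)
  qed
  moreover have "v \<notin> set D2"
  proof
    assume "v \<in> set D2"
    then obtain E1 E2 where E: "D2 = E1 @ v # E2" by (meson split_list)
    have "E1 \<noteq> []" using adjacent_not_v(1)[of "A @ D1" v E2] c E by auto
    then have "{hd (E2 @ A @ D1 @ w # E1), last (E2 @ A @ D1 @ w # E1)} \<notin> B"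
      using D E A D_ends[of "last E1"] D_D[of "hd E2" "last E1"]
      by (cases "E2 = []") (auto simp: insert_commute)
    then have "ear B xs v" using c E by (intro earI[of xs "A @ D1 @ w # E1" v E2]) auto
    then show False by (rule v_not_ear)
  qed
  ultimately have "v \<in> set A" using v_in D by auto
  then obtain k where k: "k < length A" "v = A ! k" by (metis in_set_conv_nth)
  have "k \<noteq> 0"
  proof
    assume "k = 0"
    then obtain A' where A': "A = v # A'" using k by (cases A) auto
    have "cyc xs ((D1 @ w # D2) @ v # A')" using cyc_trans[OF c cyc_append] A' by simp
    \<comment> \<open>If \<open>D2\<close> were empty, \<open>w\<close> would be adjacent to
      \<open>v\<close>. So the neighbours of \<open>v\<close> are \<open>A ! 1\<close> and the last
      vertex of \<open>D\<close>, to which maximality applies.\<close>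
    then have "D2 \<noteq> []" using adjacent_not_v(2)[of D1 v A'] adjacent_not_v(1)[of D1 v A'] by auto
    moreover have "hd A' = A ! 1" "A' \<noteq> []" using A' len_A by (cases A'; simp)+
    ultimately have "{hd ((A' @ D1 @ w # D2) @ []), last ((A' @ D1 @ w # D2) @ [])} \<notin> B"
      using mx D unfolding maximal_arc_def by auto
    then have "ear B xs v" using c A' by (intro earI[of xs "[]" v "A' @ D1 @ w # D2"]) auto
    then show False by (rule v_not_ear)
  qed
  moreover have "k \<noteq> length A - 1"
  proof
    assume "k = length A - 1"
    then have lv: "last A = v" using k A by (simp add: last_conv_nth)
    define A' where "A' = butlast A"
    have A': "A = A' @ [v]" using lv A unfolding A'_def by (metis append_butlast_last_id)
    then have "D1 \<noteq> []" using adjacent_not_v(2)[of A' v D2] c by auto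
    moreover have "last A' = A ! (length A - 2)" "A' \<noteq> []"
      using A' len_A by (cases A' rule: rev_cases; auto simp: nth_append)+
    ultimately have "{hd ((D1 @ w # D2) @ A'), last ((D1 @ w # D2) @ A')} \<notin> B"
      using mx D unfolding maximal_arc_def by (auto simp: insert_commute)
    then have "ear B xs v" using c A' by (intro earI[of xs A' v "D1 @ w # D2"]) auto
    then show False by (rule v_not_ear)
  qed
  ultimately show ?thesis using arc_fan_extend[OF D k(2)] k(1) by simp
qed

lemma hd_neighbour:
  assumes A: "A = f # A2" and nv: "v \<noteq> f" and y: "y \<in> set (w # A @ D)"
  shows "{f, y} \<in> B \<longleftrightarrow> y = A2 ! 1"
proof -
  have f2: "\<And>j. j < length A2 \<Longrightarrow> {f, A2 ! j} \<in> B \<longleftrightarrow> j = 1"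
    using arc_A unfolding A arc_Cons by auto
  have A21: "1 < length A2" "A2 ! 1 \<in> set A2" using len_A A by auto
  consider "y = w" | "y = f" | "y \<in> set D" | "y \<in> set A2" using y A by auto
  then show ?thesis
  proof cases
    case 1
    then show ?thesis using w_iff(2)[of f] nv dist(4) A A21 by auto
  next
    case 2
    then show ?thesis using no_loop[of f] dist(1) A A21 by auto
  next
    case 3
    then have "{f, y} \<notin> B" "y \<noteq> A2 ! 1"
      using D_ends[of y] dist(3) A A21(2) by (auto simp: insert_commute)
    then show ?thesis by simp
  next
    case 4
    then obtain j where j: "j < length A2" "y = A2 ! j" by (metis in_set_conv_nth)
    moreover have "A2 ! j = A2 ! 1 \<longleftrightarrow> j = 1"
      using dist(1) A j(1) A21(1) by (simp add: nth_eq_iff_index_eq)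
    ultimately show ?thesis using f2 by auto
  qed
qed

text \<open>If \<open>v\<close> is the third vertex \<open>g\<close>, then \<open>w\<close> takes
  the place of \<open>f\<close> at the start of the arc, and \<open>f\<close>, joined only to
  \<open>g\<close>, moves to \<open>D\<close>. Otherwise the second vertex \<open>c'\<close> is an
  ear whose only edge goes to the fourth vertex; the arc can begin at \<open>c'\<close>, with
  \<open>f\<close> and \<open>w\<close> moved to \<open>D\<close>.\<close>

lemma insertion_end:
  assumes A: "A = f # A2" and c: "cyc xs (f # w # A2 @ D)"
  shows "\<exists>A' D'. cyc xs (A' @ D') \<and> arc_fan B A' D'"
proof -
  obtain c' g A4 where A2: "A2 = c' # g # A4" "A4 \<noteq> []"
    using len_A A by (cases A2; cases "tl A2"; cases "tl (tl A2)"; auto)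
  have nv: "v \<noteq> f" "v \<noteq> c'"
    using adjacent_not_v(1)[of "[f]" c' "g # A4 @ D"] adjacent_not_v(2)[of "[]" f "A2 @ D"] c A2 by auto
  have arc2: "arc B A2" using arc_A unfolding A arc_Cons by blast
  have f_iff: "{f, y} \<in> B \<longleftrightarrow> y = g" if "y \<in> set (w # A @ D)" for y
    using hd_neighbour[OF A nv(1) that] A2 by simp
  show ?thesis
  proof (cases "v = g")
    case True
    have "arc B (w # A2)" unfolding arc_Cons
    proof (intro conjI allI impI)
      fix j assume j: "j < length A2"
      then have "A2 ! j \<in> set A" using A nth_mem[OF j] by simp
      then have "{w, A2 ! j} \<in> B \<longleftrightarrow> A2 ! j = A2 ! 1"
        using w_iff(1)[of "A2 ! j"] True A2 by simp
      then show "{w, A2 ! j} \<in> B \<longleftrightarrow> j = 1"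
        using j dist(1) A A2 nth_eq_iff_index_eq[of A2 j 1] by simp
    qed fact
    moreover have "\<exists>k. 1 \<le> k \<and> k + 1 < length (w # A2) \<and>
        (\<forall>y\<in>set ((w # A2) @ D @ [f]). {x, y} \<in> B \<longleftrightarrow> y = (w # A2) ! k)" if x: "x \<in> set (D @ [f])" for x
    proof (cases "x = f")
      case True
      have "2 + 1 < length (w # A2)" using A2 by (cases A4) auto
      moreover have "{x, y} \<in> B \<longleftrightarrow> y = (w # A2) ! 2" if "y \<in> set ((w # A2) @ D @ [f])" for y
        using f_iff[of y] that True A A2(1) by auto
      ultimately show ?thesis by (intro exI[of _ 2]) simp
    next
      case False
      then have xD: "x \<in> set D" using x by auto
      then obtain k where k: "1 \<le> k" "k + 1 < length A"
        "\<And>y. y \<in> set A \<union> set D \<Longrightarrow> {x, y} \<in> B \<longleftrightarrow> y = A ! k"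
        using D_neighbour[OF xD] by metis
      have Ak: "A ! k = (w # A2) ! k" using k(1) A by (cases k) auto
      have "A ! k \<in> set A" using k(2) by simp
      then have "{x, w} \<notin> B" "w \<noteq> A ! k" using w_iff(2)[of x] xD dist True A A2 by auto
      then have "{x, y} \<in> B \<longleftrightarrow> y = (w # A2) ! k" if "y \<in> set ((w # A2) @ D @ [f])" for y
        using k(3)[of y] that Ak A by (cases "y = w") auto
      then show ?thesis using k A by (intro exI[of _ k]) simp
    qed
    ultimately have "arc_fan B (w # A2) (D @ [f])" using len_A A unfolding arc_fan_def by auto
    moreover have "cyc xs ((w # A2) @ D @ [f])" using cyc_trans[OF c cyc_Cons_snoc] by simp
    ultimately show ?thesis by blast
  next
    case False
    have ear_c: "{hd ((g # A4 @ D) @ [f, w]), last ((g # A4 @ D) @ [f, w])} \<notin> B"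
      using w_iff(2)[of g] False A A2 by auto
    have cc: "cyc xs (c' # (g # A4 @ D) @ [f, w])"
      using cyc_shift[of xs "[f, w]" "A2 @ D"] c A2 by simp
    obtain u where u: "\<And>y. y \<in> set ((g # A4 @ D) @ [f, w]) \<Longrightarrow> {c', y} \<in> B \<longleftrightarrow> y = u"
      using min_blocked_ear_unique[OF mb cc ear_c] by metis
    have "{c', hd A4} \<in> B"
      using arc2 A2 unfolding arc_Cons by (cases A4) (auto simp: arc_Cons)
    then have hA4: "u = hd A4" using u[of "hd A4"] A2 by auto
    have c_iff: "{c', y} \<in> B \<longleftrightarrow> y = hd A4" if "y \<in> set (w # A @ D)" "y \<noteq> c'" for y
      using u[of y] that A A2 hA4 by auto
    \<comment> \<open>As in \<open>insertion_fan\<close>, every place for \<open>v\<close> outside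
      the interior of the new arc would make it an ear.\<close>
    have "v \<notin> set D"
    proof
      assume "v \<in> set D"
      then obtain E1 E2 where E: "D = E1 @ v # E2" by (meson split_list)
      have "A \<noteq> []" "A2 \<noteq> []" using A A2 by auto
      then have "{hd (E2 @ A), last (A @ E1)} \<notin> B"
        using E D_ends[of "hd E2"] D_ends[of "last E1"] D_D[of "hd E2" "last E1"] ends_not_short
        by (cases "E1 = []"; cases "E2 = []") (auto simp: insert_commute)
      moreover have "last (E2 @ f # w # A2 @ E1) = last (A @ E1)"
        "hd (E2 @ f # w # A2 @ E1) = hd (E2 @ A)"
        using A \<open>A2 \<noteq> []\<close> by (cases "E1 = []"; cases "E2 = []"; simp)+
      ultimately have "ear B xs v" using c E
        by (intro earI[of xs "f # w # A2 @ E1" v E2]) simp_all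
      then show False by (rule v_not_ear)
    qed
    moreover have "v \<noteq> last A"
    proof
      assume lv: "v = last A"
      define A' where "A' = butlast A4"
      have A': "A4 = A' @ [v]" using lv A A2 unfolding A'_def by simp
      have "last (f # w # c' # g # A') = A ! (length A - 2)" using A A2 A'
        by (cases A' rule: rev_cases) (auto simp: nth_append nth_Cons split: nat.splits)
      moreover have "{hd (D @ [f]), A ! (length A - 2)} \<notin> B"
      proof (cases "D = []")
        case True
        then have "length A \<ge> 5" using len_AD by simp
        then show ?thesis using True arc_A[unfolded arc_def, rule_format, of 0 "length A - 2"] A by auto
      qed (use mx in \<open>auto simp: maximal_arc_def insert_commute\<close>)
      ultimately have "ear B xs v" using c A2 A'
        by (intro earI[of xs "f # w # c' # g # A'" v D]) (auto simp: hd_append)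
      then show False by (rule v_not_ear)
    qed
    ultimately have "v \<in> set A4" "v \<noteq> last A4" using v_in A A2 nv False by auto
    then obtain l where l: "l < length A4" "v = A4 ! l" by (metis in_set_conv_nth)
    have l2: "l + 1 < length A4" using l \<open>v \<noteq> last A4\<close> A2
      by (cases "l = length A4 - 1") (auto simp: last_conv_nth)
    have vA: "v \<in> set A" using l A A2 by auto
    have "\<exists>k. 1 \<le> k \<and> k + 1 < length A2 \<and>
        (\<forall>y\<in>set (A2 @ D @ [f, w]). {x, y} \<in> B \<longleftrightarrow> y = A2 ! k)" if x: "x \<in> set (D @ [f, w])" for x
    proof -
      consider "x = f" | "x = w" | "x \<in> set D" using x by auto
      then show ?thesis
      proof cases
        case 1
        have "{x, y} \<in> B \<longleftrightarrow> y = A2 ! 1" if "y \<in> set (A2 @ D @ [f, w])" for y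
          using f_iff[of y] that 1 A A2(1) by auto
        then show ?thesis using A2 l2 by (intro exI[of _ 1]) simp
      next
        case 2
        have "v \<noteq> w" using vA dist by auto
        have "{x, y} \<in> B \<longleftrightarrow> y = A2 ! (l + 2)" if "y \<in> set (A2 @ D @ [f, w])" for y
          using w_iff(1)[of y] no_loop[of w] that 2 \<open>v \<noteq> w\<close> l(2) A A2(1) by (cases "y = w") auto
        then show ?thesis using l2 A2 by (intro exI[of _ "l + 2"]) simp
      next
        case 3
        then obtain k where k: "1 \<le> k" "k + 1 < length A"
          "\<And>y. y \<in> set A \<union> set D \<Longrightarrow> {x, y} \<in> B \<longleftrightarrow> y = A ! k"
          using D_neighbour[OF 3] by metis
        \<comment> \<open>No vertex of \<open>D\<close> may be joined to \<open>c'\<close>, which is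
          now an end of the arc; positions then drop by one.\<close>
        have "{c', x} \<notin> B" using c_iff[of x] 3 A A2 dist by (cases A4) auto
        then have "A ! k \<noteq> c'" using k(3)[of c'] A A2 by (auto simp: insert_commute)
        then have "k \<noteq> 1" using A A2 by auto
        then have "1 \<le> k - 1" "A ! k = A2 ! (k - 1)" using k(1) A by (auto simp: nth_Cons split: nat.splits)
        moreover have "A ! k \<in> set A" using k(2) by simp
        then have "{x, w} \<notin> B" "w \<noteq> A ! k" using w_iff(2)[of x] 3 dist vA by auto
        moreover have "{x, y} \<in> B \<longleftrightarrow> y = A ! k" if "y \<in> set (A2 @ D @ [f, w])" for y
          using k(3)[of y] that \<open>{x, w} \<notin> B\<close> \<open>w \<noteq> A ! k\<close> A by (cases "y = w") auto
        ultimately show ?thesis using k A by (intro exI[of _ "k - 1"]) simp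
      qed
    qed
    then have "arc_fan B A2 (D @ [f, w])" using arc2 l2 A2 unfolding arc_fan_def by auto
    moreover have "cyc xs (A2 @ D @ [f, w])"
      using cyc_shift[of xs "[f, w]" "A2 @ D"] c by simp
    ultimately show ?thesis by blast
  qed
qed

text \<open>Since \<open>v\<close> differs from \<open>a'\<close>, the vertex \<open>a\<close>
  between \<open>a'\<close> and \<open>w\<close> is an ear, and its single edge is the short
  diagonal to \<open>b'\<close>. A vertex before \<open>a'\<close> would give it a second
  one.\<close>

lemma insertion_middle_left_end:
  assumes A: "A = C1 @ [a', a] @ b # b' # C2" and c: "cyc xs ((C1 @ [a', a]) @ w # (b # b' # C2) @ D)"
    and "v \<noteq> a'"
  shows "C1 = [] \<and> (\<forall>y\<in>set A \<union> set D - {a}. {a, y} \<in> B \<longleftrightarrow> y = b')"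
proof -
  have cc: "cyc xs (a # (w # b # b' # C2 @ D) @ C1 @ [a'])"
    using cyc_shift[of xs "C1 @ [a']" "a # w # b # b' # C2 @ D"] c by simp
  have ear: "{hd ((w # b # b' # C2 @ D) @ C1 @ [a']), last ((w # b # b' # C2 @ D) @ C1 @ [a'])} \<notin> B"
    using w_iff(1)[of a'] A \<open>v \<noteq> a'\<close> by auto
  obtain u where u: "\<And>y. y \<in> set ((w # b # b' # C2 @ D) @ C1 @ [a']) \<Longrightarrow> {a, y} \<in> B \<longleftrightarrow> y = u"
    using min_blocked_ear_unique[OF mb cc ear] by metis
  have "{a, b'} \<in> B"
    using arc_A[unfolded arc_def, rule_format, of "length C1 + 1" "length C1 + 3"] A
    by (simp add: nth_append nth_Cons numeral_3_eq_3)
  then have "u = b'" using u[of b'] by simp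
  then have 1: "{a, y} \<in> B \<longleftrightarrow> y = b'" if "y \<in> set A \<union> set D - {a}" for y
    using u[of y] that A by auto
  have "C1 = []"
  proof (rule ccontr)
    assume "C1 \<noteq> []"
    then obtain C z where C1: "C1 = C @ [z]" by (metis rev_exhaust)
    then have "{z, a} \<in> B"
      using arc_A[unfolded arc_def, rule_format, of "length C" "length C + 2"] A
      by (simp add: nth_append nth_Cons)
    then show False using 1[of z] dist(1) A C1 by (auto simp: insert_commute)
  qed
  then show ?thesis using 1 by blast
qed

text \<open>The vertices \<open>a'\<close> and \<open>a\<close> have one edge each, to
  \<open>b\<close> and \<open>b'\<close>. The edge from \<open>w\<close> to \<open>v\<close> is the
  first short diagonal of an arc beginning with \<open>w\<close>, in which \<open>b\<close> and
  \<open>b'\<close> are interior; so \<open>a'\<close> and \<open>a\<close> move to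
  \<open>D\<close>.\<close>

lemma insertion_middle_right:
  assumes A: "A = C1 @ [a', a] @ b # b' # C2" and c: "cyc xs ((C1 @ [a', a]) @ w # (b # b' # C2) @ D)"
    and vb: "v = b'"
  shows "\<exists>A' D'. cyc xs (A' @ D') \<and> arc_fan B A' D'"
proof -
  have nv: "v \<noteq> a'" "v \<noteq> a" using vb A dist(1) by auto
  have C1: "C1 = []" and a_iff: "\<And>y. y \<in> set A \<union> set D \<Longrightarrow> y \<noteq> a \<Longrightarrow> {a, y} \<in> B \<longleftrightarrow> y = b'"
    using insertion_middle_left_end[OF A c nv(1)] by auto
  define A2 where "A2 = b # b' # C2"
  have A': "A = a' # a # A2" using A C1 A2_def by simp
  have arc2: "arc B A2" using arc_A unfolding A' arc_Cons by blast
  have f_iff: "{a', y} \<in> B \<longleftrightarrow> y = b" if "y \<in> set (w # A @ D)" for y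
    using hd_neighbour[OF A' nv(1) that] A2_def by simp
  \<comment> \<open>Otherwise \<open>v\<close> is the last vertex of the arc and, by maximality, an
    ear.\<close>
  have C2: "C2 \<noteq> []"
  proof
    assume C2: "C2 = []"
    then have "D \<noteq> []" using len_AD A' A2_def by auto
    then have "{hd (D @ [a', a, w, b]), last (D @ [a', a, w, b])} \<notin> B"
      using mx C2 A' A2_def unfolding maximal_arc_def by (auto simp: insert_commute)
    then have "ear B xs v" using c C1 C2 vb by (intro earI[of xs "[a', a, w, b]" v D]) auto
    then show False by (rule v_not_ear)
  qed
  have vA: "v \<in> set A" using vb A by simp
  have "arc B (w # A2)" unfolding arc_Cons
  proof (intro conjI allI impI)
    fix j assume j: "j < length A2"
    then have "A2 ! j \<in> set A" using A' nth_mem[OF j] by simp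
    then have "{w, A2 ! j} \<in> B \<longleftrightarrow> A2 ! j = A2 ! 1"
      using w_iff(1)[of "A2 ! j"] vb A2_def by simp
    then show "{w, A2 ! j} \<in> B \<longleftrightarrow> j = 1"
      using j dist(1) A' A2_def nth_eq_iff_index_eq[of A2 j 1] by simp
  qed fact
  moreover have "\<exists>k. 1 \<le> k \<and> k + 1 < length (w # A2) \<and>
      (\<forall>y\<in>set ((w # A2) @ D @ [a', a]). {x, y} \<in> B \<longleftrightarrow> y = (w # A2) ! k)" if x: "x \<in> set (D @ [a', a])" for x
  proof -
    consider "x = a'" | "x = a" | "x \<in> set D" using x by auto
    then show ?thesis
    proof cases
      case 1
      have "{x, y} \<in> B \<longleftrightarrow> y = (w # A2) ! 1" if "y \<in> set ((w # A2) @ D @ [a', a])" for y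
        using f_iff[of y] that 1 A' A2_def by auto
      then show ?thesis using A2_def by (intro exI[of _ 1]) simp
    next
      case 2
      have "{a, w} \<notin> B" using w_iff(2)[of a] nv A' by simp
      then have "{x, y} \<in> B \<longleftrightarrow> y = (w # A2) ! 2" if "y \<in> set ((w # A2) @ D @ [a', a])" for y
        using a_iff[of y] no_loop[of a] that 2 vb nv vA dist A' A2_def by (cases "y = w"; cases "y = a") auto
      then show ?thesis using A2_def C2 by (intro exI[of _ 2]) simp
    next
      case 3
      then obtain k where k: "1 \<le> k" "k + 1 < length A"
        "\<And>y. y \<in> set A \<union> set D \<Longrightarrow> {x, y} \<in> B \<longleftrightarrow> y = A ! k"
        using D_neighbour[OF 3] by metis
      have "{a, x} \<notin> B" using a_iff[of x] 3 A dist(3) by auto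
      then have "A ! k \<noteq> a" using k(3)[of a] A by (auto simp: insert_commute)
      then have "k \<noteq> 1" using A' by auto
      then have k2: "1 \<le> k - 1" "A ! k = (w # A2) ! (k - 1)"
        using k(1) A' by (auto simp: nth_Cons split: nat.splits)
      have "A ! k \<in> set A" using k(2) by simp
      then have "{x, w} \<notin> B" "w \<noteq> A ! k" using w_iff(2)[of x] 3 dist vA by auto
      then have "{x, y} \<in> B \<longleftrightarrow> y = A ! k" if "y \<in> set ((w # A2) @ D @ [a', a])" for y
        using k(3)[of y] that A' by (cases "y = w") auto
      then show ?thesis using k k2 A' by (intro exI[of _ "k - 1"]) simp
    qed
  qed
  ultimately have "arc_fan B (w # A2) (D @ [a', a])"
    using A2_def C2 unfolding arc_fan_def by (cases C2) auto
  moreover have "cyc xs ((w # A2) @ D @ [a', a])"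
    using cyc_shift[of xs "[a', a]" "w # A2 @ D"] c C1 A2_def by simp
  ultimately show ?thesis by blast
qed

text \<open>If \<open>v\<close> is neither \<open>a'\<close> nor \<open>b'\<close>, both
  \<open>a\<close> and \<open>b\<close> are ears with a single edge, and the arc has four vertices.
  Each vertex of \<open>D\<close> would have an edge to \<open>a\<close> or \<open>b\<close>, so
  \<open>D\<close> is empty, against the size of \<open>ys\<close>.\<close>

lemma insertion_middle:
  assumes A: "A = C1 @ [a', a] @ b # b' # C2" and c: "cyc xs ((C1 @ [a', a]) @ w # (b # b' # C2) @ D)"
  shows "\<exists>A' D'. cyc xs (A' @ D') \<and> arc_fan B A' D'"
proof -
  interpret r: min_insertion B "rev xs" "rev ys" "rev A" "rev D" w v by (rule rev_insertion)
  have rA: "rev A = rev C2 @ [b', b] @ a # a' # rev C1" using A by simp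
  have "cyc (rev xs) (rev D @ (rev C2 @ [b', b]) @ w # (a # a' # rev C1))"
    using cyc_rev[OF c] by simp
  then have rc: "cyc (rev xs) ((rev C2 @ [b', b]) @ w # (a # a' # rev C1) @ rev D)"
    using cyc_shift[of "rev xs" "rev D" "(rev C2 @ [b', b]) @ w # a # a' # rev C1"] by simp
  consider "v = b'" | "v = a'" | "v \<noteq> a'" "v \<noteq> b'" by blast
  then show ?thesis
  proof cases
    case 1
    then show ?thesis using insertion_middle_right[OF A c] by simp
  next
    case 2
    then obtain A' D' where A': "cyc (rev xs) (A' @ D')" "arc_fan B A' D'"
      using r.insertion_middle_right[OF rA rc] by blast
    have "cyc xs (rev D' @ rev A')" using cyc_rev[OF A'(1)] by simp
    then have "cyc xs (rev A' @ rev D')" by (rule cyc_shift)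
    then show ?thesis using arc_fan_rev[OF A'(2)] by blast
  next
    case 3
    have l: "C1 = []" "\<And>y. y \<in> set A \<union> set D \<Longrightarrow> y \<noteq> a \<Longrightarrow> {a, y} \<in> B \<longleftrightarrow> y = b'"
      using insertion_middle_left_end[OF A c 3(1)] by auto
    have r: "C2 = []" "\<And>y. y \<in> set A \<union> set D \<Longrightarrow> y \<noteq> b \<Longrightarrow> {b, y} \<in> B \<longleftrightarrow> y = a'"
      using r.insertion_middle_left_end[OF rA rc 3(2)] by auto
    have A4: "A = [a', a, b, b']" using A l r by simp
    have "D = []"
    proof (rule ccontr)
      assume "D \<noteq> []"
      then have x: "hd D \<in> set D" by simp
      then obtain k where k: "1 \<le> k" "k + 1 < length A" "{hd D, A ! k} \<in> B"
        using D_neighbour[OF x] A4 by (metis UnI1 add_lessD1 nth_mem)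
      then have "k = 1 \<or> k = 2" using A4 by auto
      then have "{a, hd D} \<in> B \<or> {b, hd D} \<in> B" using k A4 by (auto simp: insert_commute)
      then show False using l(2)[of "hd D"] r(2)[of "hd D"] x dist(3) A4 by auto
    qed
    then show ?thesis using len_AD A4 by simp
  qed
qed

lemma insertion:
  "\<exists>A' D'. cyc xs (A' @ D') \<and> arc_fan B A' D'"
  using cyc_w cyc_AD
proof (cases rule: insertion_cases)
  case (1 D1 D2)
  then show ?thesis using insertion_fan[OF 1] by blast
next
  case (2 A1 A2)
  consider "length A1 = 1" | "length A2 = 1" | "length A1 \<ge> 2" "length A2 \<ge> 2"
    using 2(2,3) by (cases A1; cases A2; cases "tl A1"; cases "tl A2"; auto)
  then show ?thesis
  proof cases
    case a: 1
    then obtain f where "A1 = [f]" by (cases A1) auto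
    then show ?thesis using insertion_end[of f A2] 2 by simp
  next
    case a: 2
    then obtain e where e: "A2 = [e]" by (cases A2) auto
    interpret r: min_insertion B "rev xs" "rev ys" "rev A" "rev D" w v by (rule rev_insertion)
    have "cyc (rev xs) (rev D @ e # w # rev A1)" using cyc_rev[OF 2(4)] e by simp
    then have "cyc (rev xs) (e # w # rev A1 @ rev D)"
      using cyc_shift[of "rev xs" "rev D" "e # w # rev A1"] by simp
    then obtain A' D' where A': "cyc (rev xs) (A' @ D')" "arc_fan B A' D'"
      using r.insertion_end[of e "rev A1"] 2 e by auto
    have "cyc xs (rev D' @ rev A')" using cyc_rev[OF A'(1)] by simp
    then have "cyc xs (rev A' @ rev D')" by (rule cyc_shift)
    then show ?thesis using arc_fan_rev[OF A'(2)] by blast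
  next
    case a: 3
    obtain C1 a' a where "A1 = C1 @ [a', a]"
      using a(1) by (cases A1 rule: rev_cases; cases "butlast A1" rule: rev_cases; auto)
    moreover obtain b b' C2 where "A2 = b # b' # C2"
      using a(2) by (cases A2; cases "tl A2"; auto)
    ultimately show ?thesis using insertion_middle[of C1 a' a b b' C2] 2 by simp
  qed
qed

end

text \<open>Either diagonal alone is a triangulation, so both lie in \<open>B\<close>.\<close>

lemma arc_fan_quadrilateral:
  assumes "min_blocked B xs" "length xs = 4"
  shows "arc_fan B xs []"
proof -
  obtain a b c d where xs: "xs = [a, b, c, d]"
    using assms(2) by (auto simp: length_Suc_conv numeral_eq_Suc)
  have nt: "\<not> tri B xs" and "sidefree B xs" using assms(1) unfolding min_blocked_def by auto
  then have "{a, b} \<notin> B" "{b, c} \<notin> B" "{c, d} \<notin> B" "{a, d} \<notin> B"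
    using xs by (auto simp: sidefree_def insert_commute)
  moreover have "{a, c} \<in> B"
    using tri_split[of B a "[b]" c "[d]"] nt xs by (auto simp: tri_base)
  moreover have "{b, d} \<in> B"
    using tri_split[of B b "[c]" d "[a]"] tri_rot[of B "[b, c, d]" "[a]"] nt xs by (auto simp: tri_base)
  ultimately have "arc B xs" unfolding xs arc_Cons
    by (auto simp: less_Suc_eq arc_def)
  then show ?thesis using assms(2) unfolding arc_fan_def by simp
qed

theorem min_blocked_structure:
  assumes "min_blocked B xs"
  obtains A D where "cyc xs (A @ D)" "arc_fan B A D" "maximal_arc B A D"
proof -
  have "\<exists>A D. cyc xs (A @ D) \<and> arc_fan B A D"
    using assms
  proof (induction "length xs" arbitrary: xs rule: less_induct)
    case less
    show ?case
    proof (cases "length xs = 4")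
      case True
      then have "arc_fan B xs []" using arc_fan_quadrilateral less.prems by blast
      then show ?thesis using cyc_refl[of xs] by (metis append_Nil2)
    next
      case False
      then have 5: "length xs \<ge> 5" using less.prems unfolding min_blocked_def by auto
      have "\<exists>w. ear B xs w"
        using exists_ear[OF _ 5] less.prems unfolding min_blocked_def by auto
      then obtain w ys where w: "cyc xs (w # ys)" "{hd ys, last ys} \<notin> B" unfolding ear_def by blast
      have mb: "min_blocked B ys" using min_blocked_remove_ear[OF less.prems w 5] .
      have len: "length xs = length ys + 1" using cyc_length[OF w(1)] by simp
      obtain A0 D0 where A0: "cyc ys (A0 @ D0)" "arc_fan B A0 D0" using less.hyps[OF _ mb] len by auto
      have "distinct (A0 @ D0)" using mb cyc_distinct[OF A0(1)] unfolding min_blocked_def by simp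
      then obtain A D where AD: "cyc ys (A @ D)" "arc_fan B A D" "maximal_arc B A D"
        using arc_fan_maximal[OF A0(2)] A0(1) cyc_trans by blast
      obtain v where v: "v \<in> set ys" "\<And>y. y \<in> set ys \<Longrightarrow> {w, y} \<in> B \<longleftrightarrow> y = v"
        using min_blocked_ear_unique[OF less.prems w] by metis
      show ?thesis
      proof (cases "length ys = 4")
        case True
        \<comment> \<open>All of \<open>ys\<close> is the arc. The new vertex lies between its two
          ends, and since sides are not in \<open>B\<close>, its neighbour is one of the two middle
          vertices.\<close>
        then have af: "arc_fan B ys []" using arc_fan_quadrilateral[OF mb] by simp
        obtain a b c d where ys: "ys = [a, b, c, d]"
          using True by (auto simp: length_Suc_conv numeral_eq_Suc)
        have "sidefree B (w # ys)" and nl: "\<forall>x. {x} \<notin> B"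
          using less.prems sidefree_cyc[OF w(1)] unfolding min_blocked_def by auto
        then have "{w, a} \<notin> B" "{w, d} \<notin> B" unfolding sidefree_def ys by (auto simp: insert_commute)
        then have "v = b \<or> v = c" using v ys by auto
        moreover have "w \<notin> set ys" using less.prems cyc_distinct[OF w(1)] unfolding min_blocked_def by auto
        ultimately have "\<exists>k. 1 \<le> k \<and> k + 1 < length ys \<and> (\<forall>y\<in>set (ys @ [w]). {w, y} \<in> B \<longleftrightarrow> y = ys ! k)"
          using v nl ys by (intro exI[of _ "if v = b then 1 else 2"]) auto
        then have "arc_fan B ys [w]" using af unfolding arc_fan_def by simp
        moreover have "cyc xs (ys @ [w])" using cyc_shift[of xs "[w]" ys] w(1) by simp
        ultimately show ?thesis by blast
      next
        case False
        then have "5 \<le> length ys" using 5 len by simp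
        then interpret min_insertion B xs ys A D w v
          using less.prems w AD v by unfold_locales auto
        show ?thesis by (rule insertion)
      qed
    qed
  qed
  then obtain A0 D0 where A0: "cyc xs (A0 @ D0)" "arc_fan B A0 D0" by blast
  have "distinct (A0 @ D0)" using assms cyc_distinct[OF A0(1)] unfolding min_blocked_def by simp
  then show thesis using arc_fan_maximal[OF A0(2)] A0(1) cyc_trans that by blast
qed

section \<open>Inserting a vertex of degree two\<close>

text \<open>Type 3, where A lists the vertices \<open>0, ..., m + 2\<close> and p, q are the vertices \<open>k, k + t\<close>. Only an
  inclusion is recorded, which is enough because there are at most n - 1 edges of these kinds.\<close>

definition bouquet_on :: "'a set set \<Rightarrow> 'a list \<Rightarrow> 'a list \<Rightarrow> 'a \<Rightarrow> 'a list \<Rightarrow> 'a \<Rightarrow> 'a list \<Rightarrow> nat \<Rightarrow> ('a \<Rightarrow> nat) \<Rightarrow> bool" where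
  "bouquet_on B A L p M q R l h \<longleftrightarrow> M \<noteq> [] \<and> 0 < l \<and> l + 1 < length A \<and>
     (\<forall>x\<in>set L. l \<le> h x \<and> h x + 1 < length A) \<and> (\<forall>x\<in>set R. 1 \<le> h x \<and> h x \<le> l) \<and>
     sorted_wrt (\<lambda>x y. h y \<le> h x + 1) L \<and> sorted_wrt (\<lambda>x y. h y \<le> h x + 1) R \<and>
     (\<forall>e\<in>B. e = {p, A ! (l - 1)} \<or> e = {q, A ! (l + 1)} \<or> e = {p, q} \<or> (\<exists>x\<in>set M. e = {x, A ! l}) \<or>
        (\<exists>i. i + 2 < length A \<and> e = {A ! i, A ! (i + 2)}) \<or> (\<exists>x\<in>set L \<union> set R. e = {x, A ! h x}))"

definition bouquet :: "'a set set \<Rightarrow> 'a list \<Rightarrow> bool" where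
  "bouquet B xs \<longleftrightarrow>
     (\<exists>A L p M q R l h. cyc xs (A @ L @ p # M @ q # R) \<and> bouquet_on B A L p M q R l h)"

lemma sorted_wrt_rev_sub:
  assumes "sorted_wrt (\<lambda>x y. h y \<le> h x + 1) xs" "\<forall>x\<in>set xs. h x \<le> (n::nat)"
  shows "sorted_wrt (\<lambda>x y. n - h y \<le> n - h x + 1) (rev xs)"
  unfolding sorted_wrt_rev
  by (rule sorted_wrt_mono_rel[OF _ assms(1)]) (use assms(2) in auto)

lemma short_rev:
  assumes "i + 2 < length A"
  shows "length A - 3 - i + 2 < length A"
    "{A ! i, A ! (i + 2)} = {rev A ! (length A - 3 - i), rev A ! (length A - 3 - i + 2)}"
proof -
  have "rev A ! (length A - 3 - i) = A ! (i + 2)" "rev A ! (length A - 3 - i + 2) = A ! i"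
    using assms by (auto simp: rev_nth intro!: arg_cong[of _ _ "(!) A"])
  then show "{A ! i, A ! (i + 2)} = {rev A ! (length A - 3 - i), rev A ! (length A - 3 - i + 2)}"
    by auto
qed (use assms in auto)

lemma bouquet_on_rev:
  assumes "bouquet_on B A L p M q R l h"
  shows "bouquet_on B (rev A) (rev R) q (rev M) p (rev L) (length A - 1 - l) (\<lambda>x. length A - 1 - h x)"
proof -
  have M: "M \<noteq> []" and l: "0 < l" "l + 1 < length A"
    and L: "\<forall>x\<in>set L. l \<le> h x \<and> h x + 1 < length A" and R: "\<forall>x\<in>set R. 1 \<le> h x \<and> h x \<le> l"
    and s: "sorted_wrt (\<lambda>x y. h y \<le> h x + 1) L" "sorted_wrt (\<lambda>x y. h y \<le> h x + 1) R"
    using assms by (simp_all add: bouquet_on_def)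
  let ?l = "length A - 1 - l" and ?h = "\<lambda>x. length A - 1 - h x"
  have nth: "rev A ! (length A - 1 - i) = A ! i" if "i < length A" for i
    using that by (auto simp: rev_nth intro!: arg_cong[of _ _ "(!) A"])
  have n: "rev A ! ?l = A ! l" "rev A ! (?l - 1) = A ! (l + 1)" "rev A ! (?l + 1) = A ! (l - 1)"
  proof -
    have "length A - 1 - (l - 1) = ?l + 1" using l by simp
    then show "rev A ! (?l + 1) = A ! (l - 1)" using nth[of "l - 1"] l by simp
  qed (use nth[of l] nth[of "l + 1"] l in auto)
  have cov: "e = {q, rev A ! (?l - 1)} \<or> e = {p, rev A ! (?l + 1)} \<or> e = {q, p} \<or> (\<exists>x\<in>set (rev M). e = {x, rev A ! ?l}) \<or>
        (\<exists>i. i + 2 < length (rev A) \<and> e = {rev A ! i, rev A ! (i + 2)}) \<or>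
        (\<exists>x\<in>set (rev R) \<union> set (rev L). e = {x, rev A ! ?h x})" if e: "e \<in> B" for e
  proof -
    have "e = {p, A ! (l - 1)} \<or> e = {q, A ! (l + 1)} \<or> e = {p, q} \<or> (\<exists>x\<in>set M. e = {x, A ! l}) \<or>
        (\<exists>i. i + 2 < length A \<and> e = {A ! i, A ! (i + 2)}) \<or> (\<exists>x\<in>set L \<union> set R. e = {x, A ! h x})"
      using assms e unfolding bouquet_on_def by simp
    then consider "e = {p, A ! (l - 1)}" | "e = {q, A ! (l + 1)}" | "e = {p, q}" | x where "x \<in> set M" "e = {x, A ! l}"
      | i where "i + 2 < length A" "e = {A ! i, A ! (i + 2)}"
      | x where "x \<in> set L \<union> set R" "e = {x, A ! h x}"
      by (elim disjE exE bexE conjE)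
    then show ?thesis
    proof cases
      case 5
      then show ?thesis using short_rev[of i A] by (metis length_rev)
    next
      case (6 x)
      then have "h x < length A" using L R l by auto
      then have "e = {x, rev A ! ?h x}" using 6 nth[of "h x"] by simp
      then show ?thesis using 6(1) by auto
    next
      case 3
      then show ?thesis by (simp add: insert_commute)
    qed (use n in auto)
  qed
  have "sorted_wrt (\<lambda>x y. ?h y \<le> ?h x + 1) (rev R)" "sorted_wrt (\<lambda>x y. ?h y \<le> ?h x + 1) (rev L)"
    using s L R l by (intro sorted_wrt_rev_sub; force)+
  moreover have "\<forall>x\<in>set (rev R). ?l \<le> ?h x \<and> ?h x + 1 < length (rev A)"
  proof
    fix x assume "x \<in> set (rev R)"
    then have "1 \<le> h x" "h x \<le> l" using R by auto
    then show "?l \<le> ?h x \<and> ?h x + 1 < length (rev A)" using l by auto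
  qed
  moreover have "\<forall>x\<in>set (rev L). 1 \<le> ?h x \<and> ?h x \<le> ?l"
  proof
    fix x assume "x \<in> set (rev L)"
    then have "l \<le> h x" "h x + 1 < length A" using L by auto
    then show "1 \<le> ?h x \<and> ?h x \<le> ?l" by auto
  qed
  moreover have "rev M \<noteq> []" "0 < ?l" "?l + 1 < length (rev A)" using M l by auto
  ultimately show ?thesis unfolding bouquet_on_def using cov by (intro conjI ballI) simp_all
qed

lemma bouquet_rev:
  assumes "bouquet B xs"
  shows "bouquet B (rev xs)"
proof -
  obtain A L p M q R l h where c: "cyc xs (A @ L @ p # M @ q # R)" and b: "bouquet_on B A L p M q R l h"
    using assms unfolding bouquet_def by blast
  have "cyc (rev xs) (rev A @ rev R @ q # rev M @ p # rev L)"
    using cyc_rev[OF c] cyc_shift[of "rev xs" "rev R @ q # rev M @ p # rev L" "rev A"] by simp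
  then show ?thesis using bouquet_on_rev[OF b] unfolding bouquet_def by blast
qed

section \<open>A vertex of degree two outside the arc\<close>

lemma set_drop_iff: "x \<in> set (drop k xs) \<longleftrightarrow> (\<exists>i. k \<le> i \<and> i < length xs \<and> x = xs ! i)"
proof
  assume "x \<in> set (drop k xs)"
  then obtain i where "i < length xs - k" "x = xs ! (k + i)" by (auto simp: in_set_conv_nth)
  then show "\<exists>i. k \<le> i \<and> i < length xs \<and> x = xs ! i" by (intro exI[of _ "k + i"]) auto
next
  assume "\<exists>i. k \<le> i \<and> i < length xs \<and> x = xs ! i"
  then obtain i where "k \<le> i" "i < length xs" "x = xs ! i" by blast
  then show "x \<in> set (drop k xs)" unfolding in_set_conv_nth by (intro exI[of _ "i - k"]) auto
qed

lemma set_take_iff: "x \<in> set (take k xs) \<longleftrightarrow> (\<exists>i. i < k \<and> i < length xs \<and> x = xs ! i)"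
  by (auto simp: in_set_conv_nth)

lemma sorted_wrt_splitI:
  "(\<And>us x vs y ws. xs = us @ x # vs @ y # ws \<Longrightarrow> P x y) \<Longrightarrow> sorted_wrt P xs"
proof (induction xs)
  case (Cons a xs)
  have "P a y" if y: "y \<in> set xs" for y
  proof -
    obtain vs ws where "xs = vs @ y # ws" using y by (meson split_list)
    then show ?thesis using Cons.prems[of "[]" a vs y ws] by simp
  qed
  moreover have "sorted_wrt P xs"
  proof (rule Cons.IH)
    fix us x vs y ws assume "xs = us @ x # vs @ y # ws"
    then show "P x y" using Cons.prems[of "a # us" x vs y ws] by simp
  qed
  ultimately show ?case by simp
qed simp

text \<open>Blocking enters as \<open>not_tri\<close> and saturation as \<open>sat\<close>;
  \<open>card_B\<close> says that \<open>B\<close> exceeds the minimum for \<open>xs\<close> by one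
  edge. \<open>A\<close>, \<open>D\<close> and \<open>h\<close> describe the rest \<open>ys\<close>,
  and \<open>mx\<close> expresses maximality of the arc by positions.\<close>

locale ear_insertion =
  fixes B :: "'a set set" and xs ys A D :: "'a list" and h :: "'a \<Rightarrow> nat" and u v1 v2 :: 'a
  assumes dist_xs: "distinct xs" and sf: "sidefree B xs" and no_loop: "\<And>x. {x} \<notin> B"
    and edges: "\<And>e. e \<in> B \<Longrightarrow> \<exists>x\<in>set xs. \<exists>y\<in>set xs. e = {x, y}"
    and not_tri: "\<not> tri B xs" and sat: "\<And>e. e \<in> B \<Longrightarrow> etri (B - {e}) xs"
    and card_B: "card B + 1 = length xs"
    and cyc_u: "cyc xs (u # ys)" and ear_u: "{hd ys, last ys} \<notin> B"
    and cyc_AD: "cyc ys (A @ D)" and len_A: "4 \<le> length A"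
    and arc_A: "arc B A"
    and h_bounds: "\<And>x. x \<in> set D \<Longrightarrow> 1 \<le> h x" "\<And>x. x \<in> set D \<Longrightarrow> h x + 1 < length A"
    and h_iff: "\<And>x y. x \<in> set D \<Longrightarrow> y \<in> set A \<union> set D \<Longrightarrow> {x, y} \<in> B \<longleftrightarrow> y = A ! h x"
    and mx: "D \<noteq> [] \<Longrightarrow> h (last D) \<noteq> 1" "D \<noteq> [] \<Longrightarrow> h (hd D) + 2 \<noteq> length A"
    and v_in: "v1 \<in> set ys" "v2 \<in> set ys" and v_ne: "v1 \<noteq> v2"
    and u_iff: "\<And>y. y \<in> set ys \<Longrightarrow> {u, y} \<in> B \<longleftrightarrow> y = v1 \<or> y = v2"
begin

lemma rev_insertion:
  "ear_insertion B (rev xs) (rev ys) (rev A) (rev D) (\<lambda>x. length A - 1 - h x) u v1 v2"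
proof
  show "sidefree B (rev xs)" using sf by (rule sidefree_rev)
  show "\<not> tri B (rev xs)" using not_tri tri_rev[of B "rev xs"] by auto
  show "etri (B - {e}) (rev xs)" if "e \<in> B" for e using sat[OF that] by (rule etri_rev)
  show "cyc (rev xs) (u # rev ys)" using cyc_rev[OF cyc_u] cyc_shift[of "rev xs" "rev ys" "[u]"] by simp
  show "{hd (rev ys), last (rev ys)} \<notin> B" using ear_u by (simp add: hd_rev last_rev insert_commute)
  show "cyc (rev ys) (rev A @ rev D)"
    using cyc_rev[OF cyc_AD] cyc_shift[of "rev ys" "rev D" "rev A"] by simp
  show "arc B (rev A)" using arc_A by (rule arc_rev)
  show "length A - 1 - h x + 1 < length (rev A)" "1 \<le> length A - 1 - h x" if "x \<in> set (rev D)" for x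
    using h_bounds[of x] that by auto
  show "{x, y} \<in> B \<longleftrightarrow> y = rev A ! (length A - 1 - h x)" if "x \<in> set (rev D)" "y \<in> set (rev A) \<union> set (rev D)" for x y
  proof -
    have "rev A ! (length A - 1 - h x) = A ! h x"
      using h_bounds[of x] that by (auto simp: rev_nth intro!: arg_cong[of _ _ "(!) A"])
    then show ?thesis using h_iff[of x y] that by simp
  qed
  show "length A - 1 - h (last (rev D)) \<noteq> 1" if "rev D \<noteq> []"
    using mx(2) that h_bounds(2)[of "hd D"] len_A by (auto simp: last_rev)
  show "length A - 1 - h (hd (rev D)) + 2 \<noteq> length (rev A)" if "rev D \<noteq> []"
    using mx(1) that h_bounds[of "last D"] len_A by (auto simp: hd_rev)
qed (use dist_xs no_loop edges card_B len_A v_in v_ne u_iff in auto)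

lemma swap_insertion: "ear_insertion B xs ys A D h u v2 v1"
  by unfold_locales
    (use dist_xs sf no_loop edges not_tri sat card_B cyc_u ear_u cyc_AD len_A arc_A h_bounds h_iff mx v_in v_ne u_iff in auto)

lemma set_ys: "set ys = set A \<union> set D"
  using cyc_set[OF cyc_AD] by auto

lemma set_xs: "set xs = insert u (set A \<union> set D)"
  using cyc_set[OF cyc_u] set_ys by auto

lemma dist: "distinct A" "distinct D" "set A \<inter> set D = {}" "u \<notin> set A" "u \<notin> set D"
  using dist_xs cyc_distinct[OF cyc_u] cyc_distinct[OF cyc_AD] set_ys by auto

lemma A_in [simp]: "i < length A \<Longrightarrow> A ! i \<in> set A"
  by simp

lemma A_eq: "i < length A \<Longrightarrow> j < length A \<Longrightarrow> A ! i = A ! j \<longleftrightarrow> i = j"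
  using dist(1) by (simp add: nth_eq_iff_index_eq)

lemma A_A: "i < length A \<Longrightarrow> j < length A \<Longrightarrow> {A ! i, A ! j} \<in> B \<longleftrightarrow> j = i + 2 \<or> i = j + 2"
proof -
  assume ij: "i < length A" "j < length A"
  consider "i < j" | "i = j" | "j < i" by linarith
  then show ?thesis
  proof cases
    case 1
    then show ?thesis using arc_A ij unfolding arc_def by auto
  next
    case 2
    then show ?thesis using no_loop by simp
  next
    case 3
    then have "{A ! j, A ! i} \<in> B \<longleftrightarrow> i = j + 2" using arc_A ij unfolding arc_def by auto
    then show ?thesis using 3 by (auto simp: insert_commute)
  qed
qed

lemma D_A: "x \<in> set D \<Longrightarrow> i < length A \<Longrightarrow> {x, A ! i} \<in> B \<longleftrightarrow> i = h x"
    "x \<in> set D \<Longrightarrow> i < length A \<Longrightarrow> {A ! i, x} \<in> B \<longleftrightarrow> i = h x"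
proof -
  have "{x, A ! i} \<in> B \<longleftrightarrow> i = h x" if "x \<in> set D" "i < length A" for x i
    using h_iff[OF that(1), of "A ! i"] that A_eq[of i "h x"] h_bounds(2)[OF that(1)] by simp
  then show "x \<in> set D \<Longrightarrow> i < length A \<Longrightarrow> {x, A ! i} \<in> B \<longleftrightarrow> i = h x"
    "x \<in> set D \<Longrightarrow> i < length A \<Longrightarrow> {A ! i, x} \<in> B \<longleftrightarrow> i = h x"
    by (simp_all add: insert_commute)
qed

lemma D_D: "x \<in> set D \<Longrightarrow> y \<in> set D \<Longrightarrow> {x, y} \<notin> B"
proof -
  assume xy: "x \<in> set D" "y \<in> set D"
  have "A ! h x \<in> set A" using h_bounds(2)[OF xy(1)] by simp
  then have "y \<noteq> A ! h x" using dist(3) xy(2) by blast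
  then show "{x, y} \<notin> B" using h_iff[OF xy(1), of y] xy(2) by simp
qed

lemma u_neighbour: "y \<in> set A \<union> set D \<Longrightarrow> {u, y} \<in> B \<longleftrightarrow> y = v1 \<or> y = v2"
  using u_iff set_ys by simp

text \<open>The inventory of \<open>B\<close> from which the inclusions in
  \<open>bouquet_on\<close>, \<open>sea_on\<close> and \<open>buffer_on\<close> are derived.\<close>

lemma edge_cases:
  assumes "e \<in> B"
  obtains "e = {u, v1}" | "e = {u, v2}" | i where "i + 2 < length A" "e = {A ! i, A ! (i + 2)}"
    | x where "x \<in> set D" "e = {x, A ! h x}"
proof -
  obtain x y where xy: "x \<in> set xs" "y \<in> set xs" "e = {x, y}" using edges[OF assms] by blast
  have ne: "x \<noteq> y" using no_loop[of x] xy assms by auto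
  consider "x = u" | "y = u" | "x \<in> set D" | "y \<in> set D" "y \<noteq> u" "x \<noteq> u" | "x \<in> set A" "y \<in> set A"
    using xy set_xs by auto
  then show thesis
  proof cases
    case 1
    then show thesis using that(1,2) u_neighbour[of y] xy ne assms set_xs by auto
  next
    case 2
    then show thesis using that(1,2) u_neighbour[of x] xy ne assms set_xs by (auto simp: insert_commute)
  next
    case 3
    show thesis
    proof (cases "y = u")
      case True
      then show thesis using that(1,2) u_neighbour[of x] xy ne assms set_xs by (auto simp: insert_commute)
    next
      case False
      then show thesis using 3 that(4)[of x] h_iff[OF 3, of y] xy ne assms set_xs by auto
    qed
  next
    case 4
    then show thesis using that(4)[of y] h_iff[OF 4(1), of x] xy ne assms set_xs
      by (auto simp: insert_commute)
  next
    case 5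
    then obtain i j where ij: "i < length A" "x = A ! i" "j < length A" "y = A ! j"
      by (metis in_set_conv_nth)
    then have "j = i + 2 \<or> i = j + 2" using A_A[of i j] assms xy by auto
    then show thesis using that(3)[of i] that(3)[of j] ij xy by (auto simp: insert_commute)
  qed
qed

lemma not_tri_ys: "\<not> tri B ys"
  using not_tri_ear[OF not_tri cyc_u ear_u] .

text \<open>If \<open>p\<close> precedes \<open>q\<close> in \<open>D\<close> and \<open>h q\<close>
  exceeds \<open>h p\<close> by at least two, position \<open>z\<close> lies strictly between them.
  The triangle \<open>A ! z\<close>, \<open>p\<close>, \<open>q\<close> with a fan at
  \<open>p\<close> over the larger positions and a fan at \<open>q\<close> over the smaller ones
  avoids \<open>B\<close>, so \<open>ys\<close> would not be blocked.\<close>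

lemma h_almost_decreasing: "sorted_wrt (\<lambda>x y. h y \<le> h x + 1) D"
proof (rule sorted_wrt_splitI, rule ccontr)
  fix D1 p D2 q D3 assume D: "D = D1 @ p # D2 @ q # D3" and "\<not> h q \<le> h p + 1"
  define z where "z = h p + 1"
  have z: "h p < z" "z < h q" "z < length A" "h p < length A"
    using \<open>\<not> h q \<le> h p + 1\<close> h_bounds[of q] h_bounds[of p] D unfolding z_def by auto
  have pq: "p \<in> set D" "q \<in> set D" using D by auto
  have "tri B (A ! z # (drop (z + 1) A @ D1) @ p # D2 @ q # (D3 @ take z A))"
  proof (rule tri_zigzag)
    show "\<forall>x\<in>set (A ! z # (drop (z + 1) A @ D1) @ D2 @ [q]). {p, x} \<notin> B"
      using z D_A(1)[OF pq(1)] D_D[OF pq(1)] D by (auto simp: set_drop_iff)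
    show "\<forall>x\<in>set ((D3 @ take z A) @ [A ! z]). {q, x} \<notin> B"
      using z D_A(1)[OF pq(2)] D_D[OF pq(2)] D by (auto simp: set_take_iff)
  qed
  moreover have A_split: "take z A @ A ! z # drop (z + 1) A @ D = A @ D"
    using id_take_nth_drop[OF z(3)] by (metis Suc_eq_plus1 append_Cons append_assoc)
  have "cyc ((A ! z # drop (z + 1) A @ D) @ take z A) (A @ D)"
    using cyc_append[of "A ! z # drop (z + 1) A @ D" "take z A"] unfolding A_split .
  then have "cyc (A ! z # (drop (z + 1) A @ D1) @ p # D2 @ q # (D3 @ take z A)) (A @ D)"
    by (simp add: D)
  ultimately show False using tri_cyc cyc_sym[OF cyc_AD] not_tri_ys by blast
qed

text \<open>Every appeal to saturation goes through this: without one edge at \<open>u\<close> the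
  blocking shape must be lost, since \<open>sat\<close> supplies a triangulation.\<close>

lemma sat_fan:
  assumes "cyc xs (A' @ D')" "fan_block (B - {{u, v}}) A' D' h'" "v = v1 \<or> v = v2"
  shows False
proof -
  have "{u, v} \<in> B" using assms(3) u_iff v_in by auto
  then show False using fan_block_not_etri[OF sat dist_xs assms(1)] assms(2) by blast
qed

lemma other_neighbour:
  assumes "{u, y} \<in> B" "y \<in> set A \<union> set D"
  obtains v where "v = v1 \<or> v = v2" "v \<noteq> y"
  using that v_ne by metis

lemma arc_short: "i + 2 < length A \<Longrightarrow> {A ! i, A ! (i + 2)} \<in> B"
  using A_A[of i "i + 2"] by simp

lemma D_edge: "x \<in> set D \<Longrightarrow> {x, A ! h x} \<in> B"
  using D_A(1)[of x "h x"] h_bounds(2)[of x] by simp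

lemma not_u: "x \<in> set A \<union> set D \<Longrightarrow> x \<noteq> u"
  using dist by auto

text \<open>Otherwise the other edge at u would be superfluous, contradicting saturation.\<close>

lemma fan_position_not_neighbour:
  assumes D: "D = D1 @ D2" and c: "cyc xs (A @ D1 @ u # D2)"
    and j: "1 \<le> j" "j + 1 < length A" "\<And>x. x \<in> set D1 \<Longrightarrow> j \<le> h x + 1" "\<And>y. y \<in> set D2 \<Longrightarrow> h y \<le> j + 1"
  shows "{u, A ! j} \<notin> B"
proof
  assume uj: "{u, A ! j} \<in> B"
  obtain v where v: "v = v1 \<or> v = v2" "v \<noteq> A ! j" using other_neighbour[OF uj] j(2) by auto
  have uD: "u \<notin> set D" using dist by simp
  have "fan_block (B - {{u, v}}) A (D1 @ u # D2) (h(u := j))"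
    unfolding fan_block_def
  proof (intro conjI allI impI ballI)
    fix i assume i: "i + 2 < length A"
    then have "u \<noteq> A ! i" "u \<noteq> A ! (i + 2)" using not_u A_in by (metis UnI1 add_lessD1)+
    then show "{A ! i, A ! (i + 2)} \<in> B - {{u, v}}" using arc_short[OF i] by (auto simp: doubleton_eq_iff)
  next
    fix x assume x: "x \<in> set (D1 @ u # D2)"
    show "1 \<le> (h(u := j)) x" "(h(u := j)) x + 1 < length A" "{x, A ! (h(u := j)) x} \<in> B - {{u, v}}"
    proof -
      have "1 \<le> (h(u := j)) x \<and> (h(u := j)) x + 1 < length A \<and> {x, A ! (h(u := j)) x} \<in> B - {{u, v}}"
      proof (cases "x = u")
        case True
        then show ?thesis using j uj v by (auto simp: doubleton_eq_iff)
      next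
        case False
        then have xD: "x \<in> set D" using x D by auto
        then have "A ! h x \<noteq> u" using h_bounds(2) not_u A_in by (metis UnI1 add_lessD1)
        then show ?thesis using False xD h_bounds D_edge by (auto simp: doubleton_eq_iff)
      qed
      then show "1 \<le> (h(u := j)) x" "(h(u := j)) x + 1 < length A" "{x, A ! (h(u := j)) x} \<in> B - {{u, v}}"
        by auto
    qed
  next
    have "sorted_wrt (\<lambda>x y. h y \<le> h x + 1) (D1 @ D2)" using h_almost_decreasing D by simp
    then have "sorted_wrt (\<lambda>x y. (h(u := j)) y \<le> (h(u := j)) x + 1) (D1 @ D2)"
      by (rule sorted_wrt_mono_rel[rotated]) (use uD D in auto)
    then show "sorted_wrt (\<lambda>x y. (h(u := j)) y \<le> (h(u := j)) x + 1) (D1 @ u # D2)"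
      using j(3,4) uD D by (auto simp: sorted_wrt_append)
  qed (use len_A in auto)
  then show False using sat_fan[of A "D1 @ u # D2"] c v by simp
qed

lemma adjacent_not_neighbour:
  "cyc xs (us @ u # b # vs) \<Longrightarrow> {u, b} \<notin> B" "cyc xs (us @ a # u # vs) \<Longrightarrow> {u, a} \<notin> B"
  using sidefree_adjacent[OF sf, of us u b vs] sidefree_adjacent[OF sf, of us a u vs]
  by (auto simp: insert_commute)

text \<open>One side of the splitting in \<open>bouquet_in_fan\<close>. If \<open>u\<close> has no
  neighbour here, a fan at \<open>u\<close> does it. A neighbour in \<open>D1\<close> or at the end
  of the arc is first cut off as an ear. For another neighbour \<open>A ! k\<close>, the chord from
  \<open>u\<close> to \<open>A ! (k - 1)\<close> separates a fan at \<open>u\<close> from a fan at a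
  vertex of \<open>D1\<close> with position \<open>a\<close>, whose edge ends before
  \<open>A ! (k - 1)\<close>.\<close>

lemma left_part_tri:
  assumes D: "D = D1 @ D2" and c: "cyc xs (A @ D1 @ u # D2)"
    and a: "(\<exists>p\<in>set D1. h p = a) \<or> a + 3 = length A" "a + 3 \<le> length A"
    and j: "j \<le> a + 1" and free: "\<And>i. j \<le> i \<Longrightarrow> i \<le> a + 1 \<Longrightarrow> {u, A ! i} \<notin> B"
    and uniq: "\<And>y y'. y \<in> set (drop (a + 2) A @ D1) \<Longrightarrow> y' \<in> set (drop (a + 2) A @ D1) \<Longrightarrow>
       {u, y} \<in> B \<Longrightarrow> {u, y'} \<in> B \<Longrightarrow> y = y'"
  shows "tri B (drop j A @ D1 @ [u])"
proof -
  have isolated: "tri B (us @ u # vs)" if "\<forall>y\<in>set us \<union> set vs. {u, y} \<notin> B" for us vs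
    using tri_isolated_cyc[of "us @ u # vs" u "vs @ us" B] that cyc_append[of us "u # vs"] by auto
  have in_list: "y \<in> set (drop (a + 2) A @ D1)" if "y \<in> set (drop j A @ D1)" "{u, y} \<in> B" for y
  proof (cases "y \<in> set D1")
    case False
    then obtain i where "j \<le> i" "i < length A" "y = A ! i" using \<open>y \<in> set (drop j A @ D1)\<close> by (auto simp: set_drop_iff)
    then have "a + 2 \<le> i" using free[of i] \<open>{u, y} \<in> B\<close> by (cases "i \<le> a + 1") auto
    then show ?thesis using \<open>i < length A\<close> \<open>y = A ! i\<close> by (auto simp: set_drop_iff)
  qed simp
  show ?thesis
  proof (cases "\<exists>y\<in>set (drop j A @ D1). {u, y} \<in> B")
    case False
    then show ?thesis using isolated[of "drop j A @ D1" "[]"] by auto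
  next
    case True
    then obtain v where v: "v \<in> set (drop j A @ D1)" "{u, v} \<in> B" by blast
    have only: "{u, y} \<notin> B" if "y \<in> set (drop j A @ D1)" "y \<noteq> v" for y
      using uniq[of y v] in_list[of y] in_list[of v] v that by blast
    have "A \<noteq> []" using len_A by auto
    then have lastA: "last A = A ! (length A - 1)" "A \<noteq> []" by (auto simp: last_conv_nth)
    have lastj: "last (drop j A) = A ! (length A - 1)" "drop j A \<noteq> []" using a j len_A lastA by auto
    show ?thesis
    proof (cases "v \<in> set D1")
      case True
      then obtain E1 E2 where E: "D1 = E1 @ v # E2" by (meson split_list)
      have "E2 \<noteq> []" using adjacent_not_neighbour(2)[of "A @ E1" v D2] c E v by auto
      have hE2: "hd E2 \<in> set D" using \<open>E2 \<noteq> []\<close> D E by simp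
      have dj: "distinct (drop j A @ D1)" using dist D by (auto dest: in_set_dropD)
      have "{hd (E2 @ u # drop j A @ E1), last (E2 @ u # drop j A @ E1)} \<notin> B"
      proof (cases "E1 = []")
        case True
        then show ?thesis using lastj \<open>E2 \<noteq> []\<close> D_A(1)[OF hE2, of "length A - 1"] h_bounds(2)[OF hE2] lastA by auto
      next
        case False
        then have "last E1 \<in> set D" using D E by simp
        then show ?thesis using False \<open>E2 \<noteq> []\<close> D_D[OF hE2] by auto
      qed
      moreover have "tri B (E2 @ u # drop j A @ E1)"
        by (rule isolated) (use only dj E in auto)
      ultimately have "tri B (v # E2 @ u # drop j A @ E1)" by (rule tri_ear[rotated])
      then show ?thesis using tri_rot[of B "v # E2 @ [u]" "drop j A @ E1"] E by simp
    next
      case False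
      then have "v \<in> set (drop (a + 2) A)" using in_list v by auto
      then obtain k where k: "a + 2 \<le> k" "k < length A" "v = A ! k" by (auto simp: set_drop_iff)
      have split_k: "drop j A = take (k - j) (drop j A) @ A ! k # drop (k + 1) A"
        using k j id_take_nth_drop[of "k - j" "drop j A"] by simp
      show ?thesis
      proof (cases "k + 1 = length A")
        case True
        have sp: "drop j A = take (k - j) (drop j A) @ [v]" using split_k True k by simp
        have "v = last A" using lastA k True by (metis add_diff_cancel_right')
        then have A_v: "A = butlast A @ [v]" using lastA(2) by simp
        have D1: "D1 \<noteq> []"
        proof
          assume "D1 = []"
          then have "cyc xs (butlast A @ v # u # D2)"
            using c A_v by (metis append_Cons append_Nil append_assoc)
          then show False using adjacent_not_neighbour(2) v(2) by blast
        qed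
        let ?X = "take (k - j) (drop j A)"
        have X: "?X \<noteq> []" "last ?X = A ! (length A - 2)"
        proof -
          show "?X \<noteq> []" using k j by simp
          then show "last ?X = A ! (length A - 2)" using k j True
            by (auto simp: last_conv_nth intro!: arg_cong[of _ _ "(!) A"])
        qed
        have hD: "hd D1 = hd D" "hd D1 \<in> set D" "D \<noteq> []" using D1 D by auto
        \<comment> \<open>By maximality the first vertex of \<open>D\<close> is not joined to the
          last interior vertex of the arc, so \<open>v\<close> can be cut off.\<close>
        have "h (hd D) \<noteq> length A - 2" using mx(2)[OF hD(3)] len_A by linarith
        then have "{hd (D1 @ u # ?X), last (D1 @ u # ?X)} \<notin> B"
          using X D1 D_A(1)[OF hD(2), of "length A - 2"] hD(1) len_A by simp
        moreover have "distinct (drop j A)" using dist by simp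
        then have "v \<notin> set ?X" using sp by (metis distinct_append disjoint_iff list.set_intros(1))
        then have "tri B (D1 @ u # ?X)"
          by (intro isolated) (use only False sp in \<open>auto dest: in_set_takeD\<close>)
        ultimately have "tri B (v # D1 @ u # ?X)" by (rule tri_ear[rotated])
        then have "tri B (?X @ v # D1 @ [u])" using tri_rot[of B "v # D1 @ [u]" ?X] by simp
        then show ?thesis using sp by (metis append_Cons append_Nil append_assoc)
      next
        case klast: False
        let ?X = "take (k - 1 - j) (drop j A)"
        have sp: "drop j A = ?X @ A ! (k - 1) # drop k A"
          using k j id_take_nth_drop[of "k - 1 - j" "drop j A"] by simp
        have Xset: "y \<in> set ?X \<Longrightarrow> y \<in> set (drop j A) \<and> y \<noteq> v" for y
        proof -
          assume y: "y \<in> set ?X"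
          then obtain i where i: "i < k - 1 - j" "i < length A - j" "y = A ! (j + i)"
            by (auto simp: set_take_iff)
          then have "y \<noteq> v" using k A_eq[of "j + i" k] by auto
          then show ?thesis using in_set_takeD[OF y] by simp
        qed
        have k1: "{u, A ! (k - 1)} \<notin> B"
        proof -
          have "A ! (k - 1) \<in> set (drop j A @ D1)" using k j by (auto simp: set_drop_iff intro!: exI[of _ "k - 1"])
          then show ?thesis using only[of "A ! (k - 1)"] k A_eq[of "k - 1" k] by auto
        qed
        have 1: "tri B (u # ?X @ [A ! (k - 1)])"
          by (rule isolated[of "[]", simplified]) (use only Xset k1 in auto)
        have "\<exists>p\<in>set (drop k A @ D1). \<forall>y\<in>set (A ! (k - 1) # drop k A @ D1 @ [u]). {p, y} \<notin> B"
          using a(1)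
        proof
          assume "\<exists>p\<in>set D1. h p = a"
          then obtain p where p: "p \<in> set D1" "h p = a" by blast
          then have pD: "p \<in> set D" using D by simp
          have "p \<noteq> v" using p False by auto
          then have "{p, u} \<notin> B" using only[of p] p by (simp add: insert_commute)
          then show ?thesis using p k D_A(1)[OF pD] D_D[OF pD] D
            by (intro bexI[of _ p]) (auto simp: set_drop_iff)
        next
          \<comment> \<open>For the default value of \<open>a\<close>, only the end of the arc lies
            beyond \<open>a + 1\<close>, and that case has been treated.\<close>
          assume a3: "a + 3 = length A"
          then have "k + 1 = length A" using k klast by simp
          then show ?thesis using klast by simp
        qed
        then obtain p where p: "p \<in> set (drop k A @ D1)"
          "\<forall>y\<in>set (A ! (k - 1) # drop k A @ D1 @ [u]). {p, y} \<notin> B" by blast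
        obtain Y1 Y2 where Y: "drop k A @ D1 = Y1 @ p # Y2" using p(1) by (meson split_list)
        then have Y': "A ! (k - 1) # (drop k A @ D1) @ [u] = (A ! (k - 1) # Y1) @ p # Y2 @ [u]" by simp
        have "cyc (A ! (k - 1) # (drop k A @ D1) @ [u]) (p # (Y2 @ [u]) @ A ! (k - 1) # Y1)"
          unfolding Y' using cyc_append[of "A ! (k - 1) # Y1" "p # Y2 @ [u]"] by simp
        moreover have "set ((Y2 @ [u]) @ A ! (k - 1) # Y1) \<subseteq> set (A ! (k - 1) # drop k A @ D1 @ [u])"
          using arg_cong[OF Y, of set] by auto
        ultimately have 2: "tri B (A ! (k - 1) # (drop k A @ D1) @ [u])"
          using tri_isolated_cyc[of _ p _ B] p(2) by blast
        have "tri B (u # ?X @ A ! (k - 1) # drop k A @ D1)"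
          using tri_split[OF 1 2 k1] by simp
        then have "tri B (?X @ A ! (k - 1) # drop k A @ D1 @ [u])"
          using tri_rot[of B "[u]" "?X @ A ! (k - 1) # drop k A @ D1"] by simp
        then show ?thesis using sp by (metis append_Cons append_assoc)
      qed
    qed
  qed
qed

lemma A_split: "i < length A \<Longrightarrow> A = take i A @ A ! i # drop (i + 1) A"
  by (simp add: id_take_nth_drop)

text \<open>The triangle \<open>A ! j\<close>, \<open>p\<close>, \<open>u\<close>: the edge of
  \<open>p\<close> ends before \<open>A ! j\<close>, so \<open>p\<close> can fan over the later
  positions, while \<open>u\<close> fans over the earlier ones and \<open>D2\<close>.\<close>

lemma zigzag_fan:
  assumes D: "D = D1 @ D2" and c: "cyc xs (A @ D1 @ u # D2)"
    and p: "p \<in> set D1" "{u, p} \<notin> B" "h p < j" and j: "j < length A"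
    and free: "\<And>i. i \<le> j \<Longrightarrow> {u, A ! i} \<notin> B" "\<And>y. y \<in> set D2 \<Longrightarrow> {u, y} \<notin> B"
  shows False
proof -
  obtain E1 E2 where E: "D1 = E1 @ p # E2" using p(1) by (meson split_list)
  have pD: "p \<in> set D" using p D by simp
  have "tri B (A ! j # (drop (j + 1) A @ E1) @ p # E2 @ u # (D2 @ take j A))"
  proof (rule tri_zigzag)
    show "\<forall>x\<in>set (A ! j # (drop (j + 1) A @ E1) @ E2 @ [u]). {p, x} \<notin> B"
      using p j D_A(1)[OF pD] D_D[OF pD] D E by (auto simp: set_drop_iff insert_commute)
    show "\<forall>x\<in>set ((D2 @ take j A) @ [A ! j]). {u, x} \<notin> B"
      using free j by (auto simp: set_take_iff)
  qed
  moreover have "cyc ((A ! j # drop (j + 1) A @ D1 @ u # D2) @ take j A) (take j A @ A ! j # drop (j + 1) A @ D1 @ u # D2)"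
    by (rule cyc_append)
  then have "cyc ((A ! j # drop (j + 1) A @ D1 @ u # D2) @ take j A) (A @ D1 @ u # D2)"
    using A_split[OF j] by (metis append_Cons append_assoc)
  then have "cyc (A ! j # (drop (j + 1) A @ E1) @ p # E2 @ u # (D2 @ take j A)) xs"
    using cyc_trans[OF _ cyc_sym[OF c]] E by simp
  ultimately show False using tri_cyc not_tri by blast
qed

text \<open>With all neighbours of \<open>u\<close> in \<open>D1\<close>, the last vertex of the arc
  takes the fan over \<open>D1\<close>, where it has no edges, and \<open>u\<close> fans over the
  remaining vertices.\<close>

lemma zigzag_end:
  assumes c: "cyc xs (A @ D1 @ u # D2)" and D: "D = D1 @ D2"
    and free: "\<And>i. i < length A \<Longrightarrow> {u, A ! i} \<notin> B" "\<And>y. y \<in> set D2 \<Longrightarrow> {u, y} \<notin> B"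
  shows False
proof -
  define n where "n = length A - 2"
  have n: "length A = n + 2" using len_A unfolding n_def by simp
  have A: "A = take n A @ [A ! n, A ! (n + 1)]"
    using A_split[of "n + 1"] take_Suc_conv_app_nth[of n A] n by simp
  have "tri B (A ! n # [] @ A ! (n + 1) # D1 @ u # (D2 @ take n A))"
  proof (rule tri_zigzag)
    show "\<forall>x\<in>set (A ! n # [] @ D1 @ [u]). {A ! (n + 1), x} \<notin> B"
      using A_A[of "n + 1" n] n free(1)[of "n + 1"] D_A(2)[of _ "n + 1"] h_bounds(2) D
      by (fastforce simp: insert_commute)
    show "\<forall>x\<in>set ((D2 @ take n A) @ [A ! n]). {u, x} \<notin> B"
      using free n by (auto simp: set_take_iff)
  qed
  moreover have "cyc xs (take n A @ [A ! n, A ! (n + 1)] @ D1 @ u # D2)"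
    using c A by (metis append_assoc)
  then have "cyc (A ! n # [] @ A ! (n + 1) # D1 @ u # (D2 @ take n A)) xs"
    using cyc_shift[of xs "take n A"] cyc_sym by fastforce
  ultimately show False using tri_cyc not_tri by blast
qed

text \<open>The bouquet has \<open>p = v2\<close>, \<open>q = u\<close> and centre
  \<open>A ! (k - 1)\<close>. By \<open>zigzag_fan\<close> every other vertex of \<open>D1\<close>
  has position at least \<open>k - 1\<close>; with the bounded increase of \<open>h\<close> this
  pins \<open>v2\<close> to \<open>k - 2\<close> and everything between \<open>v2\<close> and
  \<open>u\<close> to \<open>k - 1\<close>.\<close>

lemma bouquet_in_fan_ordered:
  assumes D: "D = D1 @ D2" and c: "cyc xs (A @ D1 @ u # D2)"
    and a: "(\<exists>p\<in>set D1. h p = a) \<or> a + 3 = length A" "a + 3 \<le> length A" "\<And>x. x \<in> set D1 \<Longrightarrow> a \<le> h x"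
      "1 \<le> a"
    and k: "v1 = A ! k" "a + 2 \<le> k" "k < length A" and v2: "v2 \<in> set D1"
  shows "bouquet B xs"
proof -
  obtain E1 E2 where E: "D1 = E1 @ v2 # E2" using v2 by (meson split_list)
  have uv: "{u, A ! k} \<in> B" "{u, v2} \<in> B" using k v2 D u_neighbour by auto
  have "E2 \<noteq> []" using adjacent_not_neighbour(2)[of "A @ E1" v2 D2] c E uv by auto
  have h_dec: "sorted_wrt (\<lambda>x y. h y \<le> h x + 1) (E1 @ v2 # E2 @ D2)"
    using h_almost_decreasing D E by simp
  have uA: "{u, A ! i} \<notin> B" if "i < k" for i
  proof -
    have i: "i < length A" using that k by simp
    then have "A ! i \<notin> set D1" using A_in[OF i] D dist(3) by (metis Un_iff disjoint_iff set_append)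
    then show ?thesis using u_neighbour[of "A ! i"] that i k A_eq[of i k] v2 by auto
  qed
  have uD: "{u, y} \<notin> B" if "y \<in> set D" "y \<noteq> v2" for y
  proof -
    have "y \<noteq> A ! k" using A_in[OF k(3)] dist(3) that(1) by blast
    then show ?thesis using u_neighbour[of y] that k(1) by simp
  qed
  have big: "k \<le> h p + 1" if "p \<in> set D1" "p \<noteq> v2" for p
  proof (rule ccontr)
    assume "\<not> k \<le> h p + 1"
    then show False using zigzag_fan[OF D c that(1) uD, of "h p + 1"] that D k uA uD v2 dist(2)
      by auto
  qed
  have hv2: "h v2 + 2 = k"
  proof -
    have x: "hd E2 \<in> set E2" using \<open>E2 \<noteq> []\<close> by simp
    then have "hd E2 \<noteq> v2" using dist(2) D E by auto
    then have "k \<le> h (hd E2) + 1" using big x E by auto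
    moreover have "h (hd E2) \<le> h v2 + 1" using h_dec x by (auto simp: sorted_wrt_append)
    \<comment> \<open>A vertex with position \<open>a\<close> violates the bound \<open>big\<close>,
      so it is \<open>v2\<close> itself. For the default \<open>a\<close>, \<open>k\<close> is the
      end of the arc and \<open>v2\<close> must be the first vertex of \<open>D\<close>, where
      maximality applies.\<close>
    moreover have "h v2 + 2 \<le> k"
      using a(1)
    proof
      assume "\<exists>p\<in>set D1. h p = a"
      then obtain p where "p \<in> set D1" "h p = a" by blast
      then show ?thesis using big[of p] k by (cases "p = v2") auto
    next
      assume a3: "a + 3 = length A"
      then have kn: "k + 1 = length A" using k by simp
      have "E1 = []"
      proof (rule ccontr)
        assume "E1 \<noteq> []"
        then have "hd E1 = hd D" "hd E1 \<in> set D1" "D \<noteq> []" "hd E1 \<in> set D" "hd E1 \<noteq> v2"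
          using D E dist(2) by (cases E1; auto)+
        then show False using big[of "hd E1"] mx(2) h_bounds(2)[of "hd E1"] kn by auto
      qed
      then have "hd D = v2" using D E by simp
      then show ?thesis using mx(2) D E h_bounds(2)[of v2] kn by auto
    qed
    ultimately show ?thesis by simp
  qed
  have hE2: "h x = k - 1" if "x \<in> set E2" for x
  proof -
    have "x \<noteq> v2" using that dist(2) D E by auto
    then have "k \<le> h x + 1" using big that E by auto
    moreover have "h x \<le> h v2 + 1" using h_dec that by (auto simp: sorted_wrt_append)
    ultimately show ?thesis using hv2 by simp
  qed
  have hE1: "k - 1 \<le> h x" if "x \<in> set E1" for x
  proof -
    have "x \<noteq> v2" using that dist(2) D E by auto
    then show ?thesis using big[of x] that E by auto
  qed
  have hD2: "h x \<le> k - 1" if "x \<in> set D2" for x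
    using h_dec hv2 that by (auto simp: sorted_wrt_append)
  have "bouquet_on B A E1 v2 E2 u D2 (k - 1) h"
    unfolding bouquet_on_def
  proof (intro conjI ballI)
    fix e assume "e \<in> B"
    then show "e = {v2, A ! (k - 1 - 1)} \<or> e = {u, A ! (k - 1 + 1)} \<or> e = {v2, u} \<or> (\<exists>x\<in>set E2. e = {x, A ! (k - 1)}) \<or>
        (\<exists>i. i + 2 < length A \<and> e = {A ! i, A ! (i + 2)}) \<or> (\<exists>x\<in>set E1 \<union> set D2. e = {x, A ! h x})"
    proof (cases rule: edge_cases)
      case 1
      then show ?thesis using k by auto
    next
      case 2
      then show ?thesis by (auto simp: insert_commute)
    next
      case (3 i)
      then show ?thesis by blast
    next
      case (4 x)
      then consider "x = v2" | "x \<in> set E2" | "x \<in> set E1 \<union> set D2" using D E by auto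
      then show ?thesis
      proof cases
        case 1
        have "k - 1 - 1 = h v2" using hv2 by simp
        then show ?thesis using 4 1 by simp
      next
        case 2
        then show ?thesis using 4 hE2 by auto
      next
        case 3
        then show ?thesis using 4 by blast
      qed
    qed
  next
    show "sorted_wrt (\<lambda>x y. h y \<le> h x + 1) E1" "sorted_wrt (\<lambda>x y. h y \<le> h x + 1) D2"
      using h_dec by (auto simp: sorted_wrt_append)
  qed (use \<open>E2 \<noteq> []\<close> k a(4) hE1 hD2 h_bounds D E in auto)
  moreover have "cyc xs (A @ E1 @ v2 # E2 @ u # D2)" using c E by simp
  ultimately show ?thesis unfolding bouquet_def by blast
qed

text \<open>Two neighbours in \<open>D1\<close> are refuted by \<open>zigzag_end\<close>, two in the
  arc by \<open>zigzag_fan\<close> with a vertex of position \<open>a\<close>; one of each kind is a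
  bouquet.\<close>

lemma bouquet_in_fan_left:
  assumes D: "D = D1 @ D2" and c: "cyc xs (A @ D1 @ u # D2)"
    and a: "(\<exists>p\<in>set D1. h p = a) \<or> a + 3 = length A" "a + 3 \<le> length A" "\<And>x. x \<in> set D1 \<Longrightarrow> a \<le> h x"
      "1 \<le> a"
    and v: "v1 \<in> set (drop (a + 2) A @ D1)" "v2 \<in> set (drop (a + 2) A @ D1)"
  shows "bouquet B xs"
proof -
  have dr: "\<exists>k. y = A ! k \<and> a + 2 \<le> k \<and> k < length A" if "y \<in> set (drop (a + 2) A)" for y
    using that by (auto simp: set_drop_iff)
  have D1D: "set D1 \<subseteq> set D" "set D2 \<inter> set D1 = {}" using D dist(2) by auto
  have uA: "{u, A ! i} \<notin> B" if "i < a + 2" "i < length A" for i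
  proof -
    have "A ! i \<notin> set (drop (a + 2) A)" using A_eq that by (auto simp: set_drop_iff)
    moreover have "A ! i \<notin> set D1" using dist(3) D1D A_in[OF that(2)] by blast
    ultimately show ?thesis using u_neighbour[of "A ! i"] that v by auto
  qed
  have uD2: "{u, y} \<notin> B" if "y \<in> set D2" for y
  proof -
    have "y \<notin> set (drop (a + 2) A)" using dist(3) D that by (auto dest: in_set_dropD)
    then show ?thesis using u_neighbour[of y] that v D1D D by auto
  qed
  consider "v1 \<in> set D1" "v2 \<in> set D1" | "v1 \<in> set (drop (a + 2) A)" "v2 \<in> set (drop (a + 2) A)"
    | "v1 \<in> set (drop (a + 2) A)" "v2 \<in> set D1" | "v2 \<in> set (drop (a + 2) A)" "v1 \<in> set D1"
    using v by auto
  then show ?thesis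
  proof cases
    case 1
    have "{u, A ! i} \<notin> B" if "i < length A" for i
    proof -
      have "A ! i \<notin> set D1" using dist(3) D1D A_in[OF that] by blast
      then show ?thesis using u_neighbour[of "A ! i"] that 1 by auto
    qed
    then show ?thesis using zigzag_end[OF c D _ uD2] by blast
  next
    case 2
    then obtain k k' where k: "v1 = A ! k" "a + 2 \<le> k" "k < length A" "v2 = A ! k'" "a + 2 \<le> k'" "k' < length A"
      using dr by blast
    have "a + 3 \<noteq> length A"
    proof
      assume "a + 3 = length A"
      then have "k = k'" using k by linarith
      then show False using k v_ne by simp
    qed
    then obtain p where p: "p \<in> set D1" "h p = a" using a(1) by auto
    have "{u, p} \<notin> B"
    proof -
      have "p \<notin> set (drop (a + 2) A)" using dist(3) D1D p(1) by (auto dest: in_set_dropD)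
      then show ?thesis using u_neighbour[of p] p 2 D1D by auto
    qed
    then show ?thesis using zigzag_fan[OF D c p(1), of "a + 1"] p(2) uA uD2 a(2) by auto
  next
    case 3
    then show ?thesis using bouquet_in_fan_ordered[OF D c a] dr by blast
  next
    case 4
    interpret s: ear_insertion B xs ys A D h u v2 v1 by (rule swap_insertion)
    show ?thesis using s.bouquet_in_fan_ordered[OF D c a] dr 4 by blast
  qed
qed

text \<open>The neighbours of u lie either to the left of A ! (a + 1) or to the right of A ! (b - 1). If
  there is at most one on each side, the chords from u to these two vertices split the polygon
  into three parts that can be triangulated.\<close>

lemma bouquet_in_fan:
  assumes D: "D = D1 @ D2" and c: "cyc xs (A @ D1 @ u # D2)"
  shows "bouquet B xs"
proof -
  \<comment> \<open>The defaults keep \<open>a + 1\<close> and \<open>b - 1\<close> interior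
    positions of the arc where \<open>D1\<close> or \<open>D2\<close> imposes no
    restriction.\<close>
  define a where "a = Min (insert (length A - 3) (h ` set D1))"
  define b where "b = Max (insert 2 (h ` set D2))"
  have a_in: "a \<in> insert (length A - 3) (h ` set D1)" unfolding a_def by (rule Min_in) auto
  have b_in: "b \<in> insert 2 (h ` set D2)" unfolding b_def by (rule Max_in) auto
  have a_le: "a \<le> length A - 3" "\<And>x. x \<in> set D1 \<Longrightarrow> a \<le> h x" unfolding a_def by auto
  have b_ge: "2 \<le> b" "\<And>x. x \<in> set D2 \<Longrightarrow> h x \<le> b" unfolding b_def by auto
  have hD: "1 \<le> h x" "h x + 2 \<le> length A" if "x \<in> set D" for x using h_bounds[OF that] by auto
  have a1: "1 \<le> a" using a_in hD D len_A by auto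
  have b1: "b + 2 \<le> length A" using b_in hD D len_A by auto
  have nc: "h y \<le> h x + 1" if "x \<in> set D1" "y \<in> set D2" for x y
    using h_almost_decreasing D that by (auto simp: sorted_wrt_append)
  \<comment> \<open>The bounded increase of \<open>h\<close> across \<open>u\<close> makes the range
    from \<open>b - 1\<close> to \<open>a + 1\<close> nonempty.\<close>
  have ba: "b \<le> a + 1"
  proof -
    have "2 \<le> h x + 1" if "x \<in> set D1" for x using hD(1)[of x] that D by simp
    moreover have "h y + 2 \<le> length A" if "y \<in> set D2" for y using hD(2)[of y] that D by simp
    ultimately show ?thesis using a_in b_in nc len_A by fastforce
  qed
  have allowed: "{u, A ! j} \<notin> B" if "b \<le> j + 1" "j \<le> a + 1" for j
  proof (rule fan_position_not_neighbour[OF D c])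
    show "1 \<le> j" using that b_ge by simp
    show "j + 1 < length A" using that a_le len_A by simp
    show "j \<le> h x + 1" if "x \<in> set D1" for x using a_le(2)[OF that] \<open>j \<le> a + 1\<close> by simp
    show "h y \<le> j + 1" if "y \<in> set D2" for y using b_ge(2)[OF that] \<open>b \<le> j + 1\<close> by simp
  qed
  have a': "(\<exists>p\<in>set D1. h p = a) \<or> a + 3 = length A" "a + 3 \<le> length A"
    using a_in a_le len_A by auto
  interpret r: ear_insertion B "rev xs" "rev ys" "rev A" "rev D" "\<lambda>x. length A - 1 - h x" u v1 v2
    by (rule rev_insertion)
  have rD: "rev D = rev D2 @ rev D1" using D by simp
  have rc: "cyc (rev xs) (rev A @ rev D2 @ u # rev D1)"
    using cyc_rev[OF c] cyc_shift[of "rev xs" "rev D2 @ u # rev D1" "rev A"] by simp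
  \<comment> \<open>The mirror image of position \<open>b\<close>, which turns the right side into
    the left side of the reversed polygon.\<close>
  define b' where "b' = length A - 1 - b"
  have b': "(\<exists>p\<in>set (rev D2). length A - 1 - h p = b') \<or> b' + 3 = length (rev A)" "b' + 3 \<le> length (rev A)"
    "1 \<le> b'" "b' + b + 1 = length A"
    using b_in b1 b_ge len_A unfolding b'_def by auto
  have b'_le: "b' \<le> length A - 1 - h x" if "x \<in> set (rev D2)" for x
    using b_ge(2)[of x] that unfolding b'_def by simp
  have drop_rev_set: "set (drop (b' + 2) (rev A)) = set (take (b - 1) A)"
  proof -
    have "length A - (b' + 2) = b - 1" using b'(4) by simp
    then show ?thesis unfolding drop_rev by simp
  qed
  consider "v1 \<in> set (drop (a + 2) A @ D1)" "v2 \<in> set (drop (a + 2) A @ D1)"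
    | "v1 \<in> set (take (b - 1) A @ D2)" "v2 \<in> set (take (b - 1) A @ D2)"
    | "\<And>y y'. y \<in> set (drop (a + 2) A @ D1) \<Longrightarrow> y' \<in> set (drop (a + 2) A @ D1) \<Longrightarrow>
       {u, y} \<in> B \<Longrightarrow> {u, y'} \<in> B \<Longrightarrow> y = y'"
      "\<And>y y'. y \<in> set (take (b - 1) A @ D2) \<Longrightarrow> y' \<in> set (take (b - 1) A @ D2) \<Longrightarrow>
       {u, y} \<in> B \<Longrightarrow> {u, y'} \<in> B \<Longrightarrow> y = y'"
  proof -
    have "y \<in> set A \<union> set D" if "y \<in> set (drop (a + 2) A @ D1) \<or> y \<in> set (take (b - 1) A @ D2)" for y
      using that D by (auto dest: in_set_dropD in_set_takeD)
    then have "{u, y} \<in> B \<Longrightarrow> y = v1 \<or> y = v2" if "y \<in> set (drop (a + 2) A @ D1) \<or> y \<in> set (take (b - 1) A @ D2)" for y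
      using that u_neighbour by blast
    then show thesis using that by metis
  qed
  then show ?thesis
  proof cases
    case 1
    then show ?thesis using bouquet_in_fan_left[OF D c a' a_le(2) a1] by blast
  next
    case 2
    then have "bouquet B (rev xs)"
      using r.bouquet_in_fan_left[OF rD rc b'(1,2) b'_le b'(3)] drop_rev_set by auto
    then show ?thesis using bouquet_rev[of B "rev xs"] by simp
  next
    case 3
    \<comment> \<open>Starting at \<open>b - 1\<close> includes the middle part, so a single chord
      from \<open>u\<close> joins the two triangulations.\<close>
    have left: "tri B (drop (b - 1) A @ D1 @ [u])"
      by (rule left_part_tri[OF D c a']) (use ba allowed 3(1) in auto)
    have "tri B (drop (b' + 1) (rev A) @ rev D2 @ [u])"
    proof (rule r.left_part_tri[OF rD rc b'(1,2)])
      fix i assume "b' + 1 \<le> i" "i \<le> b' + 1"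
      then have "rev A ! i = A ! (b - 1)" using b'(4) b_ge
        by (auto simp: rev_nth intro!: arg_cong[of _ _ "(!) A"])
      then show "{u, rev A ! i} \<notin> B" using allowed[of "b - 1"] ba by simp
    next
      fix y y' assume "y \<in> set (drop (b' + 2) (rev A) @ rev D2)" "y' \<in> set (drop (b' + 2) (rev A) @ rev D2)"
         "{u, y} \<in> B" "{u, y'} \<in> B"
      then show "y = y'" using 3(2) drop_rev_set by auto
    qed simp
    then have "tri B (rev (drop (b' + 1) (rev A) @ rev D2 @ [u]))" by (rule tri_rev)
    moreover have "rev (drop (b' + 1) (rev A)) = take b A"
    proof -
      have "length A - (b' + 1) = b" using b'(4) by simp
      then show ?thesis unfolding drop_rev by simp
    qed
    ultimately have right: "tri B (u # D2 @ take b A)" by simp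
    have b2: "b - 1 < length A" "b = Suc (b - 1)" using b1 b_ge by auto
    have t: "take b A = take (b - 1) A @ [A ! (b - 1)]"
      using b2 take_Suc_conv_app_nth by metis
    have d: "drop (b - 1) A = A ! (b - 1) # drop b A"
      using b2 Cons_nth_drop_Suc by metis
    have "tri B (u # (D2 @ take (b - 1) A) @ A ! (b - 1) # (drop b A @ D1))"
    proof (rule tri_split)
      show "tri B (u # (D2 @ take (b - 1) A) @ [A ! (b - 1)])" using right t by simp
      show "tri B (A ! (b - 1) # (drop b A @ D1) @ [u])" using left d by simp
      show "{u, A ! (b - 1)} \<notin> B" using allowed[of "b - 1"] ba by simp
    qed
    then have "tri B (u # D2 @ A @ D1)" using A_split[OF b2(1)] b2(2) by (metis Suc_eq_plus1 append_Cons append_assoc)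
    moreover have "cyc (u # D2 @ A @ D1) (A @ D1 @ u # D2)"
      using cyc_append[of "u # D2" "A @ D1"] by simp
    then have "cyc (u # D2 @ A @ D1) xs" using c cyc_sym cyc_trans by blast
    ultimately show ?thesis using tri_cyc not_tri by blast
  qed
qed

section \<open>Counting edges at ears, and a vertex next to an end of the arc\<close>

lemma within_B: "within B xs = B"
  unfolding within_def using edges by fastforce

text \<open>The polygon left after cutting off an ear needs \<open>length xs - 3\<close> of the
  \<open>length xs - 1\<close> edges.\<close>

lemma ear_edges:
  assumes "cyc xs (x # zs)" "{hd zs, last zs} \<notin> B" "S \<subseteq> B" "\<And>e. e \<in> S \<Longrightarrow> x \<in> e"
  shows "card S \<le> 2"
proof -
  have d: "distinct (x # zs)" using cyc_distinct[OF assms(1)] dist_xs by simp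
  have s: "set (x # zs) = set xs" using cyc_set[OF assms(1)] .
  have "card S + length zs \<le> card (within B xs) + 2"
  proof (rule not_tri_card_avoiding[OF not_tri_ear[OF not_tri assms(1,2)]])
    fix e assume "e \<in> S"
    then have "x \<in> e" by (rule assms(4))
    then show "\<not> e \<subseteq> set zs" using d by auto
  qed (use d s assms(3) within_B in auto)
  then show ?thesis using within_B card_B cyc_length[OF assms(1)] by simp
qed

text \<open>After two successive ears \<open>length xs - 4\<close> of the
  \<open>length xs - 1\<close> edges must remain.\<close>

lemma two_ears_edges:
  assumes "cyc xs (x # zs)" "{hd zs, last zs} \<notin> B" "cyc zs (y # ts)" "{hd ts, last ts} \<notin> B"
    "S \<subseteq> B" "\<And>e. e \<in> S \<Longrightarrow> x \<in> e \<or> y \<in> e"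
  shows "card S \<le> 3"
proof -
  have d: "distinct (x # zs)" "distinct (y # ts)"
    using cyc_distinct[OF assms(1)] cyc_distinct[OF assms(3)] dist_xs by auto
  have s: "set (x # zs) = set xs" "set (y # ts) = set zs" using cyc_set[OF assms(1)] cyc_set[OF assms(3)] by auto
  have sub: "set ts \<subseteq> set zs" using s(2) by auto
  have "card S + length ts \<le> card (within B xs) + 2"
  proof (rule not_tri_card_avoiding[OF not_tri_ear[OF not_tri_ear[OF not_tri assms(1,2)] assms(3,4)]])
    fix e assume "e \<in> S"
    then have "x \<in> e \<or> y \<in> e" by (rule assms(6))
    moreover have "x \<notin> set ts" "y \<notin> set ts" using d sub by auto
    ultimately show "\<not> e \<subseteq> set ts" by auto
  qed (use d s sub assms(5) within_B in auto)
  then show ?thesis using within_B card_B cyc_length[OF assms(1)] cyc_length[OF assms(3)] by simp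
qed

lemma ear_degree:
  assumes "cyc xs (x # zs)" "{hd zs, last zs} \<notin> B"
    and "{x, a} \<in> B" "{x, b} \<in> B" "{x, c} \<in> B" "a \<noteq> b" "a \<noteq> c" "b \<noteq> c"
  shows False
proof -
  have "card {{x, a}, {x, b}, {x, c}} = 3" using assms(6-8) by (auto simp: card_insert_if doubleton_eq_iff)
  then show False using ear_edges[OF assms(1,2), of "{{x, a}, {x, b}, {x, c}}"] assms(3-5) by auto
qed

lemma two_ears_degree:
  assumes "cyc xs (x # zs)" "{hd zs, last zs} \<notin> B" "cyc zs (y # ts)" "{hd ts, last ts} \<notin> B"
    and "{x, a} \<in> B" "{x, b} \<in> B" "{y, c} \<in> B" "{y, d} \<in> B" "a \<noteq> b" "c \<noteq> d" "x \<noteq> c" "x \<noteq> d"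
  shows False
proof -
  have "x \<noteq> y" using cyc_distinct[OF assms(1)] cyc_set[OF assms(3)] dist_xs by auto
  then have "card {{x, a}, {x, b}, {y, c}, {y, d}} = 4" using assms(9-12)
    by (auto simp: card_insert_if doubleton_eq_iff)
  then show False
    using two_ears_edges[OF assms(1-4), of "{{x, a}, {x, b}, {y, c}, {y, d}}"] assms(5-8) by auto
qed

lemma ear_isolates:
  assumes "cyc xs (x # zs)" "{hd zs, last zs} \<notin> B" "y \<in> set zs"
    and "\<And>t. t \<in> set zs \<Longrightarrow> t \<noteq> y \<Longrightarrow> {y, t} \<notin> B"
  shows False
proof -
  obtain ts where ts: "cyc zs (y # ts)" using cyc_move[OF assms(3)] by blast
  have "distinct (y # ts)"
    using cyc_distinct[OF ts] cyc_distinct[OF assms(1)] dist_xs by simp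
  then have "\<forall>t\<in>set ts. {y, t} \<notin> B" using assms(4) cyc_set[OF ts] by auto
  then show False
    using tri_isolated_cyc[OF ts] not_tri_ear[OF not_tri assms(1,2)] by blast
qed

lemma neighbours_are:
  assumes "{u, a} \<in> B" "{u, b} \<in> B" "a \<noteq> b" "a \<in> set A \<union> set D" "b \<in> set A \<union> set D"
  shows "v1 = a \<and> v2 = b \<or> v1 = b \<and> v2 = a"
  using assms u_neighbour[of a] u_neighbour[of b] by auto

text \<open>An arc of four vertices has interior positions 1 and 2 only, and maximality forbids 2
  for the first vertex of \<open>D\<close>.\<close>

lemma no_short_arc_without_one:
  assumes "length A = 4" "\<And>x. x \<in> set D \<Longrightarrow> h x \<noteq> 1" "5 \<le> length A + length D"
  shows False
proof -
  have "D \<noteq> []" using assms by auto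
  then have "hd D \<in> set D" by simp
  then have "h (hd D) = 2" using h_bounds[of "hd D"] assms(1,2) by fastforce
  then show False using mx(2)[OF \<open>D \<noteq> []\<close>] assms(1) by simp
qed

text \<open>After \<open>d\<close> the position is at most 2 and, \<open>d\<close> being the only
  vertex with position 1, equals 2. Maximality ensures that \<open>d\<close> is not the last
  vertex.\<close>

lemma last_one_split:
  assumes "d \<in> set D" "h d = 1" "\<And>x. x \<in> set D \<Longrightarrow> h x = 1 \<Longrightarrow> x = d"
  obtains E1 E2 where "D = E1 @ d # E2" "E2 \<noteq> []" "\<And>x. x \<in> set E2 \<Longrightarrow> h x = 2"
    "\<And>x. x \<in> set E1 \<Longrightarrow> 2 \<le> h x"
proof -
  obtain E1 E2 where E: "D = E1 @ d # E2" using assms(1) by (meson split_list)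
  have "E2 \<noteq> []" using mx(1) E assms(2) by auto
  moreover have "h x = 2" if "x \<in> set E2" for x
  proof -
    have "h x \<le> h d + 1" using h_almost_decreasing E that by (auto simp: sorted_wrt_append)
    moreover have "x \<noteq> d" using dist(2) E that by auto
    then have "h x \<noteq> 1" using assms(3)[of x] E that by auto
    moreover have "1 \<le> h x" using h_bounds(1)[of x] E that by simp
    ultimately show ?thesis using assms(2) by simp
  qed
  moreover have "2 \<le> h x" if "x \<in> set E1" for x
  proof -
    have "x \<noteq> d" using dist(2) E that by auto
    then have "h x \<noteq> 1" using assms(3)[of x] E that by auto
    moreover have "1 \<le> h x" using h_bounds(1)[of x] E that by simp
    ultimately show ?thesis by simp
  qed
  ultimately show thesis using that E by blast
qed

text \<open>If \<open>u\<close> is joined to \<open>g\<close>, an arc beginning with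
  \<open>u\<close> blocks without the other edge at \<open>u\<close>. Otherwise \<open>c\<close> is
  an ear. If no vertex of \<open>D\<close> is joined to \<open>c\<close>, either an arc beginning
  with \<open>c\<close> blocks without one edge at \<open>u\<close>, or a zigzag avoids
  \<open>B\<close>. If some \<open>d\<close> is, the counts at \<open>c\<close> make it unique and
  force edges from \<open>u\<close> to \<open>d\<close> and \<open>r\<close>; this is a bouquet with
  \<open>p = d\<close> and \<open>q = u\<close>.\<close>

lemma bouquet_after_first:
  assumes A: "A = f # c # g # r # A5" and cy: "cyc xs (f # u # (c # g # r # A5) @ D)"
    and len: "5 \<le> length A + length D"
  shows "bouquet B xs"
proof -
  have nth: "A ! 0 = f" "A ! 1 = c" "A ! 2 = g" "A ! 3 = r" using A by (auto simp: numeral_eq_Suc)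
  have dA: "distinct (f # c # g # r # A5)" using dist(1) A by simp
  have AD: "set A \<inter> set D = {}" "u \<notin> set A" "u \<notin> set D" using dist by auto
  have B_A: "{f, g} \<in> B" "{c, r} \<in> B"
    using arc_short[of 0] arc_short[of 1] len_A nth A by (auto simp: numeral_eq_Suc)
  have f_iff: "{f, y} \<in> B \<longleftrightarrow> y = g" if y: "y \<in> set A" for y
  proof -
    obtain j where j: "j < length A" "y = A ! j" using y by (metis in_set_conv_nth)
    have l: "0 < length A" "2 < length A" using len_A by linarith+
    have "{A ! 0, A ! j} \<in> B \<longleftrightarrow> j = 2" using A_A[OF l(1) j(1)] by auto
    moreover have "A ! j = A ! 2 \<longleftrightarrow> j = 2" using A_eq[OF j(1) l(2)] .
    ultimately show ?thesis using j nth by simp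
  qed
  have f_D: "{f, y} \<notin> B" if "y \<in> set D" for y
  proof -
    have "0 < length A" using len_A by linarith
    then show ?thesis using D_A(2)[OF that, of 0] nth(1) h_bounds(1)[OF that] by simp
  qed
  have cyu: "cyc xs ((u # c # g # r # A5) @ D @ [f])" using cyc_shift[of xs "[f]" "u # (c # g # r # A5) @ D"] cy by simp
  have cyc': "cyc xs ((c # g # r # A5) @ D @ [f, u])" using cyc_shift[of xs "[f, u]" "(c # g # r # A5) @ D"] cy by simp
  have uf: "{u, f} \<notin> B" and uc: "{u, c} \<notin> B"
    using adjacent_not_neighbour(2)[of "[]" f "(c # g # r # A5) @ D"]
      adjacent_not_neighbour(1)[of "[f]" c "(g # r # A5) @ D"] cy by auto
  have h_A: "A ! h x = (c # g # r # A5) ! (h x - 1)" "A ! h x = (u # c # g # r # A5) ! h x"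
      if "x \<in> set D" for x
    using h_bounds(1)[OF that] A by (cases "h x"; simp)+
  have short': "{(c # g # r # A5) ! i, (c # g # r # A5) ! (i + 2)} \<in> B" if "i + 2 < length (c # g # r # A5)" for i
    using arc_short[of "i + 1"] that A by simp
  have u_not: "u \<noteq> y" if "y \<in> set A \<union> set D" for y using AD that by auto
  have f_notD: "f \<notin> set D" using AD A by auto
  have edge_ne: "{x, y} \<noteq> {u, v}" if "x \<in> set A \<union> set D" "y \<in> set A \<union> set D" for x y v
    using u_not[OF that(1)] u_not[OF that(2)] by (auto simp: doubleton_eq_iff)
  have short_in: "(c # g # r # A5) ! i \<in> set A" if "i < length (c # g # r # A5)" for i
    using nth_mem[OF that] A by auto
  have h_in: "A ! h x \<in> set A" if "x \<in> set D" for x using h_bounds(2)[OF that] by simp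
  have sorted_Df: "sorted_wrt (\<lambda>x y. k y \<le> k x + 1) D" if "\<And>x. x \<in> set D \<Longrightarrow> k x = h x - 1 \<or> k x = h x"
    "(\<forall>x\<in>set D. k x = h x - 1) \<or> (\<forall>x\<in>set D. k x = h x)" for k :: "'a \<Rightarrow> nat"
    by (rule sorted_wrt_mono_rel[OF _ h_almost_decreasing]) (use that(2) in auto)
  show ?thesis
  proof (cases "{u, g} \<in> B")
    case ug: True
    obtain v where v: "v = v1 \<or> v = v2" "v \<noteq> g" using other_neighbour[OF ug] A by auto
    \<comment> \<open>\<open>u\<close> takes the place of \<open>f\<close>, which moves to the end
      of \<open>D\<close> with its edge to \<open>g\<close>.\<close>
    have "fan_block (B - {{u, v}}) (u # c # g # r # A5) (D @ [f]) (h(f := 2))"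
      unfolding fan_block_def
    proof (intro conjI allI impI ballI)
      fix i assume i: "i + 2 < length (u # c # g # r # A5)"
      show "{(u # c # g # r # A5) ! i, (u # c # g # r # A5) ! (i + 2)} \<in> B - {{u, v}}"
      proof (cases i)
        case 0
        then show ?thesis using ug v by (auto simp: doubleton_eq_iff)
      next
        case (Suc i')
        then show ?thesis using short'[of i'] i edge_ne short_in[of i'] short_in[of "i' + 2"] by auto
      qed
    next
      fix x assume x: "x \<in> set (D @ [f])"
      have "1 \<le> (h(f := 2)) x \<and> (h(f := 2)) x + 1 < length (u # c # g # r # A5) \<and>
          {x, (u # c # g # r # A5) ! (h(f := 2)) x} \<in> B - {{u, v}}"
      proof (cases "x = f")
        case True
        then show ?thesis using B_A edge_ne[of f g] A by auto
      next
        case False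
        then have xD: "x \<in> set D" using x by simp
        then show ?thesis using False h_bounds[OF xD] D_edge[OF xD] h_A(2)[OF xD] edge_ne h_in[OF xD] A by auto
      qed
      then show "1 \<le> (h(f := 2)) x" "(h(f := 2)) x + 1 < length (u # c # g # r # A5)"
          "{x, (u # c # g # r # A5) ! (h(f := 2)) x} \<in> B - {{u, v}}" by blast+
    next
      have "sorted_wrt (\<lambda>x y. (h(f := 2)) y \<le> (h(f := 2)) x + 1) D"
        by (rule sorted_Df) (use f_notD in auto)
      then show "sorted_wrt (\<lambda>x y. (h(f := 2)) y \<le> (h(f := 2)) x + 1) (D @ [f])"
        using f_notD h_bounds(1) by (fastforce simp: sorted_wrt_append)
    qed simp_all
    then show ?thesis using sat_fan[OF cyu _ v(1)] by blast
  next
    case ug: False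
    have ear_c: "{hd ((g # r # A5 @ D) @ [f, u]), last ((g # r # A5 @ D) @ [f, u])} \<notin> B"
      using ug by (auto simp: insert_commute)
    have cc: "cyc xs (c # (g # r # A5 @ D) @ [f, u])" using cyc' by simp
    show ?thesis
    proof (cases "\<exists>x\<in>set D. h x = 1")
      case False
      have A5: "A5 \<noteq> []"
        using no_short_arc_without_one[OF _ _ len] False A by auto
      show ?thesis
      proof (cases "{u, r} \<in> B")
        case ur: True
        let ?h = "\<lambda>x. if x = f then 1 else if x = u then 2 else h x - 1"
        obtain v where v: "v = v1 \<or> v = v2" "v \<noteq> r" using other_neighbour[OF ur] A by auto
        have "fan_block (B - {{u, v}}) (c # g # r # A5) (D @ [f, u]) ?h"
          unfolding fan_block_def
        proof (intro conjI allI impI ballI)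
          fix i assume i: "i + 2 < length (c # g # r # A5)"
          then show "{(c # g # r # A5) ! i, (c # g # r # A5) ! (i + 2)} \<in> B - {{u, v}}"
            using short'[OF i] edge_ne[of "(c # g # r # A5) ! i" "(c # g # r # A5) ! (i + 2)"]
              short_in[of i] short_in[of "i + 2"] by simp
        next
          fix x assume x: "x \<in> set (D @ [f, u])"
          have "1 \<le> ?h x \<and> ?h x + 1 < length (c # g # r # A5) \<and> {x, (c # g # r # A5) ! ?h x} \<in> B - {{u, v}}"
          proof (cases "x = f \<or> x = u")
            case True
            then show ?thesis using B_A edge_ne[of f g] A ur v A5 u_not[of f]
              by (auto simp: doubleton_eq_iff)
          next
            case xf: False
            then have xD: "x \<in> set D" using x by auto
            moreover have "h x \<noteq> 1" using False xD by auto
            ultimately show ?thesis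
              using xf h_bounds[OF xD] D_edge[OF xD] h_A(1)[OF xD] edge_ne[of x "A ! h x"] h_in[OF xD] A by auto
          qed
          then show "1 \<le> ?h x" "?h x + 1 < length (c # g # r # A5)"
            "{x, (c # g # r # A5) ! ?h x} \<in> B - {{u, v}}" by blast+
        next
          have "sorted_wrt (\<lambda>x y. ?h y \<le> ?h x + 1) D"
            by (rule sorted_Df) (use f_notD AD in auto)
          moreover have "\<forall>x\<in>set D. 2 \<le> h x" using False h_bounds(1) by (force simp: le_less)
          ultimately show "sorted_wrt (\<lambda>x y. ?h y \<le> ?h x + 1) (D @ [f, u])"
            using f_notD AD(3) u_not[of f] A by (auto simp: sorted_wrt_append)
        qed simp_all
        then show ?thesis using sat_fan[OF cyc' _ v(1)] by blast
      next
        case ur: False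
        \<comment> \<open>The triangle \<open>r\<close>, \<open>f\<close>, \<open>u\<close>: the fan
          at \<open>f\<close> avoids its only target \<open>g\<close>, and \<open>u\<close> fans
          over \<open>c\<close> and \<open>g\<close>.\<close>
        have "tri B (r # (A5 @ D) @ f # [] @ u # [c, g])"
        proof (rule tri_zigzag)
          show "\<forall>x\<in>set (r # (A5 @ D) @ [] @ [u]). {f, x} \<notin> B"
          proof -
            have "{f, u} \<notin> B" using uf by (simp add: insert_commute)
            then show ?thesis using f_iff f_D dA A by auto
          qed
          show "\<forall>x\<in>set ([c, g] @ [r]). {u, x} \<notin> B" using ug ur uc by auto
        qed
        moreover have "cyc xs (r # (A5 @ D) @ f # [] @ u # [c, g])"
          using cyc_shift[of xs "[c, g]" "r # A5 @ D @ [f, u]"] cyc' by simp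
        ultimately show ?thesis using not_tri tri_cyc cyc_sym by blast
      qed
    next
      case True
      then obtain d where d: "d \<in> set D" "h d = 1" by blast
      have cd: "{c, d} \<in> B" using D_edge[OF d(1)] d(2) nth by (simp add: insert_commute)
      have rd: "r \<noteq> d" using d(1) AD A by auto
      have one: "x = d" if "x \<in> set D" "h x = 1" for x
      proof (rule ccontr)
        assume "x \<noteq> d"
        have "{c, x} \<in> B" using D_edge[OF that(1)] that(2) nth by (simp add: insert_commute)
        moreover have "r \<noteq> x" using that(1) AD A by auto
        ultimately show False using ear_degree[OF cc ear_c B_A(2) cd] rd \<open>x \<noteq> d\<close> by blast
      qed
      obtain E1 E2 where E: "D = E1 @ d # E2" "E2 \<noteq> []" "\<And>x. x \<in> set E2 \<Longrightarrow> h x = 2"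
          "\<And>x. x \<in> set E1 \<Longrightarrow> 2 \<le> h x"
        using last_one_split[OF d one] by metis
      have d_iff: "{d, y} \<in> B \<longleftrightarrow> y = c" if "y \<in> set A \<union> set D" for y
        using h_iff[OF d(1) that] d(2) nth by simp
      \<comment> \<open>Otherwise cutting off \<open>c\<close> isolates \<open>d\<close>.\<close>
      have ud: "{u, d} \<in> B"
      proof (rule ccontr)
        assume "{u, d} \<notin> B"
        then have du: "{d, u} \<notin> B" by (simp add: insert_commute)
        have "c \<notin> set ((g # r # A5 @ D) @ [f, u])" using dA A AD u_not[of c] by auto
        then have "{d, t} \<notin> B" if "t \<in> set ((g # r # A5 @ D) @ [f, u])" for t
          using du d_iff[of t] that A by (cases "t = u") auto
        then show False using ear_isolates[OF cc ear_c, of d] d(1) by simp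
      qed
      \<comment> \<open>Otherwise \<open>g\<close> becomes an ear once \<open>c\<close> is cut off,
        and \<open>c\<close> and \<open>g\<close> together lose four edges.\<close>
      have ur: "{u, r} \<in> B"
      proof (rule ccontr)
        assume *: "{u, r} \<notin> B"
        have "hd E2 \<in> set E2" using E(2) by simp
        then have gE: "{g, hd E2} \<in> B" using D_edge[of "hd E2"] E nth by (auto simp: insert_commute)
        have "f \<noteq> hd E2" "c \<noteq> hd E2" "c \<noteq> f" using \<open>hd E2 \<in> set E2\<close> E(1) AD A dA by auto
        moreover have "{g, f} \<in> B" using B_A by (simp add: insert_commute)
        moreover have "{hd (r # A5 @ D @ [f, u]), last (r # A5 @ D @ [f, u])} \<notin> B"
          using * by (simp add: insert_commute)
        ultimately show False
          using two_ears_degree[OF cc ear_c, of g "r # A5 @ D @ [f, u]" r d f "hd E2"] B_A cd gE rd by simp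
      qed
      have v: "v1 = d \<and> v2 = r \<or> v1 = r \<and> v2 = d"
        using neighbours_are[OF ud ur] rd d A by auto
      have "bouquet_on B (c # g # r # A5) E1 d (E2 @ [f]) u [] 1 (\<lambda>x. h x - 1)"
        unfolding bouquet_on_def
      proof (intro conjI ballI)
        fix e assume "e \<in> B"
        then show "e = {d, (c # g # r # A5) ! (1 - 1)} \<or> e = {u, (c # g # r # A5) ! (1 + 1)} \<or> e = {d, u} \<or>
          (\<exists>x\<in>set (E2 @ [f]). e = {x, (c # g # r # A5) ! 1}) \<or>
          (\<exists>i. i + 2 < length (c # g # r # A5) \<and> e = {(c # g # r # A5) ! i, (c # g # r # A5) ! (i + 2)}) \<or>
          (\<exists>x\<in>set E1 \<union> set []. e = {x, (c # g # r # A5) ! (h x - 1)})"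
        proof (cases rule: edge_cases)
          case 1
          then show ?thesis using v by (auto simp: insert_commute)
        next
          case 2
          then show ?thesis using v by (auto simp: insert_commute)
        next
          case (3 i)
          show ?thesis
          proof (cases i)
            case 0
            then have "e = {f, g}" using 3 A by simp
            then show ?thesis by simp
          next
            case (Suc i')
            then have "i' + 2 < length (c # g # r # A5)"
              "e = {(c # g # r # A5) ! i', (c # g # r # A5) ! (i' + 2)}" using 3 A by auto
            then show ?thesis by blast
          qed
        next
          case (4 x)
          then consider "x \<in> set E1" | "x = d" | "x \<in> set E2" using E(1) by auto
          then show ?thesis
          proof cases
            case 1
            then have "e = {x, (c # g # r # A5) ! (h x - 1)}" using 4 h_A(1)[of x] by simp
            then show ?thesis using 1 by blast
          next
            case 2
            then have "e = {d, (c # g # r # A5) ! (1 - 1)}" using 4 d nth by simp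
            then show ?thesis by blast
          next
            case 3
            then have "e = {x, (c # g # r # A5) ! 1}" using 4 E(3) nth by simp
            moreover have "x \<in> set (E2 @ [f])" using 3 by simp
            ultimately show ?thesis by blast
          qed
        qed
      next
        show "1 \<le> h x - 1" if "x \<in> set E1" for x using E(4)[OF that] by simp
        show "h x - 1 + 1 < length (c # g # r # A5)" if "x \<in> set E1" for x
          using h_bounds[of x] that E(1) A by auto
        have "sorted_wrt (\<lambda>x y. h y - 1 \<le> h x - 1 + 1) D" by (rule sorted_Df) auto
        then show "sorted_wrt (\<lambda>x y. h y - 1 \<le> h x - 1 + 1) E1" using E(1) by (simp add: sorted_wrt_append)
      qed simp_all
      moreover have "cyc xs ((c # g # r # A5) @ E1 @ d # (E2 @ [f]) @ u # [])" using cyc' E(1) by simp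
      ultimately show ?thesis unfolding bouquet_def by blast
    qed
  qed
qed

lemma bouquet_before_last:
  assumes A: "A = A0 @ [e]" and cy: "cyc xs (A0 @ u # e # D)" and len: "5 \<le> length A + length D"
  shows "bouquet B xs"
proof -
  interpret r: ear_insertion B "rev xs" "rev ys" "rev A" "rev D" "\<lambda>x. length A - 1 - h x" u v1 v2
    by (rule rev_insertion)
  obtain c g r A5 where A': "rev A = e # c # g # r # A5"
  proof -
    have "Suc (Suc (Suc 0)) \<le> length (rev A0)" using A len_A by simp
    then obtain c g r A5 where "rev A0 = c # g # r # A5" unfolding Suc_le_length_iff by blast
    then show thesis using that A by simp
  qed
  have "cyc (rev xs) (rev D @ e # u # rev A0)" using cyc_rev[OF cy] by simp
  then have "cyc (rev xs) (e # u # rev A0 @ rev D)"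
    using cyc_shift[of "rev xs" "rev D" "e # u # rev A0"] by simp
  then have "bouquet B (rev xs)"
    using r.bouquet_after_first[OF A'] A A' len by simp
  then show ?thesis using bouquet_rev[of B "rev xs"] by simp
qed

end

section \<open>The vertex inside the arc of short diagonals\<close>

text \<open>In types 1 and 2 the list C consists of the vertices \<open>0, ..., m + 2\<close> and D of the remaining ones.\<close>

definition sea_on :: "'a set set \<Rightarrow> 'a list \<Rightarrow> 'a list \<Rightarrow> nat \<Rightarrow> ('a \<Rightarrow> nat) \<Rightarrow> bool" where
  "sea_on B C D l h \<longleftrightarrow> 2 < l \<and> l + 3 < length C \<and>
     (\<forall>x\<in>set D. 1 \<le> h x \<and> h x + 1 < length C \<and> h x \<noteq> l) \<and> sorted_wrt (\<lambda>x y. h y \<le> h x + 1) D \<and>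
     (\<forall>e\<in>B. e = {C ! (l - 2), C ! l} \<or> e = {C ! (l - 2), C ! (l + 1)} \<or> e = {C ! (l - 1), C ! (l + 2)} \<or>
        e = {C ! l, C ! (l + 2)} \<or> (\<exists>i. (i + 3 \<le> l \<or> l + 1 \<le> i) \<and> i + 2 < length C \<and> e = {C ! i, C ! (i + 2)}) \<or>
        (\<exists>x\<in>set D. e = {x, C ! h x}))"

definition buffer_on :: "'a set set \<Rightarrow> 'a list \<Rightarrow> 'a list \<Rightarrow> nat \<Rightarrow> ('a \<Rightarrow> nat) \<Rightarrow> bool" where
  "buffer_on B C D l h \<longleftrightarrow> 2 < l \<and> l + 4 < length C \<and>
     (\<forall>x\<in>set D. 1 \<le> h x \<and> h x + 1 < length C \<and> h x \<noteq> l \<and> h x \<noteq> l + 1) \<and>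
     sorted_wrt (\<lambda>x y. h y \<le> h x + 1) D \<and>
     (\<forall>e\<in>B. e = {C ! (l - 2), C ! l} \<or> e = {C ! (l - 2), C ! (l + 1)} \<or> e = {C ! (l - 1), C ! (l + 2)} \<or>
        e = {C ! l, C ! (l + 3)} \<or> e = {C ! (l + 1), C ! (l + 3)} \<or>
        (\<exists>i. (i + 3 \<le> l \<or> l + 2 \<le> i) \<and> i + 2 < length C \<and> e = {C ! i, C ! (i + 2)}) \<or>
        (\<exists>x\<in>set D. e = {x, C ! h x}))"

definition sea :: "'a set set \<Rightarrow> 'a list \<Rightarrow> bool" where
  "sea B xs \<longleftrightarrow> (\<exists>C D l h. cyc xs (C @ D) \<and> sea_on B C D l h)"

definition buffer :: "'a set set \<Rightarrow> 'a list \<Rightarrow> bool" where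
  "buffer B xs \<longleftrightarrow> (\<exists>C D l h. cyc xs (C @ D) \<and> buffer_on B C D l h)"

text \<open>The shape is symmetric about the gap between \<open>l\<close> and \<open>l + 1\<close>,
  so the reflection sends \<open>l + 1\<close>, not \<open>l\<close>, to the new parameter.\<close>

lemma buffer_on_rev:
  assumes "buffer_on B C D l h"
  shows "buffer_on B (rev C) (rev D) (length C - 2 - l) (\<lambda>x. length C - 1 - h x)"
proof -
  have l: "2 < l" "l + 4 < length C" and s: "sorted_wrt (\<lambda>x y. h y \<le> h x + 1) D"
    and D: "\<And>x. x \<in> set D \<Longrightarrow> 1 \<le> h x \<and> h x + 1 < length C \<and> h x \<noteq> l \<and> h x \<noteq> l + 1"
    using assms by (simp_all add: buffer_on_def)
  let ?l = "length C - 2 - l" and ?h = "\<lambda>x. length C - 1 - h x"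
  have nth: "rev C ! j = C ! i" if "i + j + 1 = length C" for i j
    using that by (auto simp: rev_nth intro!: arg_cong[of _ _ "(!) C"])
  have n: "rev C ! (?l + 1) = C ! l" "rev C ! ?l = C ! (l + 1)" "rev C ! (?l - 1) = C ! (l + 2)"
    "rev C ! (?l - 2) = C ! (l + 3)" "rev C ! (?l + 2) = C ! (l - 1)" "rev C ! (?l + 3) = C ! (l - 2)"
    by (rule nth, use l in simp)+
  have "e = {rev C ! (?l - 2), rev C ! ?l} \<or> e = {rev C ! (?l - 2), rev C ! (?l + 1)} \<or>
      e = {rev C ! (?l - 1), rev C ! (?l + 2)} \<or> e = {rev C ! ?l, rev C ! (?l + 3)} \<or>
      e = {rev C ! (?l + 1), rev C ! (?l + 3)} \<or>
      (\<exists>i. (i + 3 \<le> ?l \<or> ?l + 2 \<le> i) \<and> i + 2 < length (rev C) \<and> e = {rev C ! i, rev C ! (i + 2)}) \<or>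
      (\<exists>x\<in>set (rev D). e = {x, rev C ! ?h x})" if e: "e \<in> B" for e
  proof -
    have "e = {C ! (l - 2), C ! l} \<or> e = {C ! (l - 2), C ! (l + 1)} \<or> e = {C ! (l - 1), C ! (l + 2)} \<or>
        e = {C ! l, C ! (l + 3)} \<or> e = {C ! (l + 1), C ! (l + 3)} \<or>
        (\<exists>i. (i + 3 \<le> l \<or> l + 2 \<le> i) \<and> i + 2 < length C \<and> e = {C ! i, C ! (i + 2)}) \<or>
        (\<exists>x\<in>set D. e = {x, C ! h x})"
      using assms e unfolding buffer_on_def by simp
    then show ?thesis
    proof (elim disjE)
      assume "e = {C ! (l - 2), C ! l}"
      then have "e = {rev C ! (?l + 1), rev C ! (?l + 3)}" unfolding n by (simp only: insert_commute)
      then show ?thesis by (simp only: simp_thms)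
    next
      assume "e = {C ! (l - 2), C ! (l + 1)}"
      then have "e = {rev C ! (?l), rev C ! (?l + 3)}" unfolding n by (simp only: insert_commute)
      then show ?thesis by (simp only: simp_thms)
    next
      assume "e = {C ! (l - 1), C ! (l + 2)}"
      then have "e = {rev C ! (?l - 1), rev C ! (?l + 2)}" unfolding n by (simp only: insert_commute)
      then show ?thesis by (simp only: simp_thms)
    next
      assume "e = {C ! l, C ! (l + 3)}"
      then have "e = {rev C ! (?l - 2), rev C ! (?l + 1)}" unfolding n by (simp only: insert_commute)
      then show ?thesis by (simp only: simp_thms)
    next
      assume "e = {C ! (l + 1), C ! (l + 3)}"
      then have "e = {rev C ! (?l - 2), rev C ! (?l)}" unfolding n by (simp only: insert_commute)
      then show ?thesis by (simp only: simp_thms)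
    next
      assume "\<exists>i. (i + 3 \<le> l \<or> l + 2 \<le> i) \<and> i + 2 < length C \<and> e = {C ! i, C ! (i + 2)}"
      then obtain i where i: "i + 3 \<le> l \<or> l + 2 \<le> i" "i + 2 < length C" "e = {C ! i, C ! (i + 2)}" by blast
      let ?i = "length C - 3 - i"
      have "?i + 3 \<le> ?l \<or> ?l + 2 \<le> ?i" "?i + 2 < length (rev C)" using i(1,2) l by auto
      moreover have "e = {rev C ! ?i, rev C ! (?i + 2)}" using short_rev(2)[OF i(2)] i(3) by simp
      ultimately have "\<exists>i. (i + 3 \<le> ?l \<or> ?l + 2 \<le> i) \<and> i + 2 < length (rev C) \<and> e = {rev C ! i, rev C ! (i + 2)}"
        by blast
      then show ?thesis by (simp only: simp_thms)
    next
      assume "\<exists>x\<in>set D. e = {x, C ! h x}"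
      then obtain x where x: "x \<in> set D" "e = {x, C ! h x}" by blast
      have "rev C ! ?h x = C ! h x" by (rule nth) (use D[OF x(1)] in linarith)
      then have "e = {x, rev C ! ?h x}" "x \<in> set (rev D)" using x by simp_all
      then have "\<exists>x\<in>set (rev D). e = {x, rev C ! ?h x}" by blast
      then show ?thesis by (simp only: simp_thms)
    qed
  qed
  moreover have "sorted_wrt (\<lambda>x y. ?h y \<le> ?h x + 1) (rev D)"
    by (rule sorted_wrt_rev_sub[OF s]) (use D in force)
  moreover have "1 \<le> ?h x \<and> ?h x + 1 < length (rev C) \<and> ?h x \<noteq> ?l \<and> ?h x \<noteq> ?l + 1" if "x \<in> set (rev D)" for x
  proof -
    have "x \<in> set D" using that by simp
    from D[OF this] show ?thesis using l by auto
  qed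
  moreover have "2 < ?l" "?l + 4 < length (rev C)" using l by auto
  ultimately show ?thesis unfolding buffer_on_def by (intro conjI ballI) simp_all
qed

lemma buffer_rev:
  assumes "buffer B xs"
  shows "buffer B (rev xs)"
proof -
  obtain C D l h where c: "cyc xs (C @ D)" and b: "buffer_on B C D l h"
    using assms unfolding buffer_def by blast
  have "cyc (rev xs) (rev C @ rev D)"
    using cyc_rev[OF c] cyc_shift[of "rev xs" "rev D" "rev C"] by simp
  then show ?thesis using buffer_on_rev[OF b] unfolding buffer_def by blast
qed

text \<open>\<open>u\<close> lies between \<open>x\<close> and \<open>y\<close>, with at least two
  vertices of the arc on either side. Whether \<open>u\<close> is joined to \<open>x'\<close> and to
  \<open>y'\<close> decides whether \<open>x\<close> and \<open>y\<close> are ears.\<close>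

locale middle_insertion = ear_insertion +
  fixes C1 C2 :: "'a list" and x' x y y' :: 'a
  assumes A_eq_append: "A = C1 @ [x', x] @ y # y' # C2"
    and cyc_middle: "cyc xs ((C1 @ [x', x]) @ u # (y # y' # C2) @ D)"
    and len_AD: "5 \<le> length A + length D"
begin

lemma rev_middle: "middle_insertion B (rev xs) (rev ys) (rev A) (rev D) (\<lambda>x. length A - 1 - h x) u v1 v2
   (rev C2) (rev C1) y' y x x'"
proof -
  interpret r: ear_insertion B "rev xs" "rev ys" "rev A" "rev D" "\<lambda>x. length A - 1 - h x" u v1 v2
    by (rule rev_insertion)
  show ?thesis
  proof
    show "rev A = rev C2 @ [y', y] @ x # x' # rev C1" using A_eq_append by simp
    have "cyc (rev xs) (rev D @ (rev C2 @ [y', y]) @ u # (x # x' # rev C1))"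
      using cyc_rev[OF cyc_middle] by simp
    then show "cyc (rev xs) ((rev C2 @ [y', y]) @ u # (x # x' # rev C1) @ rev D)"
      using cyc_shift[of "rev xs" "rev D" "(rev C2 @ [y', y]) @ u # x # x' # rev C1"] by simp
  qed (use len_AD in auto)
qed

lemma A_nth: "A ! length C1 = x'" "A ! (length C1 + 1) = x" "A ! (length C1 + 2) = y" "A ! (length C1 + 3) = y'"
  unfolding A_eq_append by (simp_all add: nth_append numeral_eq_Suc)

lemma len_A_eq: "length A = length C1 + length C2 + 4"
  unfolding A_eq_append by simp

lemma dist_middle: "distinct (C1 @ [x', x, y, y'] @ C2)"
  using dist(1) unfolding A_eq_append by simp

lemma in_A: "x' \<in> set A" "x \<in> set A" "y \<in> set A" "y' \<in> set A"
  unfolding A_eq_append by simp_all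

lemma middle_edges: "{x', y} \<in> B" "{x, y'} \<in> B"
  using arc_short[of "length C1"] arc_short[of "length C1 + 1"] A_nth len_A_eq by (simp_all add: numeral_eq_Suc)

lemma cyc_x: "cyc xs (x # (u # y # y' # C2 @ D) @ C1 @ [x'])"
  using cyc_shift[of xs "C1 @ [x']" "x # u # y # y' # C2 @ D"] cyc_middle by simp

lemma ear_x: "{u, x'} \<notin> B \<Longrightarrow> {hd ((u # y # y' # C2 @ D) @ C1 @ [x']), last ((u # y # y' # C2 @ D) @ C1 @ [x'])} \<notin> B"
  by simp

lemma cyc_y: "cyc xs (y # (y' # C2 @ D) @ C1 @ [x', x, u])"
  using cyc_shift[of xs "C1 @ [x', x, u]" "y # y' # C2 @ D"] cyc_middle by simp

lemma ear_y: "{u, y'} \<notin> B \<Longrightarrow> {hd ((y' # C2 @ D) @ C1 @ [x', x, u]), last ((y' # C2 @ D) @ C1 @ [x', x, u])} \<notin> B"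
  by (simp add: insert_commute)

lemma edge_without_u: "a \<in> set A \<union> set D \<Longrightarrow> b \<in> set A \<union> set D \<Longrightarrow> {a, b} \<noteq> {u, v}"
  using dist by (auto simp: doubleton_eq_iff)

lemma first_iff: "a \<in> set A \<union> set D \<Longrightarrow> {A ! 0, a} \<in> B \<longleftrightarrow> a = A ! 2"
proof -
  assume a: "a \<in> set A \<union> set D"
  have l: "0 < length A" "2 < length A" using len_A by linarith+
  show ?thesis
  proof (cases "a \<in> set D")
    case True
    then have "a \<noteq> A ! 2" using A_in[OF l(2)] dist(3) by auto
    then show ?thesis using D_A(2)[OF True l(1)] h_bounds(1)[OF True] by auto
  next
    case False
    then obtain j where j: "j < length A" "a = A ! j" using a by (auto simp: in_set_conv_nth)
    then show ?thesis using A_A[OF l(1) j(1)] A_eq[OF j(1) l(2)] by auto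
  qed
qed

lemma D_x: "d \<in> set D \<Longrightarrow> {x, d} \<in> B \<longleftrightarrow> h d = length C1 + 1"
  using D_A(2)[of d "length C1 + 1"] A_nth(2) len_A_eq by auto

lemma D_not_A: "d \<in> set D \<Longrightarrow> a \<in> set A \<Longrightarrow> d \<noteq> a"
  using dist(3) by auto

text \<open>Both \<open>x\<close> and \<open>y\<close> would be ears. If the arc begins at
  \<open>x'\<close>, cutting off \<open>y\<close> isolates \<open>x'\<close>, and symmetrically at
  the other end. Otherwise \<open>x\<close> and \<open>y\<close>, cut off in turn, have two arc
  edges each, more than the count allows.\<close>

lemma no_ear_pair:
  assumes "{u, x'} \<notin> B" "{u, y'} \<notin> B"
  shows False
proof -
  have first: "C1 \<noteq> []" if uy: "{u, y'} \<notin> B" "{u, x'} \<notin> B"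
  proof
    assume C1: "C1 = []"
    then have 0: "A ! 0 = x'" "A ! 2 = y" using A_nth by (simp_all add: numeral_2_eq_2)
    have "{x', t} \<notin> B" if "t \<in> set ((y' # C2 @ D) @ C1 @ [x', x, u])" "t \<noteq> x'" for t
    proof (cases "t = u")
      case True
      then show ?thesis using uy by (simp add: insert_commute)
    next
      case False
      then have "t \<in> set A \<union> set D" "t \<noteq> y"
        using that cyc_distinct[OF cyc_y] dist_xs A_eq_append by auto
      then show ?thesis using first_iff[of t] 0 by simp
    qed
    then show False using ear_isolates[OF cyc_y ear_y[OF uy(1)], of x'] by simp
  qed
  interpret r: middle_insertion B "rev xs" "rev ys" "rev A" "rev D" "\<lambda>x. length A - 1 - h x" u v1 v2
     "rev C2" "rev C1" y' y x x' by (rule rev_middle)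
  have last: "C2 \<noteq> []"
  proof
    assume C2: "C2 = []"
    then have 0: "rev A ! 0 = y'" "rev A ! 2 = x" using r.A_nth by (simp_all add: numeral_2_eq_2)
    have "{y', t} \<notin> B" if "t \<in> set ((u # y # y' # C2 @ D) @ C1 @ [x'])" "t \<noteq> y'" for t
    proof (cases "t = u")
      case True
      then show ?thesis using assms by (simp add: insert_commute)
    next
      case False
      then have "t \<in> set A \<union> set D" "t \<noteq> x"
        using that cyc_distinct[OF cyc_x] dist_xs A_eq_append by auto
      then show ?thesis using r.first_iff[of t] 0 by simp
    qed
    then show False using ear_isolates[OF cyc_x ear_x[OF assms(1)], of y'] by simp
  qed
  obtain C z where C1: "C1 = C @ [z]" using first[OF assms(2,1)] by (metis rev_exhaust)
  obtain z2 C' where C2: "C2 = z2 # C'" using last by (cases C2) auto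
  have "{z, x} \<in> B" using arc_short[of "length C"] A_eq_append C1 by (simp add: nth_append)
  moreover have "{y, z2} \<in> B" using arc_short[of "length C1 + 2"] A_eq_append C2
    by (simp add: nth_append numeral_eq_Suc)
  moreover have "cyc ((u # y # y' # C2 @ D) @ C1 @ [x']) (y # y' # C2 @ D @ C1 @ [x', u])"
    using cyc_append[of "[u]" "y # y' # C2 @ D @ C1 @ [x']"] by simp
  moreover have "{hd (y' # C2 @ D @ C1 @ [x', u]), last (y' # C2 @ D @ C1 @ [x', u])} \<notin> B"
    using assms(2) by (simp add: insert_commute)
  ultimately show False
    using two_ears_degree[OF cyc_x ear_x[OF assms(1)], of y "y' # C2 @ D @ C1 @ [x', u]" z y' x' z2]
      middle_edges dist_middle C1 C2 by (auto simp: insert_commute)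
qed

text \<open>The edge at u other than the one to \<open>y'\<close> would be superfluous: the arc can be shortened to
  start with u.\<close>

lemma first_unsaturated:
  assumes C1: "C1 = []" and uy: "{u, y'} \<in> B" and no1: "\<And>d. d \<in> set D \<Longrightarrow> h d \<noteq> 1"
  shows False
proof -
  have C2: "C2 \<noteq> []" using no_short_arc_without_one[OF _ no1 len_AD] len_A_eq C1 by auto
  let ?A = "u # y # y' # C2"
  let ?h = "\<lambda>d. if d = x' then 1 else if d = x then 2 else h d - 1"
  obtain v where v: "v = v1 \<or> v = v2" "v \<noteq> y'" using other_neighbour[OF uy] in_A by auto
  have cy: "cyc xs (?A @ D @ [x', x])" using cyc_shift[of xs "[x', x]" "?A @ D"] cyc_middle C1 by simp
  have Ae: "A = x' # x # y # y' # C2" using A_eq_append C1 by simp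
  have "fan_block (B - {{u, v}}) ?A (D @ [x', x]) ?h"
    unfolding fan_block_def
  proof (intro conjI allI impI ballI)
    fix i assume i: "i + 2 < length ?A"
    show "{?A ! i, ?A ! (i + 2)} \<in> B - {{u, v}}"
    proof (cases i)
      case 0
      then show ?thesis using uy v by (auto simp: doubleton_eq_iff)
    next
      case (Suc j)
      have j: "j + 2 + 2 < length A" using i Suc Ae by simp
      have "?A ! i = A ! (j + 2)" "?A ! (i + 2) = A ! (j + 2 + 2)" using Suc Ae by simp_all
      moreover have "A ! (j + 2) \<in> set A" "A ! (j + 2 + 2) \<in> set A" using j by auto
      ultimately show ?thesis using arc_short[OF j] edge_without_u by simp
    qed
  next
    fix d assume d: "d \<in> set (D @ [x', x])"
    have "1 \<le> ?h d \<and> ?h d + 1 < length ?A \<and> {d, ?A ! ?h d} \<in> B - {{u, v}}"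
    proof -
      consider "d = x'" | "d = x" | "d \<in> set D" "d \<noteq> x'" "d \<noteq> x" using d by auto
      then show ?thesis
      proof cases
        case 1
        then show ?thesis using middle_edges edge_without_u[of x' y] in_A by simp
      next
        case 2
        then show ?thesis using middle_edges edge_without_u[of x y'] in_A C2 dist_middle by auto
      next
        case 3
        have hd2: "2 \<le> h d" using h_bounds(1)[OF 3(1)] no1[OF 3(1)] by simp
        then have "?A ! (h d - 1) = A ! h d" using Ae by (auto simp: nth_Cons split: nat.splits)
        moreover have "A ! h d \<in> set A" using h_bounds(2)[OF 3(1)] by simp
        ultimately have "{d, ?A ! (h d - 1)} \<in> B - {{u, v}}"
          using 3(1) D_edge[OF 3(1)] edge_without_u[of d "A ! h d"] by simp
        moreover have "?h d = h d - 1" using 3 by simp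
        moreover have "h d - 1 + 1 < length ?A" using h_bounds(2)[OF 3(1)] hd2 Ae by simp
        moreover have "1 \<le> h d - 1" using hd2 by simp
        ultimately show ?thesis by presburger
      qed
    qed
    then show "1 \<le> ?h d" "?h d + 1 < length ?A" "{d, ?A ! ?h d} \<in> B - {{u, v}}" by blast+
  next
    have nD: "x' \<notin> set D" "x \<notin> set D" using D_not_A in_A by blast+
    have "sorted_wrt (\<lambda>x y. ?h y \<le> ?h x + 1) D"
      by (rule sorted_wrt_mono_rel[OF _ h_almost_decreasing]) (use nD in auto)
    moreover have "2 \<le> h d" if "d \<in> set D" for d using h_bounds(1)[OF that] no1[OF that] by simp
    then have "\<forall>d\<in>set D. ?h x \<le> ?h d + 1 \<and> ?h x' \<le> ?h d + 1" using nD by force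
    ultimately show "sorted_wrt (\<lambda>x y. ?h y \<le> ?h x + 1) (D @ [x', x])"
      using dist_middle unfolding sorted_wrt_append by simp
  qed simp_all
  then show False using sat_fan[OF cy _ v(1)] by blast
qed

text \<open>Both edges at \<open>u\<close> go to the arc, so none goes to \<open>D\<close>. If
  \<open>p\<close> ended left of \<open>u\<close> and a later \<open>q\<close> right of it, the
  triangle \<open>u\<close>, \<open>p\<close>, \<open>q\<close> with fans at \<open>p\<close> and
  \<open>q\<close> would avoid \<open>B\<close>.\<close>

lemma zigzag_middle:
  assumes "{u, x'} \<in> B" "{u, y'} \<in> B" "D = E1 @ p # E2 @ q # E3" "h p \<le> length C1 + 1" "length C1 + 2 \<le> h q"
  shows False
proof -
  have pq: "p \<in> set D" "q \<in> set D" using assms(3) by auto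
  have uD: "{u, d} \<notin> B" if "d \<in> set D" for d
    using neighbours_are[OF assms(1,2)] u_neighbour[of d] D_not_A[OF that] in_A that dist_middle by auto
  have idx: "a \<in> set (y # y' # C2) \<Longrightarrow> \<exists>i. length C1 + 2 \<le> i \<and> i < length A \<and> a = A ! i"
    "a \<in> set (C1 @ [x', x]) \<Longrightarrow> \<exists>i. i \<le> length C1 + 1 \<and> i < length A \<and> a = A ! i" for a
  proof -
    have d: "drop (length C1 + 2) A = y # y' # C2" "take (length C1 + 2) A = C1 @ [x', x]"
      unfolding A_eq_append by simp_all
    show "a \<in> set (y # y' # C2) \<Longrightarrow> \<exists>i. length C1 + 2 \<le> i \<and> i < length A \<and> a = A ! i"
      using set_drop_iff[of a "length C1 + 2" A] d by simp
    show "a \<in> set (C1 @ [x', x]) \<Longrightarrow> \<exists>i. i \<le> length C1 + 1 \<and> i < length A \<and> a = A ! i"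
      using set_take_iff[of a "length C1 + 2" A] d by (auto simp: less_Suc_eq_le)
  qed
  have "tri B (u # ((y # y' # C2) @ E1) @ p # E2 @ q # (E3 @ C1 @ [x', x]))"
  proof (rule tri_zigzag)
    show "\<forall>a\<in>set (u # ((y # y' # C2) @ E1) @ E2 @ [q]). {p, a} \<notin> B"
    proof
      fix a assume "a \<in> set (u # ((y # y' # C2) @ E1) @ E2 @ [q])"
      then consider "a = u" | "a \<in> set (y # y' # C2)" | "a \<in> set D" using assms(3) by auto
      then show "{p, a} \<notin> B"
      proof cases
        case 1
        then show ?thesis using uD[OF pq(1)] by (simp add: insert_commute)
      next
        case 2
        then obtain i where "length C1 + 2 \<le> i" "i < length A" "a = A ! i" using idx(1) by blast
        then show ?thesis using D_A(1)[OF pq(1)] assms(4) by auto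
      next
        case 3
        then show ?thesis using D_D[OF pq(1)] by simp
      qed
    qed
    show "\<forall>a\<in>set ((E3 @ C1 @ [x', x]) @ [u]). {q, a} \<notin> B"
    proof
      fix a assume "a \<in> set ((E3 @ C1 @ [x', x]) @ [u])"
      then consider "a = u" | "a \<in> set (C1 @ [x', x])" | "a \<in> set D" using assms(3) by auto
      then show "{q, a} \<notin> B"
      proof cases
        case 1
        then show ?thesis using uD[OF pq(2)] by (simp add: insert_commute)
      next
        case 2
        then obtain i where "i \<le> length C1 + 1" "i < length A" "a = A ! i" using idx(2) by blast
        then show ?thesis using D_A(1)[OF pq(2)] assms(5) by auto
      next
        case 3
        then show ?thesis using D_D[OF pq(2)] by simp
      qed
    qed
  qed
  moreover have "cyc xs (u # ((y # y' # C2) @ E1) @ p # E2 @ q # (E3 @ C1 @ [x', x]))"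
    using cyc_shift[of xs "C1 @ [x', x]" "u # (y # y' # C2) @ D"] cyc_middle assms(3) by simp
  ultimately show False using not_tri tri_cyc cyc_sym by blast
qed

text \<open>A vertex of \<open>D\<close> at position 1 precedes the last one, which by maximality
  ends right of \<open>u\<close>; \<open>zigzag_middle\<close> excludes this pair. Without such a
  vertex saturation fails.\<close>

lemma first_middle_contradiction:
  assumes "{u, x'} \<in> B" "{u, y'} \<in> B" "C1 = []"
  shows False
proof (cases "\<exists>d\<in>set D. h d = 1")
  case False
  then show False using first_unsaturated[OF assms(3,2)] by blast
next
  case True
  then obtain d where d: "d \<in> set D" "h d = 1" by blast
  obtain D' l where D': "D = D' @ [l]" using d by (metis empty_iff empty_set rev_exhaust)
  then have "h l \<noteq> 1" "1 \<le> h l" using mx(1) h_bounds(1)[of l] by auto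
  then have "d \<in> set D'" using d D' by auto
  then obtain E1 E2 where "D' = E1 @ d # E2" by (meson split_list)
  then show False using zigzag_middle[OF assms(1,2), of E1 d E2 l "[]"] D' d(2) assms(3) \<open>h l \<noteq> 1\<close> \<open>1 \<le> h l\<close>
    by simp
qed

end

section \<open>The types arising in the interior of the arc\<close>

context middle_insertion
begin

lemma nth_insert:
  "k \<le> length C1 + 1 \<Longrightarrow> ((C1 @ [x', x]) @ u # y # y' # C2) ! k = A ! k"
  "length C1 + 2 \<le> k \<Longrightarrow> k < length A \<Longrightarrow> ((C1 @ [x', x]) @ u # y # y' # C2) ! (k + 1) = A ! k"
  "((C1 @ [x', x]) @ u # y # y' # C2) ! (length C1 + 2) = u"
proof -
  have A': "A = (C1 @ [x', x]) @ y # y' # C2" and l: "length (C1 @ [x', x]) = length C1 + 2"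
    using A_eq_append by simp_all
  show "k \<le> length C1 + 1 \<Longrightarrow> ((C1 @ [x', x]) @ u # y # y' # C2) ! k = A ! k"
    unfolding A' nth_append l by simp
  show "length C1 + 2 \<le> k \<Longrightarrow> k < length A \<Longrightarrow> ((C1 @ [x', x]) @ u # y # y' # C2) ! (k + 1) = A ! k"
    unfolding A' nth_append l by (auto simp: Suc_diff_le)
  show "((C1 @ [x', x]) @ u # y # y' # C2) ! (length C1 + 2) = u"
    unfolding nth_append l by simp
qed

lemma insert_h:
  assumes "d \<in> set D"
  shows "((C1 @ [x', x]) @ u # y # y' # C2) ! (if h d \<le> length C1 + 1 then h d else h d + 1) = A ! h d"
  using nth_insert(1)[of "h d"] nth_insert(2)[of "h d"] h_bounds(2)[OF assms] by auto

text \<open>With \<open>u\<close> at position \<open>l\<close>, the vertices \<open>x'\<close>,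
  \<open>x\<close>, \<open>u\<close>, \<open>y\<close>, \<open>y'\<close> are \<open>l - 2\<close>
  to \<open>l + 2\<close>. The four central edges are the two at \<open>u\<close> and the two former
  short diagonals that now pass over \<open>u\<close>.\<close>

lemma sea_middle:
  assumes ux: "{u, x'} \<in> B" "{u, y'} \<in> B" and C: "C1 \<noteq> []" "C2 \<noteq> []"
  shows "sea B xs"
proof -
  define m where "m = length C1"
  let ?C = "(C1 @ [x', x]) @ u # y # y' # C2"
  \<comment> \<open>Positions after \<open>u\<close> shift by one. An increase of \<open>h\<close>
    across \<open>u\<close> could then reach 2, but \<open>zigzag_middle\<close> excludes
    it.\<close>
  let ?h = "\<lambda>d. if h d \<le> m + 1 then h d else h d + 1"
  have m: "1 \<le> m" "m + 5 \<le> length A" "length ?C = length A + 1"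
    using C len_A_eq unfolding m_def by (cases C1; cases C2; simp)+
  have Cn: "?C ! m = x'" "?C ! (m + 1) = x" "?C ! (m + 2) = u" "?C ! (m + 3) = y" "?C ! (m + 4) = y'"
    unfolding m_def by (simp_all add: nth_append numeral_eq_Suc)
  have v: "v1 = x' \<and> v2 = y' \<or> v1 = y' \<and> v2 = x'"
    using neighbours_are[OF ux] in_A dist_middle by auto
  have "sea_on B ?C D (m + 2) ?h"
    unfolding sea_on_def
  proof (intro conjI ballI)
    show "2 < m + 2" "m + 2 + 3 < length ?C" using m by auto
    show "1 \<le> ?h d" "?h d + 1 < length ?C" "?h d \<noteq> m + 2" if "d \<in> set D" for d
      using h_bounds[OF that] m(3) by auto
    show "sorted_wrt (\<lambda>x y. ?h y \<le> ?h x + 1) D"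
    proof (rule sorted_wrt_splitI)
      fix E1 p E2 q E3 assume D: "D = E1 @ p # E2 @ q # E3"
      have "h q \<le> h p + 1" using h_almost_decreasing D by (auto simp: sorted_wrt_append)
      moreover have "\<not> (h p \<le> m + 1 \<and> m + 2 \<le> h q)"
        using zigzag_middle[OF ux D] unfolding m_def by blast
      ultimately show "?h q \<le> ?h p + 1" by auto
    qed
    fix e assume "e \<in> B"
    then show "e = {?C ! (m + 2 - 2), ?C ! (m + 2)} \<or> e = {?C ! (m + 2 - 2), ?C ! (m + 2 + 1)} \<or>
       e = {?C ! (m + 2 - 1), ?C ! (m + 2 + 2)} \<or> e = {?C ! (m + 2), ?C ! (m + 2 + 2)} \<or>
       (\<exists>i. (i + 3 \<le> m + 2 \<or> m + 2 + 1 \<le> i) \<and> i + 2 < length ?C \<and> e = {?C ! i, ?C ! (i + 2)}) \<or>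
       (\<exists>x\<in>set D. e = {x, ?C ! ?h x})"
    proof (cases rule: edge_cases)
      case 1
      then have "e = {?C ! (m + 2 - 2), ?C ! (m + 2)} \<or> e = {?C ! (m + 2), ?C ! (m + 2 + 2)}"
        using v Cn by (auto simp: numeral_eq_Suc insert_commute)
      then show ?thesis by blast
    next
      case 2
      then have "e = {?C ! (m + 2 - 2), ?C ! (m + 2)} \<or> e = {?C ! (m + 2), ?C ! (m + 2 + 2)}"
        using v Cn by (auto simp: numeral_eq_Suc insert_commute)
      then show ?thesis by blast
    next
      case (3 i)
      consider "i + 1 \<le> m" "i + 2 \<le> m + 1" | "i = m" | "i = m + 1" | "m + 2 \<le> i" by linarith
      then show ?thesis
      proof cases
        case 1
        then have "e = {?C ! i, ?C ! (i + 2)}" using 3 nth_insert(1)[of i] nth_insert(1)[of "i + 2"] m_def by simp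
        moreover have "i + 3 \<le> m + 2" "i + 2 < length ?C" using 1 m by auto
        ultimately show ?thesis by blast
      next
        case 2
        then have "e = {?C ! (m + 2 - 2), ?C ! (m + 2 + 1)}" using 3 A_nth Cn m_def by (simp add: numeral_eq_Suc)
        then show ?thesis by blast
      next
        case i: 3
        then have "e = {?C ! (m + 2 - 1), ?C ! (m + 2 + 2)}" using 3 A_nth Cn m_def by (simp add: numeral_eq_Suc)
        then show ?thesis by blast
      next
        case 4
        then have "?C ! (i + 1) = A ! i" "?C ! (i + 2 + 1) = A ! (i + 2)"
          using 3 nth_insert(2)[of i] nth_insert(2)[of "i + 2"] m_def by simp_all
        then have "e = {?C ! (i + 1), ?C ! (i + 1 + 2)}" using 3 by (simp add: add.commute)
        moreover have "m + 2 + 1 \<le> i + 1" "i + 1 + 2 < length ?C" using 4 3 m by auto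
        ultimately show ?thesis by blast
      qed
    next
      case (4 d)
      then have "e = {d, ?C ! ?h d}" using insert_h[of d] unfolding m_def by simp
      then show ?thesis using 4 by blast
    qed
  qed
  moreover have "cyc xs (?C @ D)" using cyc_middle by simp
  ultimately show ?thesis unfolding sea_def by blast
qed

text \<open>Saturation forces a vertex \<open>d\<close> of \<open>D\<close> joined to
  \<open>x\<close>, and it is unique because \<open>x\<close> is an ear. Cutting off
  \<open>x\<close> must not isolate \<open>d\<close>, hence \<open>u\<close> is joined to
  \<open>d\<close>: a bouquet on the arc beginning at \<open>u\<close>, with \<open>p = d\<close>
  and \<open>q = x\<close>.\<close>

lemma right_middle_first:
  assumes ux: "{u, x'} \<notin> B" "{u, y'} \<in> B" and C1: "C1 = []"
  shows "bouquet B xs"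
proof -
  let ?A = "u # y # y' # C2"
  have Ae: "A = x' # x # y # y' # C2" using A_eq_append C1 by simp
  obtain d where d: "d \<in> set D" "h d = 1" using first_unsaturated[OF C1 ux(2)] by blast
  have xd: "{x, b} \<in> B" if "b \<in> set D" "h b = 1" for b using D_x[OF that(1)] that(2) C1 by simp
  have one: "b = d" if "b \<in> set D" "h b = 1" for b
    using ear_degree[OF cyc_x ear_x[OF ux(1)] middle_edges(2) xd[OF d] xd[OF that]]
      D_not_A[OF d(1) in_A(4)] D_not_A[OF that(1) in_A(4)] by metis
  obtain E1 E2 where E: "D = E1 @ d # E2" "E2 \<noteq> []" "\<And>x. x \<in> set E2 \<Longrightarrow> h x = 2"
      "\<And>x. x \<in> set E1 \<Longrightarrow> 2 \<le> h x"
    using last_one_split[OF d one] by metis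
  have ud: "{u, d} \<in> B"
  proof (rule ccontr)
    assume "{u, d} \<notin> B"
    then have du: "{d, u} \<notin> B" by (simp add: insert_commute)
    have "x \<notin> set ((u # y # y' # C2 @ D) @ C1 @ [x'])"
      using cyc_distinct[OF cyc_x] dist_xs by simp
    moreover have "{d, t} \<in> B \<longleftrightarrow> t = x" if "t \<in> set A \<union> set D" for t
      using h_iff[OF d(1) that] d(2) Ae by simp
    ultimately have "{d, t} \<notin> B" if "t \<in> set ((u # y # y' # C2 @ D) @ C1 @ [x'])" for t
      using du that Ae C1 by (cases "t = u") auto
    then show False using ear_isolates[OF cyc_x ear_x[OF ux(1)], of d] d(1) by simp
  qed
  have v: "v1 = d \<and> v2 = y' \<or> v1 = y' \<and> v2 = d"
    using neighbours_are[OF ud ux(2)] D_not_A[OF d(1) in_A(4)] in_A d by auto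
  have "bouquet_on B ?A E1 d (E2 @ [x']) x [] 1 (\<lambda>x. h x - 1)"
    unfolding bouquet_on_def
  proof (intro conjI ballI)
    fix e assume "e \<in> B"
    then show "e = {d, ?A ! (1 - 1)} \<or> e = {x, ?A ! (1 + 1)} \<or> e = {d, x} \<or>
      (\<exists>x\<in>set (E2 @ [x']). e = {x, ?A ! 1}) \<or> (\<exists>i. i + 2 < length ?A \<and> e = {?A ! i, ?A ! (i + 2)}) \<or>
      (\<exists>x\<in>set E1 \<union> set []. e = {x, ?A ! (h x - 1)})"
    proof (cases rule: edge_cases)
      case 1
      then have "e = {d, ?A ! (1 - 1)} \<or> e = {?A ! 0, ?A ! (0 + 2)}" using v by (auto simp: insert_commute)
      moreover have "0 + 2 < length ?A" by simp
      ultimately show ?thesis by blast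
    next
      case 2
      then have "e = {d, ?A ! (1 - 1)} \<or> e = {?A ! 0, ?A ! (0 + 2)}" using v by (auto simp: insert_commute)
      moreover have "0 + 2 < length ?A" by simp
      ultimately show ?thesis by blast
    next
      case (3 i)
      consider "i = 0" | "i = 1" | j where "i = j + 2"
        by (metis One_nat_def add.commute add_2_eq_Suc not0_implies_Suc)
      then show ?thesis
      proof cases
        case 1
        then have "e = {x', ?A ! 1}" using 3 Ae by simp
        moreover have "x' \<in> set (E2 @ [x'])" by simp
        ultimately show ?thesis by blast
      next
        case 2
        then have "e = {x, ?A ! (1 + 1)}" using 3 Ae by simp
        then show ?thesis by blast
      next
        case (3 j)
        then have "e = {?A ! (j + 1), ?A ! (j + 1 + 2)}" "j + 1 + 2 < length ?A"
          using \<open>i + 2 < length A\<close> \<open>e = {A ! i, A ! (i + 2)}\<close> Ae by simp_all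
        then show ?thesis by blast
      qed
    next
      case (4 b)
      then consider "b \<in> set E1" | "b = d" | "b \<in> set E2" using E(1) by auto
      then show ?thesis
      proof cases
        case 1
        obtain k where "h b = k + 2" using E(4)[OF 1] by (metis add.commute le_Suc_ex)
        then have "e = {b, ?A ! (h b - 1)}" using 4 Ae by simp
        then show ?thesis using 1 by blast
      next
        case 2
        then have "e = {d, x}" using 4 d(2) Ae by simp
        then show ?thesis by blast
      next
        case 3
        then have "e = {b, ?A ! 1}" using 4 E(3) Ae by simp
        moreover have "b \<in> set (E2 @ [x'])" using 3 by simp
        ultimately show ?thesis by blast
      qed
    qed
  next
    show "1 \<le> h b - 1" if "b \<in> set E1" for b using E(4)[OF that] by simp
    show "h b - 1 + 1 < length ?A" if "b \<in> set E1" for b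
      using h_bounds[of b] that E(1) Ae E(4)[OF that] by auto
    have "sorted_wrt (\<lambda>x y. h y - 1 \<le> h x - 1 + 1) D"
      by (rule sorted_wrt_mono_rel[OF _ h_almost_decreasing]) auto
    then show "sorted_wrt (\<lambda>x y. h y - 1 \<le> h x - 1 + 1) E1" using E(1) by (simp add: sorted_wrt_append)
  qed simp_all
  moreover have "cyc xs (?A @ E1 @ d # (E2 @ [x']) @ x # [])"
    using cyc_shift[of xs "[x', x]" "?A @ D"] cyc_middle C1 E(1) by simp
  ultimately show ?thesis unfolding bouquet_def by blast
qed

text \<open>\<open>x\<close> is an ear and already has the edges to \<open>y'\<close> and
  \<open>z\<close>.\<close>

lemma not_to_x:
  assumes "{u, x'} \<notin> B" "z \<in> set A" "z \<noteq> y'" "{x, z} \<in> B" "d \<in> set D"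
  shows "h d \<noteq> length C1 + 1"
proof
  assume "h d = length C1 + 1"
  then have "{x, d} \<in> B" using D_x[OF assms(5)] by simp
  then show False
    using ear_degree[OF cyc_x ear_x[OF assms(1)] middle_edges(2) assms(4)] D_not_A[OF assms(5)] assms(2,3) in_A
    by metis
qed

text \<open>Here \<open>f\<close> plays the part of \<open>d\<close> in
  \<open>right_middle_first\<close>: its only arc edge goes to the ear \<open>x\<close>, so it must
  be joined to \<open>u\<close>. The bouquet has \<open>p = f\<close>, \<open>q = x\<close> and only
  \<open>x'\<close> between them.\<close>

lemma right_middle_second:
  assumes ux: "{u, x'} \<notin> B" "{u, y'} \<in> B" and C1: "C1 = [f]"
  shows "bouquet B xs"
proof -
  let ?A = "u # y # y' # C2"
  have Ae: "A = f # x' # x # y # y' # C2" using A_eq_append C1 by simp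
  have f: "f \<in> set A" "f \<noteq> y'" "{x, f} \<in> B"
    using Ae dist(1) arc_short[of 0] by (auto simp: insert_commute)
  have h2: "h d \<noteq> 2" if "d \<in> set D" for d using not_to_x[OF ux(1) f that] C1 by simp
  have h3: "3 \<le> h d" if d: "d \<in> set D" for d
  proof -
    have "h d \<noteq> 1"
    proof
      assume h1: "h d = 1"
      obtain D' l where D': "D = D' @ [l]" using d by (metis empty_iff empty_set rev_exhaust)
      then have "h l \<noteq> 1" "1 \<le> h l" "h l \<noteq> 2" using mx(1) h_bounds(1)[of l] h2[of l] by auto
      moreover have "d \<in> set D'" using d D' h1 \<open>h l \<noteq> 1\<close> by auto
      then have "h l \<le> h d + 1" using h_almost_decreasing D' by (auto simp: sorted_wrt_append)
      ultimately show False using h1 by simp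
    qed
    then show ?thesis using h_bounds(1)[OF d] h2[OF d] by simp
  qed
  have uf: "{u, f} \<in> B"
  proof (rule ccontr)
    assume "{u, f} \<notin> B"
    then have fu: "{f, u} \<notin> B" by (simp add: insert_commute)
    have "x \<notin> set ((u # y # y' # C2 @ D) @ C1 @ [x'])"
      using cyc_distinct[OF cyc_x] dist_xs by simp
    moreover have "{f, t} \<in> B \<longleftrightarrow> t = x" if "t \<in> set A \<union> set D" for t
      using first_iff[OF that] Ae by simp
    ultimately have "{f, t} \<notin> B" if "t \<in> set ((u # y # y' # C2 @ D) @ C1 @ [x'])" for t
      using fu that Ae C1 by (cases "t = u") auto
    then show False using ear_isolates[OF cyc_x ear_x[OF ux(1)], of f] C1 by simp
  qed
  have v: "v1 = f \<and> v2 = y' \<or> v1 = y' \<and> v2 = f"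
    using neighbours_are[OF uf ux(2)] f in_A by auto
  have "bouquet_on B ?A D f [x'] x [] 1 (\<lambda>x. h x - 2)"
    unfolding bouquet_on_def
  proof (intro conjI ballI)
    fix e assume "e \<in> B"
    then show "e = {f, ?A ! (1 - 1)} \<or> e = {x, ?A ! (1 + 1)} \<or> e = {f, x} \<or>
      (\<exists>x\<in>set [x']. e = {x, ?A ! 1}) \<or> (\<exists>i. i + 2 < length ?A \<and> e = {?A ! i, ?A ! (i + 2)}) \<or>
      (\<exists>x\<in>set D \<union> set []. e = {x, ?A ! (h x - 2)})"
    proof (cases rule: edge_cases)
      case 1
      then have "e = {f, ?A ! (1 - 1)} \<or> e = {?A ! 0, ?A ! (0 + 2)}" using v by (auto simp: insert_commute)
      moreover have "0 + 2 < length ?A" by simp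
      ultimately show ?thesis by blast
    next
      case 2
      then have "e = {f, ?A ! (1 - 1)} \<or> e = {?A ! 0, ?A ! (0 + 2)}" using v by (auto simp: insert_commute)
      moreover have "0 + 2 < length ?A" by simp
      ultimately show ?thesis by blast
    next
      case (3 i)
      consider "i = 0" | "i = 1" | "i = 2" | j where "i = j + 3"
        by (metis One_nat_def Suc_1 add.commute less_2_cases less_Suc_eq linorder_not_less numeral_3_eq_3 le_Suc_ex)
      then show ?thesis
      proof cases
        case 1
        then have "e = {f, x}" using 3 Ae by simp
        then show ?thesis by blast
      next
        case 2
        then have "e = {x', ?A ! 1}" using 3 Ae by (simp add: numeral_eq_Suc)
        then show ?thesis by simp
      next
        case i: 3
        then have "e = {x, ?A ! (1 + 1)}" using 3 Ae by (simp add: numeral_eq_Suc)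
        then show ?thesis by blast
      next
        case (4 j)
        then have "e = {?A ! (j + 1), ?A ! (j + 1 + 2)}" "j + 1 + 2 < length ?A"
          using \<open>i + 2 < length A\<close> \<open>e = {A ! i, A ! (i + 2)}\<close> Ae by (simp_all add: numeral_eq_Suc)
        then show ?thesis by blast
      qed
    next
      case (4 b)
      obtain k where "h b = k + 3" using h3[OF 4(1)] by (metis add.commute le_Suc_ex)
      then have "e = {b, ?A ! (h b - 2)}" using 4 Ae by (simp add: numeral_eq_Suc)
      then show ?thesis using 4(1) by blast
    qed
  next
    show "1 \<le> h b - 2" if "b \<in> set D" for b using h3[OF that] by simp
    show "h b - 2 + 1 < length ?A" if "b \<in> set D" for b
      using h_bounds(2)[OF that] h3[OF that] Ae by auto
    show "sorted_wrt (\<lambda>x y. h y - 2 \<le> h x - 2 + 1) D"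
      by (rule sorted_wrt_mono_rel[OF _ h_almost_decreasing]) auto
  qed simp_all
  moreover have "cyc xs (?A @ D @ f # [x'] @ x # [])"
    using cyc_shift[of xs "[f, x', x]" "?A @ D"] cyc_middle C1 by simp
  ultimately show ?thesis unfolding bouquet_def by blast
qed

text \<open>Cutting off \<open>x\<close> and then \<open>x'\<close> would lose four edges unless
  \<open>u\<close> is joined to \<open>z\<close>. If \<open>y'\<close> is the end of the arc, this
  is a bouquet with \<open>p = u\<close>, \<open>q = y'\<close> and \<open>y\<close> between them.
  Otherwise \<open>z\<close>, \<open>x'\<close>, \<open>x\<close>, \<open>u\<close>,
  \<open>y\<close>, \<open>y'\<close> are the vertices \<open>l - 2\<close> to \<open>l + 3\<close>
  of a buffer.\<close>

lemma right_middle_third: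
  assumes ux: "{u, x'} \<notin> B" "{u, y'} \<in> B" and C1: "C1 = C @ [z0, z]"
  shows "bouquet B xs \<or> buffer B xs"
proof -
  define m where "m = length C1"
  have m: "2 \<le> m" "m = length C + 2" unfolding m_def C1 by simp_all
  have Am: "A ! (m - 1) = z" "A ! m = x'" "A ! (m + 1) = x" "A ! (m + 2) = y" "A ! (m + 3) = y'"
    using A_nth C1 m unfolding m_def A_eq_append by (simp_all add: nth_append)
  have lenA: "length A = m + 4 + length C2" using len_A_eq m_def by simp
  have e: "{z, x} \<in> B" "{z0, x'} \<in> B"
    using arc_short[of "length C"] arc_short[of "length C + 1"] C1
    unfolding A_eq_append by (simp_all add: nth_append nth_Cons numeral_eq_Suc)
  have dz: "z \<noteq> y'" "z0 \<noteq> y" "z \<in> set A" using dist_middle A_eq_append C1 by auto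
  have xz: "{x, z} \<in> B" using e by (simp add: insert_commute)
  have not_x: "h d \<noteq> m + 1" if "d \<in> set D" for d
    using not_to_x[OF ux(1) dz(3,1) xz that] m_def by simp
  have uz: "{u, z} \<in> B"
  proof (rule ccontr)
    assume "{u, z} \<notin> B"
    then have "{hd ((u # y # y' # C2 @ D) @ C @ [z0, z]), last ((u # y # y' # C2 @ D) @ C @ [z0, z])} \<notin> B" by simp
    moreover have "cyc ((u # y # y' # C2 @ D) @ C1 @ [x']) (x' # (u # y # y' # C2 @ D) @ C @ [z0, z])"
      using cyc_append[of "(u # y # y' # C2 @ D) @ C1" "[x']"] C1 by simp
    moreover have "{x', z0} \<in> B" using e by (simp add: insert_commute)
    moreover have "x \<noteq> z0" "x \<noteq> y" using dist_middle C1 by auto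
    ultimately show False
      using two_ears_degree[OF cyc_x ear_x[OF ux(1)], of x' "(u # y # y' # C2 @ D) @ C @ [z0, z]" z y' z0 y]
        xz middle_edges dz by blast
  qed
  have v: "v1 = z \<and> v2 = y' \<or> v1 = y' \<and> v2 = z"
    using neighbours_are[OF uz ux(2)] dz in_A by auto
  show ?thesis
  proof (cases "C2 = []")
    case C2: True
    let ?A = "C1 @ [x', x]"
    have small: "h d + 1 \<le> m + 1" if d: "d \<in> set D" for d
    proof -
      have le: "h d \<le> m + 2" using h_bounds(2)[OF d] lenA C2 by simp
      \<comment> \<open>Maximality excludes this for the first vertex of \<open>D\<close>, whose
        position is then at most \<open>m\<close>; later positions exceed it by at most one.\<close>
      have "h d \<noteq> m + 2"
      proof
        assume h1: "h d = m + 2"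
        obtain l D' where D': "D = l # D'" using d by (cases D) auto
        then have l: "h l \<noteq> m + 2" "h l \<le> m + 2" "h l \<noteq> m + 1"
          using mx(2) h_bounds(2)[of l] not_x[of l] lenA C2 by auto
        then have "d \<in> set D'" using d D' h1 by auto
        then have "h d \<le> h l + 1" using h_almost_decreasing D' by auto
        then show False using h1 l by simp
      qed
      then show ?thesis using le not_x[OF d] by simp
    qed
    have An: "?A ! k = A ! k" if "k \<le> m + 1" for k
      using that unfolding A_eq_append m_def by (auto simp: nth_append nth_Cons split: nat.splits)
    have lenC: "length ?A = m + 2" using m_def by simp
    have "bouquet_on B ?A [] u [y] y' D m h"
      unfolding bouquet_on_def
    proof (intro conjI ballI)
      fix e assume "e \<in> B"
      then show "e = {u, ?A ! (m - 1)} \<or> e = {y', ?A ! (m + 1)} \<or> e = {u, y'} \<or>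
        (\<exists>x\<in>set [y]. e = {x, ?A ! m}) \<or> (\<exists>i. i + 2 < length ?A \<and> e = {?A ! i, ?A ! (i + 2)}) \<or>
        (\<exists>x\<in>set [] \<union> set D. e = {x, ?A ! h x})"
      proof (cases rule: edge_cases)
        case 1
        then have "e = {u, ?A ! (m - 1)} \<or> e = {u, y'}" using v An[of "m - 1"] Am by auto
        then show ?thesis by blast
      next
        case 2
        then have "e = {u, ?A ! (m - 1)} \<or> e = {u, y'}" using v An[of "m - 1"] Am by auto
        then show ?thesis by blast
      next
        case (3 i)
        consider "i + 2 \<le> m + 1" | "i = m" | "i = m + 1" using 3 lenA C2 by fastforce
        then show ?thesis
        proof cases
          case 1
          then have "e = {?A ! i, ?A ! (i + 2)}" "i + 2 < length ?A"
            using 3 An[of i] An[of "i + 2"] lenC by simp_all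
          then show ?thesis by blast
        next
          case 2
          then have "e = {y, ?A ! m}" using 3 An[of m] Am by (simp add: insert_commute)
          then show ?thesis by simp
        next
          case i: 3
          have "i + 2 = m + 3" using i by simp
          then have "A ! (i + 2) = y'" using Am(5) by metis
          then have "e = {y', ?A ! (m + 1)}" using 3 i An[of "m + 1"] Am(3) by (simp add: insert_commute)
          then show ?thesis by blast
        qed
      next
        case (4 b)
        then have "e = {b, ?A ! h b}" using An[of "h b"] small[OF 4(1)] by simp
        then show ?thesis using 4(1) by blast
      qed
    next
      show "1 \<le> h b" "h b \<le> m" if "b \<in> set D" for b using h_bounds(1)[OF that] small[OF that] by auto
      show "sorted_wrt (\<lambda>x y. h y \<le> h x + 1) D" by (rule h_almost_decreasing)
    qed (use m lenC in auto)
    moreover have "cyc xs (?A @ [] @ u # [y] @ y' # D)" using cyc_middle C2 by simp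
    ultimately have "bouquet B xs" unfolding bouquet_def by blast
    then show ?thesis ..
  next
    case C2: False
    let ?C = "(C1 @ [x', x]) @ u # y # y' # C2"
    \<comment> \<open>No vertex of \<open>D\<close> ends at \<open>x\<close>, so no increase of
      \<open>h\<close> crosses \<open>u\<close>, and the shift preserves the bound.\<close>
    let ?h = "\<lambda>d. if h d \<le> m + 1 then h d else h d + 1"
    have lenC: "length ?C = length A + 1" "m + 5 \<le> length A"
      using lenA C2 m_def by (cases C2; simp)+
    have Cn: "?C ! (m - 1) = z" "?C ! m = x'" "?C ! (m + 1) = x" "?C ! (m + 2) = u" "?C ! (m + 3) = y" "?C ! (m + 4) = y'"
      using nth_insert(1)[of "m - 1"] Am(1) unfolding m_def by (simp_all add: nth_append numeral_eq_Suc)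
    have "buffer_on B ?C D (m + 1) ?h"
      unfolding buffer_on_def
    proof (intro conjI ballI)
      show "2 < m + 1" "m + 1 + 4 < length ?C" using m lenC by auto
      show "1 \<le> ?h d" "?h d + 1 < length ?C" "?h d \<noteq> m + 1" "?h d \<noteq> m + 1 + 1" if "d \<in> set D" for d
        using h_bounds[OF that] not_x[OF that] lenC by auto
      have "sorted_wrt (\<lambda>x y. h x \<noteq> m + 1 \<and> h y \<noteq> m + 1 \<and> h y \<le> h x + 1) D"
        using h_almost_decreasing by (rule sorted_wrt_mono_rel[rotated]) (use not_x in auto)
      then show "sorted_wrt (\<lambda>x y. ?h y \<le> ?h x + 1) D"
        by (rule sorted_wrt_mono_rel[rotated]) auto
      fix e assume "e \<in> B"
      then show "e = {?C ! (m + 1 - 2), ?C ! (m + 1)} \<or> e = {?C ! (m + 1 - 2), ?C ! (m + 1 + 1)} \<or>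
         e = {?C ! (m + 1 - 1), ?C ! (m + 1 + 2)} \<or> e = {?C ! (m + 1), ?C ! (m + 1 + 3)} \<or>
         e = {?C ! (m + 1 + 1), ?C ! (m + 1 + 3)} \<or>
         (\<exists>i. (i + 3 \<le> m + 1 \<or> m + 1 + 2 \<le> i) \<and> i + 2 < length ?C \<and> e = {?C ! i, ?C ! (i + 2)}) \<or>
         (\<exists>x\<in>set D. e = {x, ?C ! ?h x})"
      proof (cases rule: edge_cases)
        case 1
        then have "e = {?C ! (m + 1 - 2), ?C ! (m + 1 + 1)} \<or> e = {?C ! (m + 1 + 1), ?C ! (m + 1 + 3)}"
          using v Cn by (auto simp: numeral_eq_Suc insert_commute)
        then show ?thesis by blast
      next
        case 2
        then have "e = {?C ! (m + 1 - 2), ?C ! (m + 1 + 1)} \<or> e = {?C ! (m + 1 + 1), ?C ! (m + 1 + 3)}"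
          using v Cn by (auto simp: numeral_eq_Suc insert_commute)
        then show ?thesis by blast
      next
        case (3 i)
        consider "i + 2 \<le> m" | "i + 1 = m" | "i = m" | "i = m + 1" | "m + 2 \<le> i" by linarith
        then show ?thesis
        proof cases
          case 1
          then have "e = {?C ! i, ?C ! (i + 2)}" using 3 nth_insert(1)[of i] nth_insert(1)[of "i + 2"] m_def by simp
          moreover have "i + 3 \<le> m + 1" "i + 2 < length ?C" using 1 lenC by auto
          ultimately show ?thesis by blast
        next
          case 2
          have "i = m - 1" "i + 2 = m + 1" using 2 by simp_all
          then have "e = {?C ! (m + 1 - 2), ?C ! (m + 1)}" using 3 Am Cn by (simp add: numeral_eq_Suc)
          then show ?thesis by blast
        next
          case i: 3
          then have "e = {?C ! (m + 1 - 1), ?C ! (m + 1 + 2)}" using 3 Am Cn by (simp add: numeral_eq_Suc)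
          then show ?thesis by blast
        next
          case 4
          then have "e = {?C ! (m + 1), ?C ! (m + 1 + 3)}" using 3 Am Cn by (simp add: numeral_eq_Suc)
          then show ?thesis by blast
        next
          case 5
          then have "?C ! (i + 1) = A ! i" "?C ! (i + 2 + 1) = A ! (i + 2)"
            using 3 nth_insert(2)[of i] nth_insert(2)[of "i + 2"] m_def by simp_all
          then have "e = {?C ! (i + 1), ?C ! (i + 1 + 2)}" using 3 by (simp add: add.commute)
          moreover have "m + 1 + 2 \<le> i + 1" "i + 1 + 2 < length ?C" using 5 3 lenC by auto
          ultimately show ?thesis by blast
        qed
      next
        case (4 d)
        then have "e = {d, ?C ! ?h d}" using insert_h[of d] unfolding m_def by simp
        then show ?thesis using 4 by blast
      qed
    qed
    moreover have "cyc xs (?C @ D)" using cyc_middle by simp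
    ultimately have "buffer B xs" unfolding buffer_def by blast
    then show ?thesis ..
  qed
qed

lemma right_middle:
  assumes ux: "{u, x'} \<notin> B" "{u, y'} \<in> B"
  shows "bouquet B xs \<or> buffer B xs"
proof -
  consider "C1 = []" | f where "C1 = [f]" | C z0 z where "C1 = C @ [z0, z]"
    by (cases C1 rule: rev_cases; cases "butlast C1" rule: rev_cases; auto)
  then show ?thesis
    using right_middle_first[OF ux] right_middle_second[OF ux] right_middle_third[OF ux] by cases blast+
qed

lemma middle:
  "sea B xs \<or> buffer B xs \<or> bouquet B xs"
proof -
  interpret r: middle_insertion B "rev xs" "rev ys" "rev A" "rev D" "\<lambda>x. length A - 1 - h x" u v1 v2
     "rev C2" "rev C1" y' y x x' by (rule rev_middle)
  consider "{u, x'} \<in> B" "{u, y'} \<in> B" | "{u, x'} \<notin> B" "{u, y'} \<in> B" | "{u, x'} \<in> B" "{u, y'} \<notin> B"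
    using no_ear_pair by blast
  then show ?thesis
  proof cases
    case 1
    then show ?thesis
      using sea_middle first_middle_contradiction r.first_middle_contradiction by blast
  next
    case 2
    then show ?thesis using right_middle by blast
  next
    case 3
    then have "bouquet B (rev xs) \<or> buffer B (rev xs)" using r.right_middle by blast
    then show ?thesis using bouquet_rev[of B "rev xs"] buffer_rev[of B "rev xs"] by auto
  qed
qed

end

section \<open>Combining all places of the inserted vertex\<close>

context ear_insertion
begin

text \<open>If \<open>ys\<close> is a quadrilateral, every rotation of it can serve as
  \<open>A\<close>; the assumption selects the one that places \<open>u\<close> after the arc and so
  reduces to a vertex outside it.\<close>

lemma insertion:
  assumes "D \<noteq> [] \<or> length A \<noteq> 4 \<or> cyc xs (A @ D @ [u])"
  shows "sea B xs \<or> buffer B xs \<or> bouquet B xs"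
  using cyc_u cyc_AD
proof (cases rule: insertion_cases)
  case (1 D1 D2)
  then show ?thesis using bouquet_in_fan[OF 1] by blast
next
  case (2 A1 A2)
  show ?thesis
  proof (cases "D = [] \<and> length A = 4")
    case True
    then have "cyc xs (A @ D @ u # [])" using assms by blast
    then show ?thesis using bouquet_in_fan[of D "[]"] by simp
  next
    case False
    then have len: "5 \<le> length A + length D" using len_A by (cases D) auto
    consider "length A1 = 1" | "length A2 = 1" | "length A1 \<ge> 2" "length A2 \<ge> 2"
      using 2(2,3) by (cases A1; cases A2; cases "tl A1"; cases "tl A2"; auto)
    then show ?thesis
    proof cases
      case a: 1
      then obtain f where f: "A1 = [f]" by (cases A1) auto
      have "Suc (Suc (Suc 0)) \<le> length A2" using len_A 2(1) f by simp
      then obtain c g r A5 where "A2 = c # g # r # A5" unfolding Suc_le_length_iff by blast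
      then show ?thesis using bouquet_after_first[of f c g r A5] 2 f len by simp
    next
      case a: 2
      then obtain e where e: "A2 = [e]" by (cases A2) auto
      then show ?thesis using bouquet_before_last[of A1 e] 2 len by simp
    next
      case a: 3
      obtain C1 x' x where C1: "A1 = C1 @ [x', x]"
        using a(1) by (cases A1 rule: rev_cases; cases "butlast A1" rule: rev_cases; auto)
      obtain y y' C2 where C2: "A2 = y # y' # C2"
        using a(2) by (cases A2; cases "tl A2"; auto)
      interpret middle_insertion B xs ys A D h u v1 v2 C1 C2 x' x y y'
        by unfold_locales (use 2 C1 C2 len in auto)
      show ?thesis by (rule middle)
    qed
  qed
qed

end

section \<open>Conversion to the three types\<close>

text \<open>The outer ends \<open>m + 2 + j\<close> lie beyond all \<open>i j\<close>, so two fan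
  edges cross only if \<open>i\<close> increases with \<open>j\<close>; an increase of at most one
  never concerns targets at distance two.\<close>

lemma fan_okI:
  assumes "\<And>j. j \<in> J \<Longrightarrow> i j \<le> m + 1" "\<And>j1 j2. j1 \<in> J \<Longrightarrow> j2 \<in> J \<Longrightarrow> j1 < j2 \<Longrightarrow> i j2 \<le> i j1 + 1"
  shows "fan_ok m i J"
  unfolding fan_ok_def
proof (intro ballI impI notI)
  fix j1 j2 assume j: "j1 \<in> J" "j2 \<in> J" and far: "i j2 + 2 \<le> i j1 \<or> i j1 + 2 \<le> i j2"
    and "crosses {m + 2 + j1, i j1} {m + 2 + j2, i j2}"
  then have "crosses {i j1, m + 2 + j1} {i j2, m + 2 + j2}" by (simp add: insert_commute)
  then have "i j1 < i j2 \<and> j1 < j2 \<or> i j2 < i j1 \<and> j2 < j1"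
    using assms(1)[OF j(1)] assms(1)[OF j(2)] by (auto simp: crosses_doubleton)
  then show False using assms(2)[OF j] assms(2)[OF j(2,1)] far by auto
qed

lemma short_diags_card: "finite (short_diags lo hi)" "card (short_diags lo hi) \<le> hi + 1 - lo"
proof -
  have "short_diags lo hi = (\<lambda>a. {a, a + 2}) ` {lo..hi}" unfolding short_diags_def by auto
  then show "finite (short_diags lo hi)" "card (short_diags lo hi) \<le> hi + 1 - lo"
    using card_image_le[of "{lo..hi}" "\<lambda>a. {a, a + 2}"] by auto
qed

lemma fan_edges_card: "finite J \<Longrightarrow> finite (fan_edges m i J)" "finite J \<Longrightarrow> card (fan_edges m i J) \<le> card J"
proof -
  have "fan_edges m i J = (\<lambda>j. {m + 2 + j, i j}) ` J" unfolding fan_edges_def by auto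
  then show "finite J \<Longrightarrow> finite (fan_edges m i J)" "finite J \<Longrightarrow> card (fan_edges m i J) \<le> card J"
    using card_image_le[of J "\<lambda>j. {m + 2 + j, i j}"] by auto
qed

text \<open>As \<open>B\<close> has \<open>n - 1\<close> elements, covering it by at most
  \<open>n - 1\<close> rotated edges is already an equality; neither the converse inclusion nor
  distinctness of the listed edges has to be checked.\<close>

lemma rotate_edges_eqI:
  assumes cy: "cyc [0..<n] zs" and n: "0 < n" and B: "card B = n - 1"
    and cover: "\<And>e. e \<in> B \<Longrightarrow> \<exists>f\<in>C. e = (!) zs ` f"
    and C: "finite C" "card C \<le> n - 1" "\<And>f x. f \<in> C \<Longrightarrow> x \<in> f \<Longrightarrow> x < n"
  shows "\<exists>r<n. B = rotate_edges n r C"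
proof -
  obtain k where k: "zs = rotate k [0..<n]" using cy unfolding cyc_iff_rotate by blast
  have nth: "zs ! x = (x + k mod n) mod n" if "x < n" for x
    using that k nth_rotate[of x "[0..<n]" k] by (simp add: add.commute mod_simps)
  have im: "(!) zs ` f = (\<lambda>x. (x + k mod n) mod n) ` f" if "f \<in> C" for f
    using C(3)[OF that] nth by (intro image_cong) auto
  have sub: "B \<subseteq> (\<lambda>f. (!) zs ` f) ` C" using cover by blast
  have fin: "finite ((\<lambda>f. (!) zs ` f) ` C)" using C(1) by simp
  have "card ((\<lambda>f. (!) zs ` f) ` C) \<le> card B"
    using card_image_le[OF C(1), of "\<lambda>f. (!) zs ` f"] C(2) B by simp
  then have "B = (\<lambda>f. (!) zs ` f) ` C" using card_seteq[OF fin sub] by simp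
  also have "\<dots> = rotate_edges n (k mod n) C" unfolding rotate_edges_def by (rule image_cong[OF refl im])
  finally show ?thesis using n by (intro exI[of _ "k mod n"]) auto
qed

lemma sea_type1:
  assumes "sea B [0..<n]" "card B = n - 1"
  shows "\<exists>r<n. \<exists>E. type1 n E \<and> B = rotate_edges n r E"
proof -
  obtain C D l h where cy: "cyc [0..<n] (C @ D)" and sea: "sea_on B C D l h"
    using assms(1) unfolding sea_def by blast
  have l: "2 < l" "l + 3 < length C"
    and hD: "\<And>x. x \<in> set D \<Longrightarrow> 1 \<le> h x \<and> h x + 1 < length C \<and> h x \<noteq> l"
    and so: "sorted_wrt (\<lambda>x y. h y \<le> h x + 1) D"
    using sea by (simp_all add: sea_on_def)
  \<comment> \<open>\<open>C\<close> lists the vertices 0 to \<open>m + 2\<close>, so the vertex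
    \<open>m + 2 + j\<close> is the one with index \<open>j - 1\<close> in \<open>D\<close>.\<close>
  define m where "m = length C - 3"
  define i where "i = (\<lambda>j. h ((C @ D) ! (m + 2 + j)))"
  have lenC: "length C = m + 3" using l unfolding m_def by simp
  have n: "n = m + 3 + length D" using cyc_length[OF cy] lenC by simp
  have lm: "l < m" using l lenC by simp
  have nthD: "(C @ D) ! (m + 2 + j) = D ! (j - 1)" "D ! (j - 1) \<in> set D" if "j \<in> {1..n - 3 - m}" for j
    using that n lenC by (auto simp: nth_append)
  have i: "1 \<le> i j" "i j \<le> m + 1" "i j \<noteq> l" if "j \<in> {1..n - 3 - m}" for j
    using hD[OF nthD(2)[OF that]] nthD(1)[OF that] lenC unfolding i_def by auto
  let ?E = "{{l-2, l}, {l-2, l+1}, {l-1, l+2}, {l, l+2}}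
          \<union> (short_diags 0 (l-3) \<union> short_diags (l+1) m) \<union> fan_edges m i {1..n-3-m}"
  have "type1 n ?E" unfolding type1_def
  proof (intro exI conjI ballI)
    show "i j \<in> {1..l-1} \<union> {l+1..m+1}" if "j \<in> {1..n-3-m}" for j using i[OF that] by auto
    show "fan_ok m i {1..n-3-m}"
    proof (rule fan_okI)
      fix j1 j2 assume j: "j1 \<in> {1..n-3-m}" "j2 \<in> {1..n-3-m}" "j1 < j2"
      then have "h (D ! (j2 - 1)) \<le> h (D ! (j1 - 1)) + 1"
        using so[unfolded sorted_wrt_iff_nth_less, rule_format, of "j1 - 1" "j2 - 1"] n by auto
      then show "i j2 \<le> i j1 + 1" unfolding i_def nthD(1)[OF j(1)] nthD(1)[OF j(2)] .
    qed (use i in auto)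
  qed (use l lm n in auto)
  moreover have "\<exists>r<n. B = rotate_edges n r ?E"
  proof (rule rotate_edges_eqI[OF cy _ assms(2)])
    fix e assume "e \<in> B"
    have Cn: "(C @ D) ! k = C ! k" if "k < m + 3" for k using that lenC by (simp add: nth_append)
    have "e = {C ! (l - 2), C ! l} \<or> e = {C ! (l - 2), C ! (l + 1)} \<or> e = {C ! (l - 1), C ! (l + 2)} \<or>
        e = {C ! l, C ! (l + 2)} \<or> (\<exists>i. (i + 3 \<le> l \<or> l + 1 \<le> i) \<and> i + 2 < length C \<and> e = {C ! i, C ! (i + 2)}) \<or>
        (\<exists>x\<in>set D. e = {x, C ! h x})"
      using sea \<open>e \<in> B\<close> unfolding sea_on_def by simp
    then show "\<exists>f\<in>?E. e = (!) (C @ D) ` f"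
    proof (elim disjE)
      assume "e = {C ! (l - 2), C ! l}"
      then show ?thesis using Cn lm by (intro bexI[of _ "{l - 2, l}"]) auto
    next
      assume "e = {C ! (l - 2), C ! (l + 1)}"
      then show ?thesis using Cn lm by (intro bexI[of _ "{l - 2, l + 1}"]) auto
    next
      assume "e = {C ! (l - 1), C ! (l + 2)}"
      then show ?thesis using Cn lm by (intro bexI[of _ "{l - 1, l + 2}"]) auto
    next
      assume "e = {C ! l, C ! (l + 2)}"
      then show ?thesis using Cn lm by (intro bexI[of _ "{l, l + 2}"]) auto
    next
      assume "\<exists>i. (i + 3 \<le> l \<or> l + 1 \<le> i) \<and> i + 2 < length C \<and> e = {C ! i, C ! (i + 2)}"
      then obtain a where a: "a + 3 \<le> l \<or> l + 1 \<le> a" "a + 2 < m + 3" "e = {C ! a, C ! (a + 2)}"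
        using lenC by auto
      then have "{a, a + 2} \<in> short_diags 0 (l-3) \<union> short_diags (l+1) m"
        unfolding short_diags_def by auto
      then show ?thesis using a Cn by (intro bexI[of _ "{a, a + 2}"]) auto
    next
      assume "\<exists>x\<in>set D. e = {x, C ! h x}"
      then obtain j' where j': "j' < length D" "e = {D ! j', C ! h (D ! j')}" by (metis in_set_conv_nth)
      have j: "Suc j' \<in> {1..n-3-m}" using j' n by auto
      have "(C @ D) ! (m + 2 + Suc j') = D ! j'" using nthD(1)[OF j] by simp
      moreover have "i (Suc j') = h (D ! j')" unfolding i_def nthD(1)[OF j] by simp
      ultimately have "e = (!) (C @ D) ` {m + 2 + Suc j', i (Suc j')}"
        using j' Cn[of "h (D ! j')"] i(2)[OF j] by simp
      moreover have "{m + 2 + Suc j', i (Suc j')} \<in> fan_edges m i {1..n-3-m}"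
        unfolding fan_edges_def using j by blast
      ultimately show ?thesis by blast
    qed
  next
    show "card ?E \<le> n - 1"
    proof -
      have "card {{l-2, l}, {l-2, l+1}, {l-1, l+2}, {l, l+2}} \<le> 4" by (simp add: card_insert_if)
      moreover have "card (short_diags 0 (l-3)) \<le> l - 2" using short_diags_card(2)[of 0 "l-3"] l by simp
      moreover have "card (short_diags (l+1) m) \<le> m - l" using short_diags_card(2)[of "l+1" m] by simp
      moreover have "card (fan_edges m i {1..n-3-m}) \<le> n - 3 - m" using fan_edges_card(2)[of "{1..n-3-m}"] by simp
      moreover have "card ?E \<le> card {{l-2, l}, {l-2, l+1}, {l-1, l+2}, {l, l+2}} +
        (card (short_diags 0 (l-3)) + card (short_diags (l+1) m)) + card (fan_edges m i {1..n-3-m})"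
        by (intro order_trans[OF card_Un_le] add_mono order_refl card_Un_le)
      ultimately show ?thesis using n lm l by linarith
    qed
    show "x < n" if "f \<in> ?E" "x \<in> f" for f x
      using that n lm l i(2) unfolding short_diags_def fan_edges_def by fastforce
  qed (use n in \<open>simp_all add: short_diags_card fan_edges_card\<close>)
  ultimately show ?thesis by blast
qed

lemma buffer_type2:
  assumes "buffer B [0..<n]" "card B = n - 1"
  shows "\<exists>r<n. \<exists>E. type2 n E \<and> B = rotate_edges n r E"
proof -
  obtain C D l h where cy: "cyc [0..<n] (C @ D)" and buf: "buffer_on B C D l h"
    using assms(1) unfolding buffer_def by blast
  have l: "2 < l" "l + 4 < length C"
    and hD: "\<And>x. x \<in> set D \<Longrightarrow> 1 \<le> h x \<and> h x + 1 < length C \<and> h x \<noteq> l \<and> h x \<noteq> l + 1"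
    and so: "sorted_wrt (\<lambda>x y. h y \<le> h x + 1) D"
    using buf by (simp_all add: buffer_on_def)
  define m where "m = length C - 3"
  define i where "i = (\<lambda>j. h ((C @ D) ! (m + 2 + j)))"
  have lenC: "length C = m + 3" using l unfolding m_def by simp
  have n: "n = m + 3 + length D" using cyc_length[OF cy] lenC by simp
  have lm: "l + 1 < m" using l lenC by simp
  have nthD: "(C @ D) ! (m + 2 + j) = D ! (j - 1)" "D ! (j - 1) \<in> set D" if "j \<in> {1..n - 3 - m}" for j
    using that n lenC by (auto simp: nth_append)
  have i: "1 \<le> i j" "i j \<le> m + 1" "i j \<noteq> l" "i j \<noteq> l + 1" if "j \<in> {1..n - 3 - m}" for j
    using hD[OF nthD(2)[OF that]] nthD(1)[OF that] lenC unfolding i_def by auto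
  let ?E = "{{l-2, l}, {l-2, l+1}, {l-1, l+2}, {l, l+3}, {l+1, l+3}}
          \<union> (short_diags 0 (l-3) \<union> short_diags (l+2) m) \<union> fan_edges m i {1..n-3-m}"
  have "type2 n ?E" unfolding type2_def
  proof (intro exI conjI ballI)
    show "i j \<in> {1..l-1} \<union> {l+2..m+1}" if "j \<in> {1..n-3-m}" for j using i[OF that] by auto
    show "fan_ok m i {1..n-3-m}"
    proof (rule fan_okI)
      fix j1 j2 assume j: "j1 \<in> {1..n-3-m}" "j2 \<in> {1..n-3-m}" "j1 < j2"
      then have "h (D ! (j2 - 1)) \<le> h (D ! (j1 - 1)) + 1"
        using so[unfolded sorted_wrt_iff_nth_less, rule_format, of "j1 - 1" "j2 - 1"] n by auto
      then show "i j2 \<le> i j1 + 1" unfolding i_def nthD(1)[OF j(1)] nthD(1)[OF j(2)] .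
    qed (use i in auto)
  qed (use l lm n in auto)
  moreover have "\<exists>r<n. B = rotate_edges n r ?E"
  proof (rule rotate_edges_eqI[OF cy _ assms(2)])
    fix e assume "e \<in> B"
    have Cn: "(C @ D) ! k = C ! k" if "k < m + 3" for k using that lenC by (simp add: nth_append)
    have "e = {C ! (l - 2), C ! l} \<or> e = {C ! (l - 2), C ! (l + 1)} \<or> e = {C ! (l - 1), C ! (l + 2)} \<or>
        e = {C ! l, C ! (l + 3)} \<or> e = {C ! (l + 1), C ! (l + 3)} \<or> (\<exists>i. (i + 3 \<le> l \<or> l + 2 \<le> i) \<and> i + 2 < length C \<and> e = {C ! i, C ! (i + 2)}) \<or>
        (\<exists>x\<in>set D. e = {x, C ! h x})"
      using buf \<open>e \<in> B\<close> unfolding buffer_on_def by simp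
    then show "\<exists>f\<in>?E. e = (!) (C @ D) ` f"
    proof (elim disjE)
      assume "e = {C ! (l - 2), C ! l}"
      then show ?thesis using Cn lm by (intro bexI[of _ "{l - 2, l}"]) auto
    next
      assume "e = {C ! (l - 2), C ! (l + 1)}"
      then show ?thesis using Cn lm by (intro bexI[of _ "{l - 2, l + 1}"]) auto
    next
      assume "e = {C ! (l - 1), C ! (l + 2)}"
      then show ?thesis using Cn lm by (intro bexI[of _ "{l - 1, l + 2}"]) auto
    next
      assume "e = {C ! l, C ! (l + 3)}"
      then show ?thesis using Cn lm by (intro bexI[of _ "{l, l + 3}"]) auto
    next
      assume "e = {C ! (l + 1), C ! (l + 3)}"
      then show ?thesis using Cn lm by (intro bexI[of _ "{l + 1, l + 3}"]) auto
    next
      assume "\<exists>i. (i + 3 \<le> l \<or> l + 2 \<le> i) \<and> i + 2 < length C \<and> e = {C ! i, C ! (i + 2)}"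
      then obtain a where a: "a + 3 \<le> l \<or> l + 2 \<le> a" "a + 2 < m + 3" "e = {C ! a, C ! (a + 2)}"
        using lenC by auto
      then have "{a, a + 2} \<in> short_diags 0 (l-3) \<union> short_diags (l+2) m"
        unfolding short_diags_def by auto
      then show ?thesis using a Cn by (intro bexI[of _ "{a, a + 2}"]) auto
    next
      assume "\<exists>x\<in>set D. e = {x, C ! h x}"
      then obtain j' where j': "j' < length D" "e = {D ! j', C ! h (D ! j')}" by (metis in_set_conv_nth)
      have j: "Suc j' \<in> {1..n-3-m}" using j' n by auto
      have "(C @ D) ! (m + 2 + Suc j') = D ! j'" using nthD(1)[OF j] by simp
      moreover have "i (Suc j') = h (D ! j')" unfolding i_def nthD(1)[OF j] by simp
      ultimately have "e = (!) (C @ D) ` {m + 2 + Suc j', i (Suc j')}"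
        using j' Cn[of "h (D ! j')"] i(2)[OF j] by simp
      moreover have "{m + 2 + Suc j', i (Suc j')} \<in> fan_edges m i {1..n-3-m}"
        unfolding fan_edges_def using j by blast
      ultimately show ?thesis by blast
    qed
  next
    show "card ?E \<le> n - 1"
    proof -
      have "card {{l-2, l}, {l-2, l+1}, {l-1, l+2}, {l, l+3}, {l+1, l+3}} \<le> 5" by (simp add: card_insert_if)
      moreover have "card (short_diags 0 (l-3)) \<le> l - 2" using short_diags_card(2)[of 0 "l-3"] l by simp
      moreover have "card (short_diags (l+2) m) \<le> m - l - 1" using short_diags_card(2)[of "l+2" m] by simp
      moreover have "card (fan_edges m i {1..n-3-m}) \<le> n - 3 - m" using fan_edges_card(2)[of "{1..n-3-m}"] by simp
      moreover have "card ?E \<le> card {{l-2, l}, {l-2, l+1}, {l-1, l+2}, {l, l+3}, {l+1, l+3}} +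
        (card (short_diags 0 (l-3)) + card (short_diags (l+2) m)) + card (fan_edges m i {1..n-3-m})"
        by (intro order_trans[OF card_Un_le] add_mono order_refl card_Un_le)
      ultimately show ?thesis using n lm l by linarith
    qed
    show "x < n" if "f \<in> ?E" "x \<in> f" for f x
      using that n lm l i(2) unfolding short_diags_def fan_edges_def by fastforce
  qed (use n in \<open>simp_all add: short_diags_card fan_edges_card\<close>)
  ultimately show ?thesis by blast
qed

lemma bouquet_type3:
  assumes "bouquet B [0..<n]" "card B = n - 1"
  shows "\<exists>r<n. \<exists>E. type3 n E \<and> B = rotate_edges n r E"
proof -
  obtain A L p M q R l h where cy: "cyc [0..<n] (A @ L @ p # M @ q # R)" and bq: "bouquet_on B A L p M q R l h"
    using assms(1) unfolding bouquet_def by blast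
  have M: "M \<noteq> []" and l: "0 < l" "l + 1 < length A"
    and L: "\<And>x. x \<in> set L \<Longrightarrow> l \<le> h x \<and> h x + 1 < length A" and R: "\<And>x. x \<in> set R \<Longrightarrow> 1 \<le> h x \<and> h x \<le> l"
    and s: "sorted_wrt (\<lambda>x y. h y \<le> h x + 1) L" "sorted_wrt (\<lambda>x y. h y \<le> h x + 1) R"
    using bq by (simp_all add: bouquet_on_def)
  define zs where "zs = A @ L @ p # M @ q # R"
  define m where "m = length A - 3"
  \<comment> \<open>The vertices \<open>p\<close> and \<open>q\<close> are \<open>k\<close> and
    \<open>k + t\<close>, and \<open>M\<close> fills the \<open>t - 1\<close> places between
    them.\<close>
  define k where "k = length A + length L"
  define t where "t = length M + 1"
  define i where "i = (\<lambda>j. h (zs ! (m + 2 + j)))"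
  have lenA: "length A = m + 3" using l unfolding m_def by simp
  have t2: "2 \<le> t" using M unfolding t_def by (cases M) auto
  have n: "n = k + t + 1 + length R" using cyc_length[OF cy] unfolding k_def t_def by simp
  have km: "k = m + 3 + length L" unfolding k_def lenA ..
  have zA: "zs ! x = A ! x" if "x < m + 3" for x using that lenA unfolding zs_def by (simp add: nth_append)
  have zL: "zs ! (m + 2 + j) = L ! (j - 1)" "L ! (j - 1) \<in> set L" if "j \<in> {1..k - m - 3}" for j
    using that km lenA unfolding zs_def by (auto simp: nth_append)
  have zp: "zs ! k = p" unfolding zs_def k_def by (simp add: nth_append)
  have zM: "zs ! (k + s) = M ! (s - 1)" if "1 \<le> s" "s \<le> t - 1" for s
  proof -
    have "s - 1 < length M" using that unfolding t_def by simp
    then show ?thesis using that unfolding zs_def k_def by (simp add: nth_append nth_Cons')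
  qed
  have zq: "zs ! (k + t) = q" unfolding zs_def k_def t_def by (simp add: nth_append nth_Cons')
  have zR': "zs ! (k + t + 1 + x) = R ! x" for x
    unfolding zs_def k_def t_def by (simp add: nth_append nth_Cons')
  have zR: "zs ! (m + 2 + j) = R ! (j - (k + t - m - 1))" "R ! (j - (k + t - m - 1)) \<in> set R"
    if "j \<in> {k+t-m-1..n-3-m}" for j
  proof -
    \<comment> \<open>The smallest index \<open>k + t - m - 1\<close> belongs to the vertex
      \<open>k + t + 1\<close>, the first one after \<open>q\<close>.\<close>
    have "m + 2 + j = k + t + 1 + (j - (k + t - m - 1))" using that km t2 by auto
    then show "zs ! (m + 2 + j) = R ! (j - (k + t - m - 1))" using zR' by metis
    show "R ! (j - (k + t - m - 1)) \<in> set R" using that n km t2 by (intro nth_mem) auto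
  qed
  have iL: "l \<le> i j" "i j \<le> m + 1" if "j \<in> {1..k - m - 3}" for j
    using L[OF zL(2)[OF that]] lenA unfolding i_def zL(1)[OF that] by auto
  have iR: "1 \<le> i j" "i j \<le> l" if "j \<in> {k+t-m-1..n-3-m}" for j
    using R[OF zR(2)[OF that]] unfolding i_def zR(1)[OF that] by auto
  let ?E1 = "{{l-1, l+1}, {k, l-1}, {k+t, l+1}, {k, k+t}}" and ?E2 = "{{k+s, l} | s. 1 \<le> s \<and> s \<le> t - 1}"
    and ?E3 = "{{a, a + 2} | a. l \<le> a \<and> a \<le> m}" and ?E4 = "{{a, a + 2} | a. a + 2 \<le> l}"
    and ?E5 = "fan_edges m i {1..k-m-3}" and ?E6 = "fan_edges m i {k+t-m-1..n-3-m}"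
  let ?E = "(?E1 \<union> ?E2) \<union> ?E3 \<union> ?E4 \<union> ?E5 \<union> ?E6"
  have fans: "fan_ok m i ({1..k-m-3} \<union> {k+t-m-1..n-3-m})"
  proof (rule fan_okI)
    show "i j \<le> m + 1" if "j \<in> {1..k-m-3} \<union> {k+t-m-1..n-3-m}" for j
      using that iL(2)[of j] iR(2)[of j] l lenA by fastforce
    fix j1 j2 assume j: "j1 \<in> {1..k-m-3} \<union> {k+t-m-1..n-3-m}" "j2 \<in> {1..k-m-3} \<union> {k+t-m-1..n-3-m}" "j1 < j2"
    then consider "j1 \<in> {1..k-m-3}" "j2 \<in> {1..k-m-3}" | "j1 \<in> {1..k-m-3}" "j2 \<in> {k+t-m-1..n-3-m}"
      | "j1 \<in> {k+t-m-1..n-3-m}" "j2 \<in> {k+t-m-1..n-3-m}"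
      using km t2 by fastforce
    then show "i j2 \<le> i j1 + 1"
    proof cases
      case 1
      then have "h (L ! (j2 - 1)) \<le> h (L ! (j1 - 1)) + 1"
        using s(1)[unfolded sorted_wrt_iff_nth_less, rule_format, of "j1 - 1" "j2 - 1"] j(3) km by auto
      then show ?thesis unfolding i_def zL(1)[OF 1(1)] zL(1)[OF 1(2)] .
    next
      case 2
      then show ?thesis using iL(1)[OF 2(1)] iR(2)[OF 2(2)] by simp
    next
      case 3
      have "j1 - (k + t - m - 1) < j2 - (k + t - m - 1)" "j2 - (k + t - m - 1) < length R"
        using 3 j(3) n km t2 by auto
      then have "h (R ! (j2 - (k + t - m - 1))) \<le> h (R ! (j1 - (k + t - m - 1))) + 1"
        using s(2) unfolding sorted_wrt_iff_nth_less by blast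
      then show ?thesis unfolding i_def zR(1)[OF 3(1)] zR(1)[OF 3(2)] .
    qed
  qed
  have "type3 n ?E" unfolding type3_def
    by (rule exI[of _ m], rule exI[of _ l], rule exI[of _ k], rule exI[of _ t], rule exI[of _ i])
      (use l lenA km t2 n iL iR fans in auto)
  moreover have "\<exists>r<n. B = rotate_edges n r ?E"
  proof (rule rotate_edges_eqI[OF cy[folded zs_def] _ assms(2)])
    fix e assume "e \<in> B"
    then have "e = {p, A ! (l - 1)} \<or> e = {q, A ! (l + 1)} \<or> e = {p, q} \<or> (\<exists>x\<in>set M. e = {x, A ! l}) \<or>
        (\<exists>i. i + 2 < length A \<and> e = {A ! i, A ! (i + 2)}) \<or> (\<exists>x\<in>set L \<union> set R. e = {x, A ! h x})"
      using bq unfolding bouquet_on_def by simp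
    then show "\<exists>f\<in>?E. e = (!) zs ` f"
    proof (elim disjE)
      assume "e = {p, A ! (l - 1)}"
      then show ?thesis using zA[of "l - 1"] zp l lenA by (intro bexI[of _ "{k, l - 1}"]) auto
    next
      assume "e = {q, A ! (l + 1)}"
      then show ?thesis using zA[of "l + 1"] zq l lenA by (intro bexI[of _ "{k + t, l + 1}"]) auto
    next
      assume "e = {p, q}"
      then show ?thesis using zp zq by (intro bexI[of _ "{k, k + t}"]) auto
    next
      assume "\<exists>x\<in>set M. e = {x, A ! l}"
      then obtain j where j: "j < length M" "e = {M ! j, A ! l}" by (metis in_set_conv_nth)
      have "1 \<le> Suc j \<and> Suc j \<le> t - 1" using j unfolding t_def by simp
      then have "{k + Suc j, l} \<in> ?E2" by blast
      then have mem: "{k + Suc j, l} \<in> ?E" by (simp only: Un_iff simp_thms)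
      have "e = (!) zs ` {k + Suc j, l}" using zM[of "Suc j"] zA[of l] j l lenA unfolding t_def by simp
      from bexI[where P = "\<lambda>f. e = (!) zs ` f", OF this mem] show ?thesis .
    next
      assume "\<exists>i. i + 2 < length A \<and> e = {A ! i, A ! (i + 2)}"
      then obtain a where a: "a + 2 < m + 3" "e = {A ! a, A ! (a + 2)}" using lenA by auto
      then have eq: "e = (!) zs ` {a, a + 2}" using zA[of a] zA[of "a + 2"] by simp
      have "{a, a + 2} \<in> ?E1 \<union> ?E3 \<union> ?E4"
      proof -
        \<comment> \<open>The short diagonal around \<open>l\<close> is listed with the bouquet;
          those before and after it form the two separate families.\<close>
        consider "a + 2 \<le> l" | "l = a + 1" | "l \<le> a" by linarith
        then show ?thesis
        proof cases
          case 1
          then have "{a, a + 2} \<in> ?E4" by blast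
          then show ?thesis by (simp only: Un_iff simp_thms)
        next
          case 2
          then show ?thesis by (simp add: numeral_2_eq_2)
        next
          case 3
          have "a \<le> m" using a by simp
          then have "{a, a + 2} \<in> ?E3" using 3 by blast
          then show ?thesis by (simp only: Un_iff simp_thms)
        qed
      qed
      then have "{a, a + 2} \<in> ?E" unfolding Un_iff by argo
      from bexI[where P = "\<lambda>f. e = (!) zs ` f", OF eq this] show ?thesis .
    next
      assume "\<exists>x\<in>set L \<union> set R. e = {x, A ! h x}"
      then obtain x where x: "x \<in> set L \<union> set R" "e = {x, A ! h x}" by blast
      have "\<exists>j\<in>{1..k-m-3} \<union> {k+t-m-1..n-3-m}. zs ! (m + 2 + j) = x"
      proof (cases "x \<in> set L")
        case True
        then obtain j where j: "j < length L" "x = L ! j" by (metis in_set_conv_nth)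
        then have "Suc j \<in> {1..k-m-3}" using km by auto
        then show ?thesis using zL(1)[of "Suc j"] j by (metis UnI1 diff_Suc_1)
      next
        case False
        then have "x \<in> set R" using x(1) by simp
        then obtain j where j: "j < length R" "x = R ! j" by (metis in_set_conv_nth)
        have "j + (k + t - m - 1) \<in> {k+t-m-1..n-3-m}" using j n km t2 by auto
        then show ?thesis using zR(1)[of "j + (k + t - m - 1)"] j by (metis UnI2 add_diff_cancel_right')
      qed
      then obtain j where j: "j \<in> {1..k-m-3} \<union> {k+t-m-1..n-3-m}" "zs ! (m + 2 + j) = x" by blast
      have ij: "i j = h x" unfolding i_def j(2) ..
      have "i j < m + 3" using j(1) iL(2)[of j] iR(2)[of j] l lenA by fastforce
      then have eq: "e = (!) zs ` {m + 2 + j, i j}" using x(2) j(2) zA[of "i j"] ij by simp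
      have "{m + 2 + j, i j} \<in> ?E5 \<union> ?E6" using j(1) unfolding fan_edges_def by blast
      then have "{m + 2 + j, i j} \<in> ?E" unfolding Un_iff by argo
      from bexI[where P = "\<lambda>f. e = (!) zs ` f", OF eq this] show ?thesis .
    qed
  next
    have E2: "?E2 = (\<lambda>s. {k + s, l}) ` {1..t - 1}" and E3: "?E3 = (\<lambda>a. {a, a + 2}) ` {l..m}" by auto
    have E4: "?E4 = (\<lambda>a. {a, a + 2}) ` {a. a + 2 \<le> l}" by auto
    have a4: "{a. a + 2 \<le> l} = {..<l - 1}" using l by auto
    show "finite ?E" unfolding E2 E3 E4 a4 by (simp add: fan_edges_card)
    show "card ?E \<le> n - 1"
    proof -
      have "card ?E1 \<le> 4" by (simp add: card_insert_if)
      moreover have "card ?E2 \<le> length M"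
        unfolding E2 using card_image_le[of "{1..t - 1}" "\<lambda>s. {k + s, l}"] by (simp add: t_def)
      moreover have "card ?E3 + l \<le> m + 1"
        unfolding E3 using card_image_le[of "{l..m}" "\<lambda>a. {a, a + 2}"] l lenA by simp
      moreover have "card ?E4 + 1 \<le> l"
        unfolding E4 a4 using card_image_le[of "{..<l-1}" "\<lambda>a. {a, a + 2}"] l by simp
      moreover have "card ?E5 \<le> length L" using fan_edges_card(2)[of "{1..k-m-3}"] km by simp
      moreover have "card ?E6 \<le> length R"
      proof -
        have "n - 3 - m = (k + t - m - 1) + length R - 1" using n km t2 by linarith
        then have "card {k+t-m-1..n-3-m} = length R" using km by simp
        then show ?thesis using fan_edges_card(2)[of "{k+t-m-1..n-3-m}"] by (metis finite_atLeastAtMost)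
      qed
      moreover have "card ?E \<le> card ?E1 + card ?E2 + card ?E3 + card ?E4 + card ?E5 + card ?E6"
        by (intro order_trans[OF card_Un_le] add_mono order_refl)
      moreover have "n = m + 5 + length L + length M + length R" using n km unfolding t_def by simp
      ultimately show ?thesis by linarith
    qed
    show "x < n" if "f \<in> ?E" "x \<in> f" for f x
    proof -
      consider "f \<in> ?E1" | "f \<in> ?E2" | "f \<in> ?E3 \<union> ?E4" | "f \<in> ?E5 \<union> ?E6" using \<open>f \<in> ?E\<close> by blast
      then show ?thesis
      proof cases
        case 4
        then obtain j where j: "j \<in> {1..k-m-3} \<union> {k+t-m-1..n-3-m}" "f = {m + 2 + j, i j}"
          unfolding fan_edges_def by blast
        have "i j < m + 3" using j(1) iL(2)[of j] iR(2)[of j] l lenA by fastforce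
        then show ?thesis using j \<open>x \<in> f\<close> n km t2 by auto
      qed (use \<open>x \<in> f\<close> n km l lenA t2 in auto)
    qed
  qed (use n in simp)
  ultimately show ?thesis by blast
qed

section \<open>From the degree hypothesis to the list setting\<close>

lemma diagonals_ge_4:
  assumes "e \<in> diagonals n"
  shows "4 \<le> n"
proof (rule ccontr)
  assume "\<not> 4 \<le> n"
  obtain i j where ij: "i < j" "j < n" "e = {i, j}" and side: "\<not> is_side n e"
    using assms unfolding diagonals_def is_edge_def by blast
  have "j = i + 1 \<or> i = 0 \<and> j = 2 \<and> n = 3" using ij \<open>\<not> 4 \<le> n\<close> by linarith
  then have "is_side n e"
  proof
    assume "j = i + 1"
    then show ?thesis unfolding is_side_def using ij by (intro exI[of _ i]) simp
  next
    assume "i = 0 \<and> j = 2 \<and> n = 3"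
    then show ?thesis unfolding is_side_def using ij by (intro exI[of _ 2]) (simp add: insert_commute)
  qed
  then show False using side by simp
qed

lemma diagonals_sidefree:
  assumes "B \<subseteq> diagonals n" "3 \<le> n"
  shows "sidefree B [0..<n]"
proof -
  have "{i, Suc i} \<notin> B" if "Suc i < n" for i
  proof -
    have "is_side n {i, Suc i}" unfolding is_side_def using that by (intro exI[of _ i]) simp
    then show ?thesis using assms(1) unfolding diagonals_def by blast
  qed
  moreover have "is_side n {n - 1, 0}" unfolding is_side_def using assms(2) by (intro exI[of _ "n - 1"]) auto
  then have "{n - 1, 0} \<notin> B" using assms(1) unfolding diagonals_def by blast
  ultimately show ?thesis using assms(2)
    unfolding sidefree_def by (auto simp: successively_conv_nth hd_conv_nth last_conv_nth)
qed

text \<open>The polygon without \<open>u\<close> is read from \<open>u + 1\<close> around to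
  \<open>u - 1\<close>. Only the two edges at \<open>u\<close> are lost, which leaves
  \<open>n - 3\<close> edges on \<open>n - 1\<close> vertices, so
  \<open>min_blocked_structure\<close> applies.\<close>

lemma degree_two_ear:
  fixes B :: "edge set"
  assumes nk: "nk_blocker n (n - 1) B" and u: "u < n" "deg B u = 2"
    and short: "{(u + n - 1) mod n, (u + 1) mod n} \<notin> B"
  shows "sea B [0..<n] \<or> buffer B [0..<n] \<or> bouquet B [0..<n]"
proof -
  have Bd: "B \<subseteq> diagonals n" and cardB: "card B = n - 1"
    and sat: "\<And>e. e \<in> B \<Longrightarrow> \<not> blocker n (B - {e})" and blk: "blocker n B"
    using nk unfolding nk_blocker_def saturated_blocker_def blocker_def by auto
  have "{e\<in>B. u \<in> e} \<noteq> {}" using u(2) unfolding deg_def by (metis card.empty zero_neq_numeral)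
  then have n4: "4 \<le> n" using diagonals_ge_4[of _ n] Bd by blast
  let ?xs = "[0..<n]" and ?ys = "[u+1..<n] @ [0..<u]"
  have edges: "\<exists>x\<in>set ?xs. \<exists>y\<in>set ?xs. x \<noteq> y \<and> e = {x, y}" if e: "e \<in> B" for e
  proof -
    obtain i j where "i < j" "j < n" "e = {i, j}"
      using e Bd unfolding diagonals_def is_edge_def by blast
    then have "i \<in> set ?xs" "j \<in> set ?xs" "i \<noteq> j" "e = {i, j}" by auto
    then show ?thesis by blast
  qed
  have no_loop: "{x} \<notin> B" for x using edges[of "{x}"] by (auto simp: doubleton_eq_iff)
  have sf: "sidefree B ?xs" using diagonals_sidefree[OF Bd] n4 by simp
  have nt: "\<not> tri B ?xs" using blocker_imp_not_tri[OF blk] n4 by simp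
  have st: "etri (B - {e}) ?xs" if "e \<in> B" for e
    using not_blocker_imp_etri[OF sat[OF that]] Bd n4 by auto
  have "?xs = [0..<u] @ u # [u+1..<n]" using u(1) upt_add_eq_append[of 0 u "n - u"] upt_conv_Cons[of u n] by simp
  then have cu: "cyc ?xs (u # ?ys)" using cyc_append[of "[0..<u]" "u # [u+1..<n]"] by simp
  have hd: "hd ?ys = (u + 1) mod n"
    using u(1) n4 by (cases "u + 1 = n") (auto simp: hd_append)
  have last: "last ?ys = (u + n - 1) mod n"
  proof (cases "u = 0")
    case False
    then have "(u + n - 1) mod n = (n + (u - 1)) mod n" by (simp add: add.commute)
    also have "\<dots> = u - 1" using u(1) by simp
    finally show ?thesis using False by simp
  qed (use n4 in auto)
  have ear: "{hd ?ys, last ?ys} \<notin> B" using short unfolding hd last by (simp add: insert_commute)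
  have d: "distinct (u # ?ys)" using cyc_distinct[OF cu] by simp
  have sfu: "sidefree B (u # ?ys)" using sidefree_cyc[OF cu sf] .
  have leny: "length ?ys = n - 1" using u(1) by simp
  obtain e1 e2 where e12: "{e\<in>B. u \<in> e} = {e1, e2}" "e1 \<noteq> e2"
    using u(2) unfolding deg_def card_2_iff by blast
  have "e1 \<in> {e\<in>B. u \<in> e}" "e2 \<in> {e\<in>B. u \<in> e}" unfolding e12(1) by simp_all
  then have e12B: "e1 \<in> B" "u \<in> e1" "e2 \<in> B" "u \<in> e2" by simp_all
  have other: "\<exists>v\<in>set ?ys. e = {u, v}" if e: "e \<in> B" "u \<in> e" for e
  proof -
    obtain x y where xy: "x \<in> set ?xs" "y \<in> set ?xs" "x \<noteq> y" "e = {x, y}" using edges[OF e(1)] by blast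
    have su: "x = u \<or> x \<in> set ?ys" "y = u \<or> y \<in> set ?ys"
      using xy(1,2) cyc_set[OF cu] by (metis set_ConsD)+
    from e(2) consider "x = u" | "y = u" using xy(4) by blast
    then show ?thesis
    proof cases
      case 1
      then have "y \<in> set ?ys" "e = {u, y}" using su(2) xy(3,4) by simp_all
      then show ?thesis by (rule bexI[rotated])
    next
      case 2
      then have "x \<in> set ?ys" "e = {u, x}" using su(1) xy(3,4) by (simp_all add: insert_commute)
      then show ?thesis by (rule bexI[rotated])
    qed
  qed
  obtain v1 where v1: "v1 \<in> set ?ys" "e1 = {u, v1}" using other[OF e12B(1,2)] by (elim bexE)
  obtain v2 where v2: "v2 \<in> set ?ys" "e2 = {u, v2}" using other[OF e12B(3,4)] by (elim bexE)
  have v12: "v1 \<noteq> v2" using e12(2) v1(2) v2(2) by auto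
  have u_iff: "{u, y} \<in> B \<longleftrightarrow> y = v1 \<or> y = v2" if "y \<in> set ?ys" for y
  proof -
    have "{u, y} \<in> {e\<in>B. u \<in> e} \<longleftrightarrow> {u, y} \<in> {e1, e2}" by (simp only: e12(1))
    then show ?thesis using v1 v2 by (auto simp: doubleton_eq_iff)
  qed
  have yne: "?ys \<noteq> []" using leny n4 by auto
  have "hd ?ys \<in> set ?ys" "last ?ys \<in> set ?ys" using yne by (meson hd_in_set last_in_set)+
  have "{u, hd ?ys} \<notin> B" "{u, last ?ys} \<notin> B"
    using sfu yne unfolding sidefree_def by (auto simp: successively_Cons insert_commute)
  then have "v1 \<noteq> hd ?ys" "v1 \<noteq> last ?ys" "v2 \<noteq> hd ?ys" "v2 \<noteq> last ?ys"
    using u_iff v1 v2 by auto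
  moreover have "hd ?ys \<noteq> last ?ys"
    using d leny n4 by (cases ?ys; cases "tl ?ys") auto
  \<comment> \<open>Sides are not in \<open>B\<close>, so the neighbours of \<open>u\<close> in
    \<open>B\<close> differ from those on the polygon, and at least four vertices remain.\<close>
  ultimately have four: "card {v1, v2, hd ?ys, last ?ys} = 4" using v12 by auto
  have sub: "{v1, v2, hd ?ys, last ?ys} \<subseteq> set ?ys"
    using v1(1) v2(1) \<open>hd ?ys \<in> set ?ys\<close> \<open>last ?ys \<in> set ?ys\<close> by blast
  have "4 \<le> card (set ?ys)" using card_mono[OF finite_set sub] unfolding four .
  then have len4: "4 \<le> length ?ys" using card_length[of ?ys] by (rule order_trans)
  have wB: "within B ?ys = B - {e1, e2}"
  proof -
    have "e \<in> within B ?ys \<longleftrightarrow> u \<notin> e" if "e \<in> B" for e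
      using edges[OF that] cyc_set[OF cu] d that unfolding within_def by auto
    then have "within B ?ys = B - {e\<in>B. u \<in> e}" unfolding within_def by blast
    then show ?thesis by (simp only: e12(1))
  qed
  have "{e1, e2} \<subseteq> B" using e12B by blast
  then have "card (within B ?ys) = n - 1 - 2"
    using e12(2) cardB unfolding wB by (simp add: card_Diff_subset)
  then have mb: "min_blocked B ?ys"
    unfolding min_blocked_def
    using d len4 leny no_loop not_tri_ear[OF nt cu ear] sidefree_Cons_ear[OF sfu ear] by auto
  \<comment> \<open>For a quadrilateral the list \<open>?ys\<close> itself is taken as the arc, so
    that \<open>u\<close> follows it.\<close>
  have "\<exists>A D. cyc ?ys (A @ D) \<and> arc_fan B A D \<and> maximal_arc B A D \<and> (D \<noteq> [] \<or> length A \<noteq> 4 \<or> cyc ?xs (A @ D @ [u]))"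
  proof (cases "length ?ys = 4")
    case True
    then have "arc_fan B ?ys []" using arc_fan_quadrilateral mb by blast
    moreover have "cyc ?xs (?ys @ [] @ [u])" using cyc_shift[of ?xs "[u]" ?ys] cu by simp
    moreover have "maximal_arc B ?ys []" unfolding maximal_arc_def by simp
    ultimately show ?thesis using cyc_refl[of ?ys] by (metis append_Nil2)
  next
    case False
    obtain A D where AD: "cyc ?ys (A @ D)" "arc_fan B A D" "maximal_arc B A D"
      using min_blocked_structure[OF mb] by blast
    have "D \<noteq> [] \<or> length A \<noteq> 4" using cyc_length[OF AD(1)] False by auto
    then show ?thesis using AD by blast
  qed
  then obtain A D where AD: "cyc ?ys (A @ D)" "arc_fan B A D" "maximal_arc B A D"
    "D \<noteq> [] \<or> length A \<noteq> 4 \<or> cyc ?xs (A @ D @ [u])" by blast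
  have "\<forall>x\<in>set D. \<exists>k. 1 \<le> k \<and> k + 1 < length A \<and> (\<forall>y\<in>set (A @ D). {x, y} \<in> B \<longleftrightarrow> y = A ! k)"
    using AD(2) unfolding arc_fan_def by blast
  then obtain h where h: "\<forall>x\<in>set D. 1 \<le> h x \<and> h x + 1 < length A \<and> (\<forall>y\<in>set (A @ D). {x, y} \<in> B \<longleftrightarrow> y = A ! h x)"
    by metis
  have A4: "4 \<le> length A" "arc B A" using AD(2) unfolding arc_fan_def by auto
  have hA: "{x, A ! h x} \<in> B" if "x \<in> set D" for x
  proof -
    have "h x + 1 < length A" using h that by blast
    then have "A ! h x \<in> set (A @ D)" by simp
    then show ?thesis using h that by blast
  qed
  interpret ear_insertion B ?xs ?ys A D h u v1 v2
  proof
    show "h (last D) \<noteq> 1" if "D \<noteq> []"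
      using AD(3) that hA[of "last D"] unfolding maximal_arc_def by (auto simp: insert_commute)
    show "h (hd D) + 2 \<noteq> length A" if "D \<noteq> []"
    proof
      assume "h (hd D) + 2 = length A"
      then have "A ! h (hd D) = A ! (length A - 2)" by (metis add_diff_cancel_right')
      then show False using AD(3) that hA[of "hd D"] unfolding maximal_arc_def by (auto simp: insert_commute)
    qed
    show "{x, y} \<in> B \<longleftrightarrow> y = A ! h x" if "x \<in> set D" "y \<in> set A \<union> set D" for x y
      using h that by auto
    show "\<exists>x\<in>set ?xs. \<exists>y\<in>set ?xs. e = {x, y}" if "e \<in> B" for e using edges[OF that] by blast
    show "card B + 1 = length ?xs" using cardB n4 by simp
  qed (fact distinct_upt sf no_loop nt st cu ear AD(1) A4 v1(1) v2(1) v12 u_iff | use h in blast)+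
  show ?thesis by (rule insertion[OF AD(4)])
qed

theorem theorem4p11:
  fixes n :: nat and B :: "nat set set"
  assumes "nk_blocker n (n - 1) B"
    and "\<exists>u<n. deg B u = 2 \<and> {(u + n - 1) mod n, (u + 1) mod n} \<notin> B"
  shows "\<exists>r<n. \<exists>C. (type1 n C \<or> type2 n C \<or> type3 n C) \<and> B = rotate_edges n r C"
proof -
  have "sea B [0..<n] \<or> buffer B [0..<n] \<or> bouquet B [0..<n]"
    using degree_two_ear assms by blast
  moreover have "card B = n - 1" using assms(1) unfolding nk_blocker_def by simp
  ultimately show ?thesis using sea_type1 buffer_type2 bouquet_type3 by blast
qed

end
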